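(* Let $\lambda\notin\mathrm{rg}(m_\mu)$ be an eigenvalue of $U_\mu$ and let $V\subset\mathbb{C}$ be an open set such that $V\cap\sigma(U_\mu)=\{\lambda\}$. Then: (1) $U_{n,\mu}$ converges compactly to $U_\mu$ almost surely. (2) The eigenvalues in $\sigma(U_{n,\mu})\cap V$ converge to $\lambda$ almost surely. (3) If $\mathrm{Pr}_n$ is the spectral projection of $\sigma(U_{n,\mu})\cap V$ (for the operator $U_{n,\mu}$) and $\mathrm{Pr}$ is the spectral projection of $\sigma(U_\mu)\cap V$ (for the operator $U_\mu$), then $\mathrm{Pr}_n$ converges to $\mathrm{Pr}$ pointwise almost surely. This convergence is in the uniform topology of functions, i.e. in the norm $\|\cdot\|_{B(\mathcal{X})}$.
   Context: Let $(\Omega,\mathcal{F},\mathbb{P})$ be a probability space, $(\mathcal{X},d)$ a compact metric space with a Borel probability measure $\mu$, and $k:\mathcal{X}\times\mathcal{X}\to[0,\infty)$ a symmetric measurable kernel. Let $X_1,X_2,\dots:\Omega\to\mathcal{X}$ be independent random variables with law $\mu$ and $\mu_n=\frac1n\sum_{i=1}^n\delta_{X_i}$. $B_\delta(x)$ denotes the ball of radius $\delta$ around $x$. $B(\mathcal{X})$ is the Banach space of bounded measurable functions $f:\mathcal{X}\to\mathbb{R}$ with $\|f\|_{B(\mathcal{X})}=\sup_{x}|f(x)|$; $\sigma(S)\subset\mathbb{C}$ is the spectrum of a bounded operator $S$ (of its complexification). $\mathrm{rg}(g)$ denotes the range of a function $g$. Put $d_\mu(x)=\int k(x,y)\,d\mu(y)$,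 $d_{n,\mu}(x)=\int k(x,y)\,d\mu_n(y)$, and, for $\delta>0$, $k_\delta(x;z)=\sup_{y\in B_\delta(x)}|k(x,z)-k(y,z)|$. Standing assumptions: there are constants $0<a\le 1\le M<\infty$ and a continuous increasing function $\omega:[0,+\infty]\to\mathbb{R}$ with $\lim_{\delta\to0}\omega(\delta)=0$ such that $\sup_{x,y}k(x,y)<M$; $a<\inf_x d_\mu(x)$; and $\int k_\delta(x;z)\,d\mu(z)\le\omega(\delta)$ for all $x\in\mathcal{X}$, $\delta>0$. Define $h_\mu(x,y)=\frac12k(x,y)\left(\frac1{d_\mu(x)}+\frac1{d_\mu(y)}\right)$, $h_{n,\mu}(x,y)=\frac12k(x,y)\left(\frac1{d_{n,\mu}(x)}+\frac1{d_{n,\mu}(y)}\right)$, $m_\mu(x)=\int h_\mu(x,y)\,d\mu(y)$, $m_{n,\mu}(x)=\int h_{n,\mu}(x,y)\,d\mu_n(y)$, and operators on $B(\mathcal{X})$: $U_\mu f(x)=\int h_\mu(x,y)(f(x)-f(y))\,d\mu(y)=m_\mu(x)f(x)-\int h_\mu(x,y)f(y)\,d\mu(y)$, and $U_{n,\mu}f(x)=\int h_{n,\mu}(x,y)(f(x)-f(y))\,d\mu_n(y)=m_{n,\mu}(x)f(x)-\int h_{n,\mu}(x,y)f(y)\,d\mu_n(y)$. (Almost surely $\inf_x d_{n,\mu}(x)>0$ for all large $n$, so $U_{n,\mu}$ is defined for all large $n$.) For bounded operators $S_n,S$ on a Banach space $E$: $S_n$ converges pointwise to $S$ if $\|S_nx-Sx\|\to0$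 for all $x\in E$; $S_n$ converges compactly to $S$ if for every sequence $x_n\in E$ with $\|x_n\|\le1$, the sequence $(S-S_n)x_n$ has a convergent subsequence. Spectral projection: for a bounded operator $S$ and $W\subset\mathbb{C}$, if $\gamma$ is a (positively oriented) simple closed curve not meeting $\sigma(S)$ whose interior $\Gamma_{\mathrm{int}}$ satisfies $\Gamma_{\mathrm{int}}\cap\sigma(S)=W\cap\sigma(S)$, the spectral projection of $\sigma(S)\cap W$ is $-\frac1{2\pi i}\int_\gamma(S-zI)^{-1}dz$.
   Formalization: The formal theorem also assumes that the boundary of V contains no point of σ(U_μ), without which (2) and (3) can fail; and in (3) "pointwise almost surely" means: for each fixed f, almost surely Pr_n f → Pr f, since a single null set for all f is impossible in general. *)

theory Defs
  imports "HOL-Probability.Probability" "HOL-Complex_Analysis.Complex_Analysis"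
begin

section \<open>The Banach space of bounded Borel functions\<close>

definition "bmfun = {f. f \<in> borel_measurable borel \<and> bounded (range f)}"

typedef (overloaded) ('a, 'b) bmfun =
  "bmfun :: ('a::topological_space \<Rightarrow> 'b::{real_normed_vector, second_countable_topology}) set"
  morphisms apply_bmfun Bmfun
  by (rule exI[of _ "\<lambda>_. 0"]) (auto simp: bmfun_def image_def)

setup_lifting type_definition_bmfun

lemma measurable_apply_bmfun [measurable, simp]: "apply_bmfun f \<in> borel_measurable borel"
  and bounded_apply_bmfun [simp]: "bounded (range (apply_bmfun f))"
  using apply_bmfun[of f] by (auto simp: bmfun_def)

lemma bmfun_eqI: "(\<And>x. apply_bmfun f x = apply_bmfun g x) \<Longrightarrow> f = g"
  by transfer auto

lemma bmfunI:
  "f \<in> borel_measurable borel \<Longrightarrow> (\<And>x. norm (f x) \<le> b) \<Longrightarrow> f \<in> bmfun"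
  by (auto simp: bmfun_def intro: boundedI)

lemma bmfun_bound: "f \<in> bmfun \<Longrightarrow> \<exists>b. \<forall>x. norm (f x) \<le> b"
  unfolding bmfun_def bounded_iff by blast

instantiation bmfun ::
  (topological_space, "{real_normed_vector, second_countable_topology}") real_vector
begin

lift_definition zero_bmfun :: "('a, 'b) bmfun" is "\<lambda>_. 0"
  by (rule bmfunI[where b = 0]) auto

lift_definition plus_bmfun :: "('a, 'b) bmfun \<Rightarrow> ('a, 'b) bmfun \<Rightarrow> ('a, 'b) bmfun"
  is "\<lambda>f g x. f x + g x"
  by (auto simp: bmfun_def intro!: bounded_plus_comp)

lift_definition minus_bmfun :: "('a, 'b) bmfun \<Rightarrow> ('a, 'b) bmfun \<Rightarrow> ('a, 'b) bmfun"
  is "\<lambda>f g x. f x - g x"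
  by (auto simp: bmfun_def intro!: bounded_minus_comp)

lift_definition uminus_bmfun :: "('a, 'b) bmfun \<Rightarrow> ('a, 'b) bmfun" is "\<lambda>f x. - f x"
  by (auto simp: bmfun_def)

lift_definition scaleR_bmfun :: "real \<Rightarrow> ('a, 'b) bmfun \<Rightarrow> ('a, 'b) bmfun"
  is "\<lambda>r f x. r *\<^sub>R f x"
  by (auto simp: bmfun_def intro!: bounded_scaleR_comp)

lemmas bmfun_apply_simps [simp] =
  zero_bmfun.rep_eq plus_bmfun.rep_eq minus_bmfun.rep_eq uminus_bmfun.rep_eq scaleR_bmfun.rep_eq

instance
  by standard (auto intro!: bmfun_eqI simp: algebra_simps)

end

instantiation bmfun ::
  (topological_space, "{real_normed_vector, second_countable_topology}") real_normed_vector
begin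

lift_definition norm_bmfun :: "('a, 'b) bmfun \<Rightarrow> real" is "\<lambda>f. SUP x. norm (f x)" .

definition dist_bmfun :: "('a, 'b) bmfun \<Rightarrow> ('a, 'b) bmfun \<Rightarrow> real"
  where "dist_bmfun f g = norm (f - g)"

definition sgn_bmfun :: "('a, 'b) bmfun \<Rightarrow> ('a, 'b) bmfun"
  where "sgn_bmfun f = f /\<^sub>R norm f"

definition uniformity_bmfun :: "(('a, 'b) bmfun \<times> ('a, 'b) bmfun) filter"
  where "uniformity_bmfun = (INF e\<in>{0 <..}. principal {(x, y). dist x y < e})"

definition open_bmfun :: "('a, 'b) bmfun set \<Rightarrow> bool"
  where "open_bmfun S = (\<forall>x\<in>S. \<forall>\<^sub>F (x', y) in uniformity. x' = x \<longrightarrow> y \<in> S)"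

lemma norm_apply_bmfun_le: "norm (apply_bmfun f x) \<le> norm (f :: ('a, 'b) bmfun)"
  by transfer (auto simp: bmfun_def intro: bounded_norm_le_SUP_norm)

lemma norm_bmfun_le: "(\<And>x. norm (apply_bmfun f x) \<le> b) \<Longrightarrow> norm (f :: ('a, 'b) bmfun) \<le> b"
  by transfer (auto intro: cSUP_least)

instance
proof
  fix f g :: "('a, 'b) bmfun" and r :: real
  show "norm f = 0 \<longleftrightarrow> f = 0"
  proof
    assume "norm f = 0"
    then show "f = 0"
      using norm_apply_bmfun_le[of f] by (intro bmfun_eqI) simp
  next
    assume "f = 0"
    then have "norm f \<le> 0" by (intro norm_bmfun_le) simp
    moreover have "0 \<le> norm f"
      using norm_apply_bmfun_le[of f undefined] norm_ge_zero order_trans by blast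
    ultimately show "norm f = 0" by simp
  qed
  show "norm (f + g) \<le> norm f + norm g"
    by (rule norm_bmfun_le) (auto intro: norm_triangle_mono norm_apply_bmfun_le)
  have le: "norm (r *\<^sub>R f) \<le> \<bar>r\<bar> * norm f" for r and f :: "('a, 'b) bmfun"
    by (rule norm_bmfun_le) (auto intro: mult_left_mono norm_apply_bmfun_le)
  show "norm (r *\<^sub>R f) = \<bar>r\<bar> * norm f"
  proof (cases "r = 0")
    case True
    have "0 \<le> norm (r *\<^sub>R f)"
      using norm_apply_bmfun_le[of "r *\<^sub>R f" undefined] norm_ge_zero order_trans by blast
    with True le[of r f] show ?thesis by simp
  next
    case False
    have "inverse r *\<^sub>R r *\<^sub>R f = f" using False by (intro bmfun_eqI) simp
    then have "norm f \<le> \<bar>inverse r\<bar> * norm (r *\<^sub>R f)" using le[of "inverse r" "r *\<^sub>R f"] by simp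
    then have "\<bar>r\<bar> * norm f \<le> norm (r *\<^sub>R f)"
      using False by (simp add: field_simps)
    with le[of r f] show ?thesis by simp
  qed
qed (simp_all add: dist_bmfun_def sgn_bmfun_def uniformity_bmfun_def open_bmfun_def)

end

instance bmfun :: (topological_space, "{banach, second_countable_topology}") banach
proof
  fix f :: "nat \<Rightarrow> ('a, 'b) bmfun"
  assume C: "Cauchy f"
  have "Cauchy (\<lambda>n. apply_bmfun (f n) x)" for x
  proof (rule metric_CauchyI)
    fix e :: real assume "0 < e"
    with C obtain N where N: "\<And>m n. m \<ge> N \<Longrightarrow> n \<ge> N \<Longrightarrow> dist (f m) (f n) < e"
      using metric_CauchyD by blast
    have "dist (apply_bmfun (f m) x) (apply_bmfun (f n) x) < e" if "m \<ge> N" "n \<ge> N" for m n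
      using N[OF that] norm_apply_bmfun_le[of "f m - f n" x] by (simp add: dist_norm)
    then show "\<exists>M. \<forall>m\<ge>M. \<forall>n\<ge>M. dist (apply_bmfun (f m) x) (apply_bmfun (f n) x) < e" by blast
  qed
  then have "\<forall>x. \<exists>l. (\<lambda>n. apply_bmfun (f n) x) \<longlonglongrightarrow> l"
    by (simp add: Cauchy_convergent_iff convergent_def)
  then obtain g where g: "\<And>x. (\<lambda>n. apply_bmfun (f n) x) \<longlonglongrightarrow> g x" by metis
  have unif: "\<exists>N. \<forall>n\<ge>N. \<forall>x. norm (apply_bmfun (f n) x - g x) \<le> e" if "0 < e" for e :: real
  proof -
    obtain N where N: "\<And>m n. m \<ge> N \<Longrightarrow> n \<ge> N \<Longrightarrow> dist (f m) (f n) < e"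
      using metric_CauchyD[OF C \<open>0 < e\<close>] by blast
    have "norm (apply_bmfun (f n) x - g x) \<le> e" if "n \<ge> N" for n x
    proof (rule tendsto_upperbound)
      show "(\<lambda>m. norm (apply_bmfun (f n) x - apply_bmfun (f m) x))
          \<longlonglongrightarrow> norm (apply_bmfun (f n) x - g x)"
        by (intro tendsto_intros g)
      show "\<forall>\<^sub>F m in sequentially. norm (apply_bmfun (f n) x - apply_bmfun (f m) x) \<le> e"
        using eventually_ge_at_top[of N]
      proof eventually_elim
        fix m assume "N \<le> m"
        then have "norm (f n - f m) < e" using N[of n m] that by (simp add: dist_norm)
        then show "norm (apply_bmfun (f n) x - apply_bmfun (f m) x) \<le> e"
          using norm_apply_bmfun_le[of "f n - f m" x] by simp
      qed
    qed simp
    then show ?thesis by blast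
  qed
  obtain N where N: "\<And>x. norm (apply_bmfun (f N) x - g x) \<le> 1"
    using unif[of 1] by auto
  have "g \<in> borel_measurable borel"
    by (rule borel_measurable_LIMSEQ_metric[OF _ g]) simp
  moreover have "norm (g x) \<le> norm (f N) + 1" for x
    using N[of x] norm_apply_bmfun_le[of "f N" x] norm_triangle_ineq2[of "g x" "apply_bmfun (f N) x"]
    by (simp add: norm_minus_commute)
  ultimately have "g \<in> bmfun" by (rule bmfunI)
  then have app: "apply_bmfun (Bmfun g) = g" by (simp add: Bmfun_inverse)
  have "f \<longlonglongrightarrow> Bmfun g"
  proof (rule metric_LIMSEQ_I)
    fix e :: real assume "0 < e"
    then obtain N where N: "\<forall>n\<ge>N. \<forall>x. norm (apply_bmfun (f n) x - g x) \<le> e / 2"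
      using unif[of "e / 2"] by auto
    have "dist (f n) (Bmfun g) < e" if "n \<ge> N" for n
    proof -
      have "norm (f n - Bmfun g) \<le> e / 2"
        using N that by (intro norm_bmfun_le) (simp add: app)
      then show ?thesis using \<open>0 < e\<close> by (simp add: dist_norm)
    qed
    then show "\<exists>N. \<forall>n\<ge>N. dist (f n) (Bmfun g) < e" by blast
  qed
  then show "convergent f" by (rule convergentI)
qed


section \<open>Complexification, spectrum, spectral projection\<close>

text \<open>The complexification of the real space \<open>('a, real) bmfun\<close> is \<open>('a, complex) bmfun\<close>, again
  with the supremum norm. As there is no class of complex vector spaces, multiplication by
  a complex scalar is a (real) bounded linear operator on the latter.\<close>

lift_definition scaleC_bmfun ::
    "complex \<Rightarrow> ('a::topological_space, complex) bmfun \<Rightarrow> ('a, complex) bmfun"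
  is "\<lambda>c f x. c * f x"
  by (auto simp: bmfun_def bounded_iff norm_mult) (meson mult_left_mono norm_ge_zero)

lift_definition Re_bmfun :: "('a::topological_space, complex) bmfun \<Rightarrow> ('a, real) bmfun"
  is "\<lambda>f x. Re (f x)"
  by (auto simp: bmfun_def bounded_iff) (meson abs_Re_le_cmod order_trans)

lift_definition Im_bmfun :: "('a::topological_space, complex) bmfun \<Rightarrow> ('a, real) bmfun"
  is "\<lambda>f x. Im (f x)"
  by (auto simp: bmfun_def bounded_iff) (meson abs_Im_le_cmod order_trans)

lift_definition Complex_bmfun ::
    "('a::topological_space, real) bmfun \<Rightarrow> ('a, real) bmfun \<Rightarrow> ('a, complex) bmfun"
  is "\<lambda>u v x. complex_of_real (u x) + \<i> * complex_of_real (v x)"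
proof -
  fix u v :: "'a \<Rightarrow> real"
  assume u: "u \<in> bmfun" and v: "v \<in> bmfun"
  obtain a b where "\<And>x. \<bar>u x\<bar> \<le> a" "\<And>x. \<bar>v x\<bar> \<le> b"
    using bmfun_bound[OF u] bmfun_bound[OF v] by auto
  then have "norm (complex_of_real (u x) + \<i> * complex_of_real (v x)) \<le> a + b" for x
    by (intro norm_triangle_mono) (auto simp: norm_mult)
  moreover have "(\<lambda>x. complex_of_real (u x) + \<i> * complex_of_real (v x)) \<in> borel_measurable borel"
  proof -
    have [measurable]: "u \<in> borel_measurable borel" "v \<in> borel_measurable borel"
      using u v by (auto simp: bmfun_def)
    show ?thesis by measurable
  qed
  ultimately show "(\<lambda>x. complex_of_real (u x) + \<i> * complex_of_real (v x)) \<in> bmfun"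
    by (intro bmfunI)
qed

lemmas bmfun_complex_apply_simps [simp] =
  scaleC_bmfun.rep_eq Re_bmfun.rep_eq Im_bmfun.rep_eq Complex_bmfun.rep_eq

lift_definition scalar_op ::
    "complex \<Rightarrow> ('a::topological_space, complex) bmfun \<Rightarrow>\<^sub>L ('a, complex) bmfun"
  is scaleC_bmfun
proof -
  fix c
  show "bounded_linear (scaleC_bmfun c :: ('a, complex) bmfun \<Rightarrow> _)"
  proof (rule bounded_linear_intro[where K = "norm c"])
    fix f :: "('a, complex) bmfun"
    show "norm (scaleC_bmfun c f) \<le> norm f * norm c"
      by (rule norm_bmfun_le)
        (simp add: norm_mult mult.commute[of "norm f"] mult_left_mono norm_apply_bmfun_le)
  qed (auto intro!: bmfun_eqI simp: algebra_simps)
qed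

lift_definition complexify ::
    "(('a::topological_space, real) bmfun \<Rightarrow>\<^sub>L ('a, real) bmfun) \<Rightarrow>
      (('a, complex) bmfun \<Rightarrow>\<^sub>L ('a, complex) bmfun)"
  is "\<lambda>S f. Complex_bmfun (S (Re_bmfun f)) (S (Im_bmfun f))"
proof -
  fix S :: "('a, real) bmfun \<Rightarrow> ('a, real) bmfun"
  assume S: "bounded_linear S"
  interpret bounded_linear S by (rule S)
  obtain K where K: "0 < K" "\<And>u. norm (S u) \<le> norm u * K" using pos_bounded by blast
  have Re: "norm (Re_bmfun f) \<le> norm f" and Im: "norm (Im_bmfun f) \<le> norm f"
    for f :: "('a, complex) bmfun"
    by (rule norm_bmfun_le,
        simp, meson abs_Re_le_cmod abs_Im_le_cmod norm_apply_bmfun_le order_trans)+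
  show "bounded_linear (\<lambda>f. Complex_bmfun (S (Re_bmfun f)) (S (Im_bmfun f)))"
  proof (rule bounded_linear_intro[where K = "2 * K"])
    fix f :: "('a, complex) bmfun"
    have "norm (S (Re_bmfun f)) \<le> norm f * K" "norm (S (Im_bmfun f)) \<le> norm f * K"
      by (rule order_trans[OF K(2)], use Re Im K(1) in \<open>simp add: mult_right_mono\<close>)+
    then have *: "\<bar>apply_bmfun (S (Re_bmfun f)) x\<bar> \<le> norm f * K"
      "\<bar>apply_bmfun (S (Im_bmfun f)) x\<bar> \<le> norm f * K" for x
      using norm_apply_bmfun_le[of "S (Re_bmfun f)" x] norm_apply_bmfun_le[of "S (Im_bmfun f)" x]
      by auto
    show "norm (Complex_bmfun (S (Re_bmfun f)) (S (Im_bmfun f))) \<le> norm f * (2 * K)"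
    proof (rule norm_bmfun_le)
      fix x
      have "norm (complex_of_real (apply_bmfun (S (Re_bmfun f)) x)
          + \<i> * complex_of_real (apply_bmfun (S (Im_bmfun f)) x)) \<le> norm f * K + norm f * K"
        using * by (intro norm_triangle_mono) (auto simp: norm_mult)
      then show "norm (apply_bmfun (Complex_bmfun (S (Re_bmfun f)) (S (Im_bmfun f))) x)
          \<le> norm f * (2 * K)"
        by (simp add: algebra_simps)
    qed
  next
    fix f g :: "('a, complex) bmfun"
    have "Re_bmfun (f + g) = Re_bmfun f + Re_bmfun g" "Im_bmfun (f + g) = Im_bmfun f + Im_bmfun g"
      by (auto intro!: bmfun_eqI)
    then show "Complex_bmfun (S (Re_bmfun (f + g))) (S (Im_bmfun (f + g))) =
        Complex_bmfun (S (Re_bmfun f)) (S (Im_bmfun f))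
        + Complex_bmfun (S (Re_bmfun g)) (S (Im_bmfun g))"
      by (auto intro!: bmfun_eqI simp: add algebra_simps)
  next
    fix r and f :: "('a, complex) bmfun"
    have "Re_bmfun (r *\<^sub>R f) = r *\<^sub>R Re_bmfun f" "Im_bmfun (r *\<^sub>R f) = r *\<^sub>R Im_bmfun f"
      by (auto intro!: bmfun_eqI)
    then show "Complex_bmfun (S (Re_bmfun (r *\<^sub>R f))) (S (Im_bmfun (r *\<^sub>R f))) =
        r *\<^sub>R Complex_bmfun (S (Re_bmfun f)) (S (Im_bmfun f))"
      by (intro bmfun_eqI) (auto simp: scaleR scaleR_conv_of_real algebra_simps)
  qed
qed

definition is_resolvent ::
    "(('a::topological_space, real) bmfun \<Rightarrow>\<^sub>L ('a, real) bmfun) \<Rightarrow> complex \<Rightarrow>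
      (('a, complex) bmfun \<Rightarrow>\<^sub>L ('a, complex) bmfun) \<Rightarrow> bool"
  where "is_resolvent S z R \<longleftrightarrow>
    R o\<^sub>L (complexify S - scalar_op z) = id_blinfun \<and>
    (complexify S - scalar_op z) o\<^sub>L R = id_blinfun"

text \<open>The resolvent is \<open>(S - z I)\<^sup>-\<^sup>1\<close> (not \<open>(z I - S)\<^sup>-\<^sup>1\<close>); a two-sided inverse is unique.\<close>

definition resolvent ::
    "(('a::topological_space, real) bmfun \<Rightarrow>\<^sub>L ('a, real) bmfun) \<Rightarrow> complex \<Rightarrow>
      (('a, complex) bmfun \<Rightarrow>\<^sub>L ('a, complex) bmfun)"
  where "resolvent S z = (THE R. is_resolvent S z R)"

definition op_spectrum ::
    "(('a::topological_space, real) bmfun \<Rightarrow>\<^sub>L ('a, real) bmfun) \<Rightarrow> complex set"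
  where "op_spectrum S = {z. \<nexists>R. is_resolvent S z R}"

definition op_eigenvalue ::
    "(('a::topological_space, real) bmfun \<Rightarrow>\<^sub>L ('a, real) bmfun) \<Rightarrow> complex \<Rightarrow> bool"
  where "op_eigenvalue S z \<longleftrightarrow> (\<exists>f. f \<noteq> 0 \<and> complexify S f = scaleC_bmfun z f)"

text \<open>The operator-valued contour integral is written out exactly as
  \<^const>\<open>has_contour_integral\<close> unfolds for complex-valued integrands. Uniqueness of the operator
  \<open>P\<close>, i.e. independence of the contour, is not part of this definition.\<close>

definition is_spectral_projection ::
    "(('a::topological_space, real) bmfun \<Rightarrow>\<^sub>L ('a, real) bmfun) \<Rightarrow> complex set \<Rightarrow>
      (('a, complex) bmfun \<Rightarrow>\<^sub>L ('a, complex) bmfun) \<Rightarrow> bool"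
  where "is_spectral_projection S W P \<longleftrightarrow>
    (\<exists>\<gamma> J. valid_path \<gamma> \<and> simple_path \<gamma> \<and> pathfinish \<gamma> = pathstart \<gamma> \<and>
      (\<forall>z\<in>inside (path_image \<gamma>). winding_number \<gamma> z = 1) \<and>
      path_image \<gamma> \<inter> op_spectrum S = {} \<and>
      inside (path_image \<gamma>) \<inter> op_spectrum S = W \<inter> op_spectrum S \<and>
      ((\<lambda>t. scalar_op (vector_derivative \<gamma> (at t within {0..1})) o\<^sub>L resolvent S (\<gamma> t))
        has_integral J) {0..1} \<and>
      P = scalar_op (- 1 / (2 * of_real pi * \<i>)) o\<^sub>L J)"

definition spectral_projection ::
    "(('a::topological_space, real) bmfun \<Rightarrow>\<^sub>L ('a, real) bmfun) \<Rightarrow> complex set \<Rightarrow>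
      (('a, complex) bmfun \<Rightarrow>\<^sub>L ('a, complex) bmfun)"
  where "spectral_projection S W = (THE P. is_spectral_projection S W P)"

definition converges_compactly ::
    "(nat \<Rightarrow> 'e::real_normed_vector \<Rightarrow>\<^sub>L 'e) \<Rightarrow> ('e \<Rightarrow>\<^sub>L 'e) \<Rightarrow> bool"
  where "converges_compactly Sn S \<longleftrightarrow>
    (\<forall>x. (\<forall>n. norm (x n) \<le> 1) \<longrightarrow>
      (\<exists>r. strict_mono r \<and> convergent (\<lambda>j. (S - Sn (r j)) (x (r j)))))"


section \<open>The unnormalized operators\<close>

text \<open>All objects are defined for an arbitrary measure \<open>\<nu>\<close>; they are used with \<open>\<nu> = \<mu>\<close> and with
  the empirical measure of the sample \<open>X 1 w, \<dots>, X n w\<close>.\<close>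

definition empirical :: "(nat \<Rightarrow> 'w \<Rightarrow> 'a::topological_space) \<Rightarrow> nat \<Rightarrow> 'w \<Rightarrow> 'a measure"
  where "empirical X n w = distr (uniform_count_measure {1..n}) borel (\<lambda>i. X i w)"

definition deg :: "('a \<Rightarrow> 'a \<Rightarrow> real) \<Rightarrow> 'a measure \<Rightarrow> 'a \<Rightarrow> real"
  where "deg k \<nu> x = (\<integral>y. k x y \<partial>\<nu>)"

definition hker :: "('a \<Rightarrow> 'a \<Rightarrow> real) \<Rightarrow> 'a measure \<Rightarrow> 'a \<Rightarrow> 'a \<Rightarrow> real"
  where "hker k \<nu> x y = 1 / 2 * k x y * (1 / deg k \<nu> x + 1 / deg k \<nu> y)"

definition mfun :: "('a \<Rightarrow> 'a \<Rightarrow> real) \<Rightarrow> 'a measure \<Rightarrow> 'a \<Rightarrow> real"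
  where "mfun k \<nu> x = (\<integral>y. hker k \<nu> x y \<partial>\<nu>)"

definition kdelta :: "('a::metric_space \<Rightarrow> 'a \<Rightarrow> real) \<Rightarrow> real \<Rightarrow> 'a \<Rightarrow> 'a \<Rightarrow> real"
  where "kdelta k \<delta> x z = (SUP y\<in>ball x \<delta>. \<bar>k x z - k y z\<bar>)"

text \<open>\<^const>\<open>Blinfun\<close> and \<^const>\<open>Bmfun\<close> are unspecified outside their domains, which matters only
  when \<^term>\<open>deg k \<nu>\<close> is not bounded away from \<open>0\<close>; see \<open>Uop_apply\<close> below.\<close>

definition Uop ::
    "('a::topological_space \<Rightarrow> 'a \<Rightarrow> real) \<Rightarrow> 'a measure \<Rightarrow> ('a, real) bmfun \<Rightarrow>\<^sub>L ('a, real) bmfun"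
  where "Uop k \<nu> = Blinfun (\<lambda>f. Bmfun (\<lambda>x.
    \<integral>y. hker k \<nu> x y * (apply_bmfun f x - apply_bmfun f y) \<partial>\<nu>))"

lemma integral_empirical:
  fixes f :: "'a::topological_space \<Rightarrow> real"
  assumes "f \<in> borel_measurable borel"
  shows "(\<integral>y. f y \<partial>empirical X n w) = (\<Sum>i=1..n. f (X i w)) / n"
proof -
  have "(\<lambda>i. X i w) \<in> measurable (uniform_count_measure {1..n}) borel"
    by (auto simp: measurable_def sets_uniform_count_measure space_uniform_count_measure)
  then show ?thesis
    unfolding empirical_def by (simp add: integral_distr assms integral_uniform_count_measure)
qed

lemma Uop_apply:
  fixes k :: "'a::topological_space \<Rightarrow> 'a \<Rightarrow> real"
  assumes "prob_space \<nu>" and sets [measurable_cong]: "sets \<nu> = sets borel"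
    and k [measurable]: "(\<lambda>(x, y). k x y) \<in> borel_measurable (borel \<Otimes>\<^sub>M borel)"
    and k_nonneg: "\<And>x y. 0 \<le> k x y" and k_le: "\<And>x y. k x y \<le> C"
    and "0 < c" and deg_ge: "\<And>x. c \<le> deg k \<nu> x"
  shows "apply_bmfun (Uop k \<nu> f) x =
    (\<integral>y. hker k \<nu> x y * (apply_bmfun f x - apply_bmfun f y) \<partial>\<nu>)"
proof -
  interpret prob_space \<nu> by fact
  let ?U = "\<lambda>(f :: ('a, real) bmfun) x.
    \<integral>y. hker k \<nu> x y * (apply_bmfun f x - apply_bmfun f y) \<partial>\<nu>"
  have [measurable]: "deg k \<nu> \<in> borel_measurable borel"
    unfolding deg_def by measurable
  have hmeas [measurable]: "(\<lambda>(x, y). hker k \<nu> x y) \<in> borel_measurable (borel \<Otimes>\<^sub>M borel)"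
    unfolding hker_def by measurable
  have hx [measurable]: "hker k \<nu> x \<in> borel_measurable borel" for x
    unfolding hker_def by measurable
  have "0 \<le> C" using k_nonneg k_le order_trans by blast
  have h_nonneg: "0 \<le> hker k \<nu> x y" for x y
  proof -
    have "0 < deg k \<nu> x" for x using \<open>0 < c\<close> deg_ge[of x] by simp
    then show ?thesis unfolding hker_def using k_nonneg by (simp add: less_imp_le)
  qed
  have h_le: "hker k \<nu> x y \<le> C / c" for x y
  proof -
    have "1 / deg k \<nu> x \<le> 1 / c" for x
      using deg_ge[of x] \<open>0 < c\<close> by (simp add: frac_le)
    then have "1 / deg k \<nu> x + 1 / deg k \<nu> y \<le> 2 / c"
      using add_mono[of "1 / deg k \<nu> x" "1 / c" "1 / deg k \<nu> y" "1 / c"] by simp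
    moreover have "0 \<le> 1 / deg k \<nu> x + 1 / deg k \<nu> y"
      using \<open>0 < c\<close> deg_ge[of x] deg_ge[of y] by simp
    ultimately have "k x y * (1 / deg k \<nu> x + 1 / deg k \<nu> y) \<le> C * (2 / c)"
      using k_le \<open>0 \<le> C\<close> by (intro mult_mono) auto
    then show ?thesis unfolding hker_def by simp
  qed
  have bnd: "\<bar>hker k \<nu> x y * (apply_bmfun f x - apply_bmfun f y)\<bar> \<le> C / c * (2 * norm f)"
    for f :: "('a, real) bmfun" and x y
  proof -
    have "\<bar>apply_bmfun f x - apply_bmfun f y\<bar> \<le> 2 * norm f"
      using norm_apply_bmfun_le[of f x] norm_apply_bmfun_le[of f y] by simp
    then show ?thesis
      unfolding abs_mult using h_nonneg[of x y] h_le[of x y] by (intro mult_mono) auto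
  qed
  have int: "integrable \<nu> (\<lambda>y. hker k \<nu> x y * (apply_bmfun f x - apply_bmfun f y))"
    for f :: "('a, real) bmfun" and x
    by (rule integrable_const_bound[where B = "C / c * (2 * norm f)"]) (use bnd in auto)
  have Ubound: "\<bar>?U f x\<bar> \<le> norm f * (2 * C / c)" for f x
  proof -
    have "\<bar>?U f x\<bar> \<le> (\<integral>y. \<bar>hker k \<nu> x y * (apply_bmfun f x - apply_bmfun f y)\<bar> \<partial>\<nu>)"
      by (rule integral_abs_bound)
    also have "\<dots> \<le> (\<integral>y. C / c * (2 * norm f) \<partial>\<nu>)"
      by (rule integral_mono) (use int bnd in auto)
    finally show ?thesis by (simp add: prob_space field_simps)
  qed
  have "?U f \<in> bmfun" for f
  proof (rule bmfunI)
    show "?U f \<in> borel_measurable borel" by measurable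
    show "norm (?U f x) \<le> norm f * (2 * C / c)" for x using Ubound by simp
  qed
  then have app: "apply_bmfun (Bmfun (?U f)) = ?U f" for f by (simp add: Bmfun_inverse)
  have "bounded_linear (\<lambda>f. Bmfun (?U f))"
  proof (rule bounded_linear_intro[where K = "2 * C / c"])
    fix f g :: "('a, real) bmfun"
    show "Bmfun (?U (f + g)) = Bmfun (?U f) + Bmfun (?U g)"
    proof (rule bmfun_eqI)
      fix x
      have "?U (f + g) x = (\<integral>y. hker k \<nu> x y * (apply_bmfun f x - apply_bmfun f y)
          + hker k \<nu> x y * (apply_bmfun g x - apply_bmfun g y) \<partial>\<nu>)"
        by (simp add: algebra_simps)
      also have "\<dots> = ?U f x + ?U g x" by (rule Bochner_Integration.integral_add[OF int int])
      also have "\<dots> = apply_bmfun (Bmfun (?U f) + Bmfun (?U g)) x"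
        by (simp only: app plus_bmfun.rep_eq)
      finally show "apply_bmfun (Bmfun (?U (f + g))) x = apply_bmfun (Bmfun (?U f) + Bmfun (?U g)) x"
        by (simp only: app)
    qed
  next
    fix r and f :: "('a, real) bmfun"
    show "Bmfun (?U (r *\<^sub>R f)) = r *\<^sub>R Bmfun (?U f)"
    proof (rule bmfun_eqI)
      fix x
      have "?U (r *\<^sub>R f) x = (\<integral>y. r * (hker k \<nu> x y * (apply_bmfun f x - apply_bmfun f y)) \<partial>\<nu>)"
        by (simp add: algebra_simps)
      also have "\<dots> = r * ?U f x" by simp
      also have "\<dots> = apply_bmfun (r *\<^sub>R Bmfun (?U f)) x"
        by (simp only: app scaleR_bmfun.rep_eq real_scaleR_def)
      finally show "apply_bmfun (Bmfun (?U (r *\<^sub>R f))) x = apply_bmfun (r *\<^sub>R Bmfun (?U f)) x"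
        by (simp only: app)
    qed
  next
    fix f :: "('a, real) bmfun"
    show "norm (Bmfun (?U f)) \<le> norm f * (2 * C / c)"
      by (rule norm_bmfun_le) (use Ubound in \<open>simp add: app\<close>)
  qed
  then show ?thesis
    unfolding Uop_def by (simp add: bounded_linear_Blinfun_apply app)
qed

end

theory Submission
  imports Defs
begin

text \<open>Write \<open>U = m - K\<close> for the limit operator and \<open>U\<^sub>n = m\<^sub>n - K\<^sub>n\<close> for the operator of the
  empirical measure, where \<open>m\<close>, \<open>m\<^sub>n\<close> act by multiplication and \<open>K\<close>, \<open>K\<^sub>n\<close> are the integral operators.

  Compact convergence. As \<open>\<integral> \<bar>k x y - k c y\<bar> \<partial>\<mu> \<le> \<omega> \<delta>\<close> for \<open>x\<close> in the \<open>\<delta>\<close>-ball around \<open>c\<close>, an integral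
  \<open>\<integral> k x y * f y\<close> is determined up to \<open>\<omega> \<delta>\<close> by its values at finitely many centres \<open>c\<close>. At the
  centres the strong law of large numbers applies, to the integrals and to the bounds \<open>kdelta\<close>. Hence,
  almost surely, \<open>m\<^sub>n\<close> tends to \<open>m\<close> uniformly, and the functions \<open>K\<^sub>n f\<close> with \<open>\<parallel>f\<parallel> \<le> 1\<close> oscillate little
  on small balls as soon as \<open>n\<close> is large. A version of the Arzela-Ascoli theorem for such
  asymptotically equicontinuous sequences (\<open>asymptotic_Arzela_Ascoli\<close>) yields compact convergence.

  Pointwise convergence on enough vectors. For each fixed \<open>f\<close> the same argument gives \<open>U\<^sub>n f \<longlonglongrightarrow> U f\<close>
  almost surely, but the null set depends on \<open>f\<close> and the bounded functions are not separable. It turns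
  out that convergence is needed only at the vectors \<open>R(z) g\<close> where \<open>R(z)\<close> is the resolvent of \<open>U\<close> and
  \<open>g\<close> is a limit of functions \<open>(U - U\<^sub>n) f\<^sub>n\<close>. Such \<open>g\<close> are uniform limits of step functions over
  one fixed countable family of Borel sets, so a countable set of vectors controls them all
  (\<open>conv_vec_resolvent_regulated\<close>).

  Resolvents. If \<open>(U\<^sub>n - z\<^sub>n) F\<^sub>n \<longlonglongrightarrow> 0\<close> with \<open>\<parallel>F\<^sub>n\<parallel> = 1\<close> and \<open>z\<^sub>n\<close> in a compact subset of the resolvent set
  of \<open>U\<close>, then by compact convergence a subsequence of \<open>F\<^sub>n\<close> tends to a vector \<open>R(z) g\<close>, and this is
  an eigenvector of \<open>U\<close> at \<open>z\<close>, a contradiction. So \<open>U\<^sub>n - z\<close> is bounded below, uniformly on the compact set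
  (\<open>uniformly_bounded_below\<close>). It is also onto: the kernel is symmetric, so the spectrum of \<open>U\<^sub>n\<close> is real
  (\<open>op_spectrum_real\<close>), and a limit of invertible operators that is bounded below is invertible.
  Hence the spectrum of \<open>U\<^sub>n\<close> in \<open>V\<close> eventually lies in any given disc around \<open>\<lambda>\<close>, and resolvents converge at
  the relevant vectors, uniformly on a circle around \<open>\<lambda>\<close>.

  Projections. A real spectrum has a connected complement. Two contours that both enclose exactly the
  part of the spectrum in \<open>V\<close> can therefore be joined to a loop that is null-homologous in the
  resolvent set, so the spectral projection does not depend on the contour, and a small circle
  around \<open>\<lambda>\<close>, the same for all samples, may be used (\<open>spectral_projection_eq_circle\<close>). Convergence of
  the resolvents on this circle gives convergence of the projections.
  Since the limit projection fixes the eigenvectors of \<open>U\<close>, the projections of \<open>U\<^sub>n\<close> do not vanish, and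
  \<open>U\<^sub>n\<close> has spectrum in \<open>V\<close>. This spectrum consists of eigenvalues because it lies off the
  range of \<open>m\<^sub>n\<close> and \<open>K\<^sub>n\<close> has finite rank (\<open>eigenvalue_if_finite_support\<close>).\<close>

section \<open>Invertibility of bounded operators\<close>

definition invertible_blinfun :: "('e::real_normed_vector \<Rightarrow>\<^sub>L 'e) \<Rightarrow> bool"
  where "invertible_blinfun A \<longleftrightarrow> (\<exists>R. R o\<^sub>L A = id_blinfun \<and> A o\<^sub>L R = id_blinfun)"

definition bounded_below :: "real \<Rightarrow> ('e::real_normed_vector \<Rightarrow>\<^sub>L 'e) \<Rightarrow> bool"
  where "bounded_below c A \<longleftrightarrow> (\<forall>x. c * norm x \<le> norm (A x))"

lemma norm_inverse_le:
  assumes "bounded_below c A" "0 < c" "A o\<^sub>L R = id_blinfun"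
  shows "norm R \<le> 1 / c"
proof (rule norm_blinfun_bound)
  fix y
  have "A (R y) = y" using arg_cong[OF assms(3), of "\<lambda>B. blinfun_apply B y"] by simp
  then have "c * norm (R y) \<le> norm y" using assms(1) unfolding bounded_below_def by metis
  then show "norm (R y) \<le> 1 / c * norm y" using \<open>0 < c\<close> by (simp add: field_simps)
qed (use \<open>0 < c\<close> in simp)

lemma invertible_imp_bounded_below:
  fixes A :: "'e::real_normed_vector \<Rightarrow>\<^sub>L 'e"
  assumes "invertible_blinfun A"
  shows "\<exists>c>0. bounded_below c A"
proof -
  obtain R where R: "R o\<^sub>L A = id_blinfun" using assms unfolding invertible_blinfun_def by blast
  have *: "norm x \<le> (norm R + 1) * norm (A x)" for x
  proof -
    have "R (A x) = x" using arg_cong[OF R, of "\<lambda>B. blinfun_apply B x"] by simp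
    then have "norm x \<le> norm R * norm (A x)" using norm_blinfun[of R "A x"] by simp
    also have "\<dots> \<le> (norm R + 1) * norm (A x)" by (simp add: mult_right_mono)
    finally show ?thesis .
  qed
  have pos: "0 < norm R + 1" using norm_ge_zero[of R] by linarith
  have "bounded_below (1 / (norm R + 1)) A"
    unfolding bounded_below_def using * pos by (auto simp: field_simps)
  with pos show ?thesis by (intro exI[of _ "1 / (norm R + 1)"]) auto
qed

lemma bounded_below_perturb:
  assumes "bounded_below c A"
  shows "bounded_below (c - norm (A - B)) B"
  unfolding bounded_below_def
proof
  fix x
  have "c * norm x \<le> norm (A x)" using assms unfolding bounded_below_def by blast
  also have "\<dots> \<le> norm (B x) + norm ((A - B) x)"
    by (metis add_diff_cancel_left' blinfun.diff_left norm_triangle_sub)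
  also have "norm ((A - B) x) \<le> norm (A - B) * norm x" by (rule norm_blinfun)
  finally show "(c - norm (A - B)) * norm x \<le> norm (B x)" by (simp add: algebra_simps)
qed

lemma invertible_if_bounded_below_surj:
  fixes A :: "'e::real_normed_vector \<Rightarrow>\<^sub>L 'e"
  assumes b: "bounded_below c A" "0 < c" and s: "surj (blinfun_apply A)"
  shows "invertible_blinfun A"
proof -
  have inj: "x = y" if "A x = A y" for x y
  proof -
    have "c * norm (x - y) \<le> norm (A (x - y))" using b unfolding bounded_below_def by blast
    also have "A (x - y) = 0" using that by (simp add: blinfun.diff_right)
    finally show ?thesis using \<open>0 < c\<close> by (simp add: mult_le_0_iff)
  qed
  define g where "g = inv (blinfun_apply A)"
  have Ag: "A (g y) = y" for y unfolding g_def by (rule surj_f_inv_f[OF s])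
  have gA: "g (A x) = x" for x by (rule inj) (rule Ag)
  have "bounded_linear g"
  proof (rule bounded_linear_intro[where K = "1 / c"])
    show "g (x + y) = g x + g y" for x y by (rule inj) (simp add: Ag blinfun.add_right)
    show "g (r *\<^sub>R x) = r *\<^sub>R g x" for r x by (rule inj) (simp add: Ag blinfun.scaleR_right)
    fix x
    have "c * norm (g x) \<le> norm (A (g x))" using b unfolding bounded_below_def by blast
    then show "norm (g x) \<le> norm x * (1 / c)" using \<open>0 < c\<close> by (simp add: Ag field_simps)
  qed
  then have "Blinfun g o\<^sub>L A = id_blinfun" "A o\<^sub>L Blinfun g = id_blinfun"
    by (auto intro!: blinfun_eqI simp: bounded_linear_Blinfun_apply gA Ag)
  then show ?thesis unfolding invertible_blinfun_def by blast
qed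

text \<open>The equation \<open>A x = y\<close> is the fixed point equation \<open>x = R (y - (A - B) x)\<close> for the inverse
  \<open>R\<close> of \<open>B\<close>, and the right-hand side is a contraction as \<open>\<parallel>R\<parallel> \<le> 1 / (c - \<parallel>A - B\<parallel>)\<close>.
  So a bounded-below operator that is a limit of invertible ones is invertible.\<close>

lemma invertible_near_bounded_below:
  fixes A B :: "'e::banach \<Rightarrow>\<^sub>L 'e"
  assumes b: "bounded_below c A" and inv: "invertible_blinfun B" and d: "2 * norm (A - B) < c"
  shows "invertible_blinfun A"
proof -
  let ?d = "norm (A - B)"
  have "0 < c" using d norm_ge_zero[of "A - B"] by linarith
  obtain R where R: "R o\<^sub>L B = id_blinfun" "B o\<^sub>L R = id_blinfun"
    using inv unfolding invertible_blinfun_def by blast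
  have cd: "0 < c - ?d" using d norm_ge_zero[of "A - B"] by linarith
  have nR: "norm R \<le> 1 / (c - ?d)"
    by (rule norm_inverse_le[OF bounded_below_perturb[OF b] cd R(2)])
  have BR: "B (R y) = y" for y using arg_cong[OF R(2), of "\<lambda>B. blinfun_apply B y"] by simp
  have "surj (blinfun_apply A)"
    unfolding surj_def
  proof
    fix y
    have "\<exists>!x. R (y - (A - B) x) = x"
    proof (rule banach_fix_type[where c = "?d / (c - ?d)"])
      show "0 \<le> ?d / (c - ?d)" "?d / (c - ?d) < 1" using d cd by auto
      show "\<forall>x x'. dist (R (y - (A - B) x)) (R (y - (A - B) x')) \<le> ?d / (c - ?d) * dist x x'"
      proof (intro allI)
        fix x x'
        have "R (y - (A - B) x) - R (y - (A - B) x') = R ((A - B) (x' - x))"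
          by (simp add: blinfun.diff_right[symmetric])
        then have "dist (R (y - (A - B) x)) (R (y - (A - B) x')) \<le> norm R * norm ((A - B) (x' - x))"
          by (simp add: dist_norm norm_blinfun)
        also have "\<dots> \<le> 1 / (c - ?d) * (?d * norm (x' - x))"
          using nR cd by (intro mult_mono norm_blinfun) auto
        finally show "dist (R (y - (A - B) x)) (R (y - (A - B) x')) \<le> ?d / (c - ?d) * dist x x'"
          by (simp add: dist_norm norm_minus_commute)
      qed
    qed
    then obtain x where "R (y - (A - B) x) = x" by blast
    then have "B x = y - (A - B) x" by (metis BR)
    then show "\<exists>x. y = A x" by (intro exI[of _ x]) (simp add: blinfun.diff_left)
  qed
  then show ?thesis by (rule invertible_if_bounded_below_surj[OF b \<open>0 < c\<close>])
qed

section \<open>Spectrum and resolvent on the complexification\<close>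

abbreviation shifted ::
    "(('a::topological_space, real) bmfun \<Rightarrow>\<^sub>L ('a, real) bmfun) \<Rightarrow> complex \<Rightarrow>
      (('a, complex) bmfun \<Rightarrow>\<^sub>L ('a, complex) bmfun)"
  where "shifted S z \<equiv> complexify S - scalar_op z"

lemma not_in_spectrum_iff: "z \<notin> op_spectrum S \<longleftrightarrow> invertible_blinfun (shifted S z)"
  by (auto simp: op_spectrum_def is_resolvent_def invertible_blinfun_def)

lemma scalar_op_apply [simp]: "blinfun_apply (scalar_op z) f = scaleC_bmfun z f"
  by (simp add: scalar_op.rep_eq)

lemma complexify_apply [simp]:
  "apply_bmfun (complexify S f) x =
    complex_of_real (apply_bmfun (S (Re_bmfun f)) x) + \<i> * complex_of_real (apply_bmfun (S (Im_bmfun f)) x)"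
  by (simp add: complexify.rep_eq)

lemma norm_Re_bmfun: "norm (Re_bmfun f) \<le> norm f"
  by (rule norm_bmfun_le, simp, meson abs_Re_le_cmod norm_apply_bmfun_le order_trans)

lemma norm_Im_bmfun: "norm (Im_bmfun f) \<le> norm f"
  by (rule norm_bmfun_le, simp, meson abs_Im_le_cmod norm_apply_bmfun_le order_trans)

lemma norm_Complex_bmfun: "norm (Complex_bmfun u v) \<le> norm u + norm v"
  by (rule norm_bmfun_le)
    (use norm_apply_bmfun_le[of u] norm_apply_bmfun_le[of v] in
      \<open>auto simp: norm_mult intro!: norm_triangle_mono\<close>)

lemma norm_complexify_apply_le:
  "norm (complexify S f) \<le> norm (S (Re_bmfun f)) + norm (S (Im_bmfun f))"
  using norm_Complex_bmfun by (simp add: complexify.rep_eq)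

lemma norm_complexify_le: "norm (complexify S) \<le> 2 * norm S"
proof (rule norm_blinfun_bound)
  fix f
  have "norm (S (Re_bmfun f)) \<le> norm S * norm f" "norm (S (Im_bmfun f)) \<le> norm S * norm f"
    by (meson norm_blinfun norm_Re_bmfun norm_Im_bmfun mult_left_mono norm_ge_zero order_trans)+
  then show "norm (complexify S f) \<le> 2 * norm S * norm f"
    using norm_complexify_apply_le[of S f] by simp
qed simp

lemma complexify_diff: "complexify (S - S') = complexify S - complexify S'"
  by (intro blinfun_eqI bmfun_eqI) (simp add: blinfun.diff_left algebra_simps)

lemma norm_scaleC_bmfun: "norm (scaleC_bmfun c f) = cmod c * norm f"
proof (rule antisym)
  have le: "norm (scaleC_bmfun c f) \<le> cmod c * norm f" for c and f :: "('a, complex) bmfun"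
    by (rule norm_bmfun_le) (simp add: norm_mult mult_left_mono norm_apply_bmfun_le)
  show "norm (scaleC_bmfun c f) \<le> cmod c * norm f" by (rule le)
  show "cmod c * norm f \<le> norm (scaleC_bmfun c f)"
  proof (cases "c = 0")
    case False
    have "scaleC_bmfun (1 / c) (scaleC_bmfun c f) = f" using False by (intro bmfun_eqI) simp
    then show ?thesis using le[of "1 / c" "scaleC_bmfun c f"] False
      by (simp add: norm_divide field_simps)
  qed simp
qed

lemma norm_scalar_op_le: "norm (scalar_op z) \<le> cmod z"
  by (rule norm_blinfun_bound) (auto simp: norm_scaleC_bmfun)

lemma bounded_linear_scalar_op: "bounded_linear scalar_op"
proof (rule bounded_linear_intro[where K = 1])
  show "scalar_op (x + y) = scalar_op x + scalar_op y" for x y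
    by (intro blinfun_eqI bmfun_eqI) (simp add: blinfun.add_left algebra_simps)
  show "scalar_op (r *\<^sub>R x) = r *\<^sub>R scalar_op x" for r x
    by (intro blinfun_eqI bmfun_eqI) (simp add: blinfun.scaleR_left)
qed (simp add: norm_scalar_op_le)

lemma scalar_op_diff: "scalar_op z - scalar_op w = scalar_op (z - w)"
  by (simp add: bounded_linear_scalar_op linear_diff[OF bounded_linear.linear])

text \<open>The complexification is complex linear, which its type as a real bounded operator does not record.
  It makes the resolvent commute with scalars and hence complex differentiable.\<close>

lemma complexify_scaleC: "complexify S (scaleC_bmfun c f) = scaleC_bmfun c (complexify S f)"
proof -
  have "Re_bmfun (scaleC_bmfun c f) = Re c *\<^sub>R Re_bmfun f - Im c *\<^sub>R Im_bmfun f"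
    "Im_bmfun (scaleC_bmfun c f) = Re c *\<^sub>R Im_bmfun f + Im c *\<^sub>R Re_bmfun f"
    by (auto intro!: bmfun_eqI)
  then show ?thesis
    by (intro bmfun_eqI complex_eqI) (simp_all add: blinfun.diff_right blinfun.add_right blinfun.scaleR_right)
qed

lemma shifted_scaleC: "shifted S z (scaleC_bmfun c f) = scaleC_bmfun c (shifted S z f)"
  by (rule bmfun_eqI) (simp only: blinfun.diff_left complexify_scaleC, simp add: algebra_simps)

lemma resolvent:
  fixes S :: "('a::topological_space, real) bmfun \<Rightarrow>\<^sub>L ('a, real) bmfun"
  assumes "z \<notin> op_spectrum S"
  shows "resolvent S z o\<^sub>L shifted S z = id_blinfun" "shifted S z o\<^sub>L resolvent S z = id_blinfun"
proof -
  obtain R where R: "is_resolvent S z R" using assms by (auto simp: op_spectrum_def)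
  have "R' = R" if "is_resolvent S z R'" for R'
  proof -
    have id: "A o\<^sub>L id_blinfun = A" "id_blinfun o\<^sub>L A = A"
      for A :: "('a, complex) bmfun \<Rightarrow>\<^sub>L ('a, complex) bmfun"
      by (auto intro: blinfun_eqI)
    have "R' = R' o\<^sub>L (shifted S z o\<^sub>L R)" using R by (simp add: is_resolvent_def id)
    also have "\<dots> = (R' o\<^sub>L shifted S z) o\<^sub>L R" by (simp add: blinfun_eqI)
    also have "\<dots> = R" using that by (simp add: is_resolvent_def id)
    finally show ?thesis .
  qed
  with R have "is_resolvent S z (resolvent S z)"
    unfolding resolvent_def by (metis theI)
  then show "resolvent S z o\<^sub>L shifted S z = id_blinfun" "shifted S z o\<^sub>L resolvent S z = id_blinfun"
    by (auto simp: is_resolvent_def)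
qed

lemma resolvent_shifted [simp]: "z \<notin> op_spectrum S \<Longrightarrow> resolvent S z (shifted S z f) = f"
  and shifted_resolvent [simp]: "z \<notin> op_spectrum S \<Longrightarrow> shifted S z (resolvent S z f) = f"
  using resolvent[of z S] by (metis blinfun_apply_blinfun_compose id_blinfun.rep_eq id_apply)+

lemma resolvent_eqI: "z \<notin> op_spectrum S \<Longrightarrow> shifted S z f = g \<Longrightarrow> resolvent S z g = f"
  by auto

lemma resolvent_scaleC:
  "z \<notin> op_spectrum S \<Longrightarrow> resolvent S z (scaleC_bmfun c f) = scaleC_bmfun c (resolvent S z f)"
  by (rule resolvent_eqI) (simp_all add: shifted_scaleC)

lemma norm_shifted_diff_le: "norm (shifted S z - shifted S w) \<le> cmod (z - w)"
proof -
  have "shifted S z - shifted S w = scalar_op (w - z)"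
    by (simp flip: scalar_op_diff)
  then show ?thesis by (metis norm_minus_commute norm_scalar_op_le)
qed

text \<open>Boundary points of the spectrum are approximate eigenvalues.\<close>

lemma notin_spectrum_if_bounded_below:
  assumes "z \<in> closure (- op_spectrum S)" "bounded_below c (shifted S z)" "0 < c"
  shows "z \<notin> op_spectrum S"
proof -
  obtain w where w: "w \<notin> op_spectrum S" "dist w z < c / 2"
    using assms(1,3) unfolding closure_approachable by (metis ComplD half_gt_zero)
  have "2 * norm (shifted S z - shifted S w) < c"
    using norm_shifted_diff_le[of S z w] w(2) by (simp add: dist_norm norm_minus_commute)
  then show ?thesis
    using invertible_near_bounded_below[OF assms(2)] w(1) by (simp add: not_in_spectrum_iff)
qed

lemma closed_op_spectrum: "closed (op_spectrum S)"
proof -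
  have "open (- op_spectrum S)" unfolding open_dist
  proof (intro ballI)
    fix z assume "z \<in> - op_spectrum S"
    then have inv: "invertible_blinfun (shifted S z)" by (simp add: not_in_spectrum_iff)
    then obtain c where c: "0 < c" "bounded_below c (shifted S z)"
      using invertible_imp_bounded_below by blast
    have "w \<in> - op_spectrum S" if "dist w z < c / 3" for w
    proof -
      have n: "norm (shifted S z - shifted S w) < c / 3"
        using norm_shifted_diff_le[of S z w] that by (simp add: dist_norm norm_minus_commute)
      have "invertible_blinfun (shifted S w)"
      proof (rule invertible_near_bounded_below[OF bounded_below_perturb[OF c(2)] inv])
        show "2 * norm (shifted S w - shifted S z) < c - norm (shifted S z - shifted S w)"
          using n by (simp add: norm_minus_commute)
      qed
      then show ?thesis by (simp add: not_in_spectrum_iff)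
    qed
    then show "\<exists>e>0. \<forall>w. dist w z < e \<longrightarrow> w \<in> - op_spectrum S"
      using c(1) by (intro exI[of _ "c / 3"]) auto
  qed
  then show ?thesis by (simp add: closed_def)
qed

text \<open>The operator \<open>- z\<close> is invertible and bounded below by \<open>\<bar>z\<bar>\<close>, and \<open>S - z\<close> is a perturbation of it by
  \<open>S\<close>. The perturbation argument asks for \<open>2 * \<parallel>S\<parallel> < \<bar>z\<bar> - \<parallel>S\<parallel>\<close>, whence the constant \<open>3\<close>.\<close>

lemma norm_le_of_mem_op_spectrum:
  fixes S :: "('a::topological_space, real) bmfun \<Rightarrow>\<^sub>L ('a, real) bmfun"
  assumes "z \<in> op_spectrum S"
  shows "cmod z \<le> 3 * norm (complexify S)"
proof (rule ccontr)
  assume "\<not> ?thesis"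
  then have z: "3 * norm (complexify S) < cmod z" by simp
  then have "z \<noteq> 0" using norm_ge_zero[of "complexify S"] by auto
  define B :: "('a, complex) bmfun \<Rightarrow>\<^sub>L ('a, complex) bmfun" where "B = scalar_op (- z)"
  have bB: "bounded_below (cmod z) B"
    by (simp add: bounded_below_def B_def norm_scaleC_bmfun)
  have inv: "invertible_blinfun B"
    unfolding invertible_blinfun_def B_def using \<open>z \<noteq> 0\<close>
    by (intro exI[of _ "scalar_op (- 1 / z)"] conjI blinfun_eqI bmfun_eqI) simp_all
  have d: "shifted S z - B = complexify S"
  proof -
    have "scalar_op z + B = scalar_op (z - z)" unfolding B_def
      by (intro blinfun_eqI bmfun_eqI) (simp add: blinfun.add_left)
    then show ?thesis
      by (intro blinfun_eqI bmfun_eqI) (simp add: blinfun.diff_left B_def)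
  qed
  have "norm (B - shifted S z) = norm (complexify S)" using d by (metis norm_minus_commute)
  then have b: "bounded_below (cmod z - norm (complexify S)) (shifted S z)"
    using bounded_below_perturb[OF bB, of "shifted S z"] by simp
  have "invertible_blinfun (shifted S z)"
    by (rule invertible_near_bounded_below[OF b inv]) (simp only: d, use z in simp)
  then show False using assms by (simp add: not_in_spectrum_iff[symmetric])
qed

text \<open>The resolvent identity, applied to a vector.\<close>

lemma resolvent_diff:
  assumes "z \<notin> op_spectrum S" "w \<notin> op_spectrum S"
  shows "resolvent S z f - resolvent S w f = scaleC_bmfun (z - w) (resolvent S w (resolvent S z f))"
proof -
  let ?g = "resolvent S z f"
  have "shifted S w ?g = f + scaleC_bmfun (z - w) ?g"
  proof -
    have "shifted S w ?g = shifted S z ?g + scaleC_bmfun (z - w) ?g"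
      by (rule bmfun_eqI) (simp only: blinfun.diff_left, simp add: algebra_simps)
    then show ?thesis using assms by simp
  qed
  then have "?g = resolvent S w (f + scaleC_bmfun (z - w) ?g)"
    using assms(2) by (metis resolvent_eqI)
  then show ?thesis using assms(2) by (simp add: blinfun.add_right resolvent_scaleC algebra_simps)
qed

lemma continuous_on_resolvent: "continuous_on (- op_spectrum S) (resolvent S)"
  unfolding continuous_on_iff
proof (intro ballI allI impI)
  fix z e assume z: "z \<in> - op_spectrum S" and e: "(0::real) < e"
  then obtain c where c: "0 < c" "bounded_below c (shifted S z)"
    using invertible_imp_bounded_below by (auto simp: not_in_spectrum_iff)
  have Rz: "norm (resolvent S z) \<le> 1 / c"
    using z by (intro norm_inverse_le[OF c(2,1)] resolvent) simp
  show "\<exists>d>0. \<forall>w\<in>- op_spectrum S. dist w z < d \<longrightarrow> dist (resolvent S w) (resolvent S z) < e"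
  proof (intro exI conjI ballI impI)
    show "0 < min (c / 2) (e * c\<^sup>2 / 4)" using c e by simp
    fix w assume w: "w \<in> - op_spectrum S" "dist w z < min (c / 2) (e * c\<^sup>2 / 4)"
    have "bounded_below (c / 2) (shifted S w)"
      using bounded_below_perturb[OF c(2), of "shifted S w"] norm_shifted_diff_le[of S z w] w(2)
      unfolding bounded_below_def
      by (smt (verit) dist_norm min_less_iff_conj mult_right_mono norm_ge_zero norm_minus_commute field_sum_of_halves)
    then have Rw: "norm (resolvent S w) \<le> 1 / (c / 2)"
      using w c by (intro norm_inverse_le[OF _ _ resolvent(2)]) auto
    have "norm (resolvent S w - resolvent S z) \<le> cmod (w - z) * (1 / c * (1 / (c / 2)))"
    proof (rule norm_blinfun_bound)
      fix f
      have "norm ((resolvent S w - resolvent S z) f) = cmod (w - z) * norm (resolvent S z (resolvent S w f))"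
        using z w by (simp add: blinfun.diff_left resolvent_diff norm_scaleC_bmfun)
      also have "norm (resolvent S z (resolvent S w f)) \<le> (1 / c) * ((1 / (c / 2)) * norm f)"
        using Rz Rw c
        by (meson norm_blinfun order_trans mult_mono norm_ge_zero divide_nonneg_pos zero_le_one mult_right_mono mult_left_mono)
      finally show "norm ((resolvent S w - resolvent S z) f) \<le> cmod (w - z) * (1 / c * (1 / (c / 2))) * norm f"
        by (simp add: mult_left_mono)
    qed (use c in simp)
    also have "\<dots> < e"
    proof -
      have "cmod (w - z) * (2 / c\<^sup>2) < e * c\<^sup>2 / 4 * (2 / c\<^sup>2)"
        using w(2) c by (intro mult_strict_right_mono) (auto simp: dist_norm)
      also have "\<dots> < e" using c e by (simp add: field_simps)
      finally show ?thesis by (simp add: power2_eq_square)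
    qed
    finally show "dist (resolvent S w) (resolvent S z) < e" by (simp add: dist_norm)
  qed
qed

lemma bounded_linear_eval: "bounded_linear (\<lambda>L. apply_bmfun (blinfun_apply L f) x)"
proof (rule bounded_linear_intro[where K = "norm f"])
  show "norm (apply_bmfun (blinfun_apply L f) x) \<le> norm L * norm f" for L
    by (meson norm_apply_bmfun_le norm_blinfun order_trans)
qed (simp_all add: blinfun.add_left blinfun.scaleR_left)

lemma holomorphic_on_resolvent:
  "(\<lambda>z. apply_bmfun (resolvent S z f) x) holomorphic_on (- op_spectrum S)"
proof -
  let ?\<phi> = "\<lambda>z. apply_bmfun (resolvent S z f) x"
  have op: "open (- op_spectrum S)" using closed_op_spectrum by auto
  have cont: "continuous_on (- op_spectrum S) (\<lambda>z. apply_bmfun (resolvent S w (resolvent S z f)) x)" for w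
  proof -
    have "bounded_linear (\<lambda>L. apply_bmfun (blinfun_apply (resolvent S w o\<^sub>L L) f) x)"
      by (rule bounded_linear_compose[OF bounded_linear_eval
          bounded_bilinear.bounded_linear_right[OF bounded_bilinear_blinfun_compose]])
    then show ?thesis
      using continuous_on_compose2[OF linear_continuous_on[of _ UNIV] continuous_on_resolvent] by auto
  qed
  have "(?\<phi> has_field_derivative apply_bmfun (resolvent S w (resolvent S w f)) x) (at w)"
    if w: "w \<in> - op_spectrum S" for w
    unfolding has_field_derivative_iff
  proof (rule Lim_transform_eventually)
    show "((\<lambda>z. apply_bmfun (resolvent S w (resolvent S z f)) x) \<longlongrightarrow>
        apply_bmfun (resolvent S w (resolvent S w f)) x) (at w)"
      using cont[of w] op w by (simp add: continuous_on_eq_continuous_at isCont_def)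
    show "\<forall>\<^sub>F z in at w. apply_bmfun (resolvent S w (resolvent S z f)) x = (?\<phi> z - ?\<phi> w) / (z - w)"
      using eventually_at_in_open[OF op w]
    proof eventually_elim
      case (elim z)
      then have "apply_bmfun (resolvent S z f - resolvent S w f) x =
          (z - w) * apply_bmfun (resolvent S w (resolvent S z f)) x"
        using w resolvent_diff[of z S w f] by simp
      then show ?case using elim by (simp add: field_simps)
    qed
  qed
  then show ?thesis unfolding holomorphic_on_open[OF op] by blast
qed

section \<open>Contour integrals of the resolvent\<close>

text \<open>Each closed half plane without \<open>A\<close> lies between an open half plane and its closure, and the two
  meet in a large real number.\<close>

lemma connected_Compl_real:
  fixes A :: "complex set"
  assumes "bounded A" "A \<subseteq> \<real>"
  shows "connected (- A)"
proof -
  obtain b where b: "0 < b" "\<And>z. z \<in> A \<Longrightarrow> cmod z < b"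
    using assms(1) by (meson bounded_pos_less)
  have half: "connected {z. 0 < Im z}" "connected {z. Im z < 0}"
    by (auto intro: convex_connected convex_halfspace_Im_gt convex_halfspace_Im_lt)
  have cl: "closure {z. 0 < Im z} = {z. 0 \<le> Im z}" "closure {z. Im z < 0} = {z. Im z \<le> 0}"
    using closure_halfspace_gt[of \<i> 0] closure_halfspace_lt[of \<i> 0]
    by (simp_all add: inner_complex_def)
  have Im: "Im z = 0" if "z \<in> A" for z using that assms(2) by (auto simp: complex_is_Real_iff)
  have "connected ({z. 0 \<le> Im z} - A)" "connected ({z. Im z \<le> 0} - A)"
    by (rule connected_intermediate_closure[OF half(1)], use Im cl in force, use cl in blast)
      (rule connected_intermediate_closure[OF half(2)], use Im cl in force, use cl in blast)
  moreover have "({z. 0 \<le> Im z} - A) \<inter> ({z. Im z \<le> 0} - A) \<noteq> {}"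
  proof -
    have "complex_of_real b \<in> ({z. 0 \<le> Im z} - A) \<inter> ({z. Im z \<le> 0} - A)"
      using b(2)[of "of_real b"] \<open>0 < b\<close> by auto
    then show ?thesis by blast
  qed
  ultimately have "connected (({z. 0 \<le> Im z} - A) \<union> ({z. Im z \<le> 0} - A))"
    by (rule connected_Un)
  moreover have "({z. 0 \<le> Im z} - A) \<union> ({z. Im z \<le> 0} - A) = - A" by auto
  ultimately show ?thesis by simp
qed

text \<open>Join the two loops by a path \<open>p\<close> in the complement of \<open>A\<close>. The loop that runs through \<open>g\<close>, \<open>p\<close>, \<open>h\<close> backwards
  and \<open>p\<close> backwards has winding number \<open>0\<close> about each point of \<open>A\<close>, and the contributions of \<open>p\<close> cancel.\<close>

lemma contour_integral_eq_if_winding_number_eq: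
  assumes "closed A" "connected (- A)" and hol: "f holomorphic_on (- A)"
    and g: "valid_path g" "pathfinish g = pathstart g" "path_image g \<inter> A = {}"
    and h: "valid_path h" "pathfinish h = pathstart h" "path_image h \<inter> A = {}"
    and wn: "\<And>w. w \<in> A \<Longrightarrow> winding_number g w = winding_number h w"
  shows "contour_integral g f = contour_integral h f"
proof -
  have op: "open (- A)" using assms(1) by auto
  have "pathstart g \<in> - A" "pathstart h \<in> - A" using g(3) h(3) by auto
  then obtain p where p: "polynomial_function p" "path_image p \<subseteq> - A"
      "pathstart p = pathstart g" "pathfinish p = pathstart h"
    using connected_open_polynomial_connected[OF op assms(2)] by metis
  then have pv: "valid_path p" by (simp add: valid_path_polynomial_function)
  note pa = valid_path_imp_path[OF g(1)] valid_path_imp_path[OF h(1)] valid_path_imp_path[OF pv]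
  let ?l = "g +++ (p +++ (reversepath h +++ reversepath p))"
  have v: "valid_path ?l" using g h pv p by (auto intro!: valid_path_join)
  have im: "path_image ?l \<subseteq> - A"
    using g h p pa by (auto simp: path_image_join)
  have wl: "winding_number ?l w = 0" if "w \<in> A" for w
  proof -
    have nin: "w \<notin> path_image g" "w \<notin> path_image h" "w \<notin> path_image p" using that g h p by auto
    have "winding_number ?l w = winding_number g w +
        (winding_number p w + (winding_number (reversepath h) w + winding_number (reversepath p) w))"
      using pa g h p nin by (simp add: winding_number_join path_image_join not_in_path_image_join)
    then show ?thesis using wn[OF that] nin pa by (simp add: winding_number_reversepath)
  qed
  have "(f has_contour_integral 0) ?l"
    by (rule Cauchy_theorem_global[OF op hol v _ im]) (use g h p wl in auto)
  then have zero: "contour_integral ?l f = 0" by (rule contour_integral_unique)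
  have int: "f contour_integrable_on q" if "valid_path q" "path_image q \<subseteq> - A" for q
    by (rule contour_integrable_holomorphic_simple[OF hol op that])
  have i: "f contour_integrable_on g" "f contour_integrable_on h" "f contour_integrable_on p"
    by (intro int; use g h pv p in auto)+
  have "contour_integral ?l f = contour_integral g f +
      (contour_integral p f + (contour_integral (reversepath h) f + contour_integral (reversepath p) f))"
    using g h p pv i by (simp add: contour_integrable_reversepath)
  then show ?thesis using zero g h pv i by (simp add: contour_integral_reversepath)
qed

abbreviation resolvent_integrand ::
    "(('a::topological_space, real) bmfun \<Rightarrow>\<^sub>L ('a, real) bmfun) \<Rightarrow> (real \<Rightarrow> complex) \<Rightarrow> real \<Rightarrow>
      (('a, complex) bmfun \<Rightarrow>\<^sub>L ('a, complex) bmfun)"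
  where "resolvent_integrand S \<gamma> t \<equiv>
    scalar_op (vector_derivative \<gamma> (at t within {0..1})) o\<^sub>L resolvent S (\<gamma> t)"

text \<open>Evaluation at a vector and a point turns the operator-valued integral into an ordinary contour
  integral, to which Cauchy's theorem applies.\<close>

lemma has_contour_integral_resolvent:
  assumes "(resolvent_integrand S \<gamma> has_integral J) {0..1}"
  shows "((\<lambda>z. apply_bmfun (resolvent S z f) x) has_contour_integral apply_bmfun (J f) x) \<gamma>"
  using has_integral_linear[OF assms bounded_linear_eval[of f x]]
  by (simp add: has_contour_integral_def o_def mult.commute)

lemma bounded_op_spectrum: "bounded (op_spectrum S)"
  using norm_le_of_mem_op_spectrum by (auto simp: bounded_iff)

lemma spectral_projection_unique:
  fixes S :: "('a::topological_space, real) bmfun \<Rightarrow>\<^sub>L ('a, real) bmfun"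
  assumes real: "op_spectrum S \<subseteq> \<real>"
    and P: "is_spectral_projection S W P" and Q: "is_spectral_projection S W Q"
  shows "P = Q"
proof -
  let ?s = "op_spectrum S" and ?c = "- 1 / (2 * of_real pi * \<i>)"
  obtain g J where g: "valid_path g" "simple_path g" "pathfinish g = pathstart g"
      "\<And>z. z \<in> inside (path_image g) \<Longrightarrow> winding_number g z = 1"
      "path_image g \<inter> ?s = {}" "inside (path_image g) \<inter> ?s = W \<inter> ?s"
      "(resolvent_integrand S g has_integral J) {0..1}" "P = scalar_op ?c o\<^sub>L J"
    using P unfolding is_spectral_projection_def by blast
  obtain h K where h: "valid_path h" "simple_path h" "pathfinish h = pathstart h"
      "\<And>z. z \<in> inside (path_image h) \<Longrightarrow> winding_number h z = 1"
      "path_image h \<inter> ?s = {}" "inside (path_image h) \<inter> ?s = W \<inter> ?s"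
      "(resolvent_integrand S h has_integral K) {0..1}" "Q = scalar_op ?c o\<^sub>L K"
    using Q unfolding is_spectral_projection_def by blast
  have wn: "winding_number q w = (if w \<in> W then 1 else 0)"
    if q: "valid_path q" "pathfinish q = pathstart q"
      "\<And>z. z \<in> inside (path_image q) \<Longrightarrow> winding_number q z = 1"
      "path_image q \<inter> ?s = {}" "inside (path_image q) \<inter> ?s = W \<inter> ?s" and w: "w \<in> ?s" for q w
  proof (cases "w \<in> W")
    case True
    then have "w \<in> inside (path_image q)" using q(5) w by blast
    then show ?thesis using q(3) True by simp
  next
    case False
    then have "w \<in> outside (path_image q)"
      using q(4,5) w inside_Un_outside[of "path_image q"] by blast
    then show ?thesis
      using winding_number_zero_in_outside[OF valid_path_imp_path[OF q(1)] q(2)] False by simp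
  qed
  have "J = K"
  proof (intro blinfun_eqI bmfun_eqI)
    fix f x
    let ?\<phi> = "\<lambda>z. apply_bmfun (resolvent S z f) x"
    have "contour_integral g ?\<phi> = contour_integral h ?\<phi>"
    proof (rule contour_integral_eq_if_winding_number_eq[OF closed_op_spectrum[of S]])
      show "connected (- ?s)" by (rule connected_Compl_real[OF bounded_op_spectrum real])
      show "winding_number g w = winding_number h w" if "w \<in> ?s" for w
        using wn[OF g(1,3,4,5,6) that] wn[OF h(1,3,4,5,6) that] by simp
    qed (fact g h holomorphic_on_resolvent)+
    then show "apply_bmfun (J f) x = apply_bmfun (K f) x"
      using contour_integral_unique[OF has_contour_integral_resolvent[OF g(7)]]
        contour_integral_unique[OF has_contour_integral_resolvent[OF h(7)]] by simp
  qed
  then show ?thesis using g(8) h(8) by simp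
qed

text \<open>The projection along a circle is given a name of its own because, unlike the contours that the
  definition of spectral projections quantifies over, the circle is the same for all operators
  of a convergent sequence.\<close>

definition circle_projection ::
    "(('a::topological_space, real) bmfun \<Rightarrow>\<^sub>L ('a, real) bmfun) \<Rightarrow> complex \<Rightarrow> real \<Rightarrow>
      (('a, complex) bmfun \<Rightarrow>\<^sub>L ('a, complex) bmfun)"
  where "circle_projection S c r =
    scalar_op (- 1 / (2 * of_real pi * \<i>)) o\<^sub>L integral {0..1} (resolvent_integrand S (circlepath c r))"

lemma has_integral_circle:
  fixes S :: "('a::topological_space, real) bmfun \<Rightarrow>\<^sub>L ('a, real) bmfun"
  assumes "0 < r" "sphere c r \<inter> op_spectrum S = {}"
  shows "(resolvent_integrand S (circlepath c r) has_integral
    integral {0..1} (resolvent_integrand S (circlepath c r))) {0..1}"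
proof (rule integrable_integral, rule integrable_continuous_real)
  have "continuous_on {0..1} (\<lambda>t. scalar_op (2 * pi * \<i> * r * exp (2 * of_real pi * \<i> * of_real t)) o\<^sub>L
      resolvent S (circlepath c r t) :: ('a, complex) bmfun \<Rightarrow>\<^sub>L ('a, complex) bmfun)"
  proof (rule bounded_bilinear.continuous_on[OF bounded_bilinear_blinfun_compose])
    show "continuous_on {0..1} (\<lambda>t. scalar_op (2 * pi * \<i> * r * exp (2 * of_real pi * \<i> * of_real t))
        :: ('a, complex) bmfun \<Rightarrow>\<^sub>L ('a, complex) bmfun)"
      by (intro bounded_linear.continuous_on[OF bounded_linear_scalar_op] continuous_intros)
    have "circlepath c r ` {0..1} \<subseteq> - op_spectrum S"
      using assms path_image_circlepath[of c r] by (auto simp: path_image_def)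
    then show "continuous_on {0..1} (\<lambda>t. resolvent S (circlepath c r t))"
      using path_circlepath[of c r] unfolding path_def
      by (intro continuous_on_compose2[OF continuous_on_resolvent]) auto
  qed
  then show "continuous_on {0..1} (resolvent_integrand S (circlepath c r))"
    by (rule continuous_on_eq) (simp add: vector_derivative_circlepath01)
qed

lemma inside_sphere_complex: "0 < r \<Longrightarrow> inside (sphere (c::complex) r) = ball c r"
  using inside_frontier_eq_interior[of "cball c r"] by simp

lemma is_spectral_projection_circle:
  assumes r: "0 < r" and s: "sphere c r \<inter> op_spectrum S = {}"
    and b: "ball c r \<inter> op_spectrum S = W \<inter> op_spectrum S"
  shows "is_spectral_projection S W (circle_projection S c r)"
  unfolding is_spectral_projection_def
proof (intro exI conjI)
  show "(resolvent_integrand S (circlepath c r) has_integral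
    integral {0..1} (resolvent_integrand S (circlepath c r))) {0..1}"
    by (rule has_integral_circle[OF r s])
  show "circle_projection S c r = scalar_op (- 1 / (2 * of_real pi * \<i>)) o\<^sub>L
      integral {0..1} (resolvent_integrand S (circlepath c r))"
    by (fact circle_projection_def)
qed (use r s b in \<open>auto simp: inside_sphere_complex simple_path_circlepath
  winding_number_circlepath dist_norm norm_minus_commute\<close>)

lemma spectral_projection_eq_circle:
  assumes "0 < r" "sphere c r \<inter> op_spectrum S = {}"
    and "ball c r \<inter> op_spectrum S = W \<inter> op_spectrum S" and "op_spectrum S \<subseteq> \<real>"
  shows "\<exists>!P. is_spectral_projection S W P" "spectral_projection S W = circle_projection S c r"
proof -
  note P = is_spectral_projection_circle[OF assms(1-3)]
  show ex: "\<exists>!P. is_spectral_projection S W P"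
    using P spectral_projection_unique[OF assms(4)] by blast
  show "spectral_projection S W = circle_projection S c r"
    unfolding spectral_projection_def using ex P by (rule the1_equality)
qed

text \<open>On an eigenvector the resolvent at \<open>z\<close> is multiplication by \<open>1 / (l - z)\<close>, so the integral is given by
  Cauchy's integral formula.\<close>

lemma circle_projection_eigenvector:
  assumes "0 < r" "sphere c r \<inter> op_spectrum S = {}" "l \<in> ball c r"
    and f: "complexify S f = scaleC_bmfun l f"
  shows "circle_projection S c r f = f"
proof (rule bmfun_eqI)
  fix x
  let ?J = "integral {0..1} (resolvent_integrand S (circlepath c r))"
  let ?v = "apply_bmfun f x"
  have res: "apply_bmfun (resolvent S z f) x = - ?v / (z - l)" if z: "z \<in> sphere c r" for z
  proof -
    have "z \<noteq> l" "z \<notin> op_spectrum S" using z assms by auto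
    have "shifted S z (scaleC_bmfun (1 / (l - z)) f) = scaleC_bmfun (1 / (l - z)) (shifted S z f)"
      by (rule shifted_scaleC)
    also have "shifted S z f = scaleC_bmfun (l - z) f"
      by (rule bmfun_eqI) (simp only: blinfun.diff_left f, simp add: algebra_simps)
    also have "scaleC_bmfun (1 / (l - z)) (scaleC_bmfun (l - z) f) = f"
      using \<open>z \<noteq> l\<close> by (intro bmfun_eqI) simp
    finally have "resolvent S z f = scaleC_bmfun (1 / (l - z)) f"
      by (rule resolvent_eqI[OF \<open>z \<notin> op_spectrum S\<close>])
    then show ?thesis using \<open>z \<noteq> l\<close> by (simp add: divide_simps algebra_simps)
  qed
  have "((\<lambda>z. (- ?v) / (z - l)) has_contour_integral (2 * of_real pi * \<i> * (- ?v))) (circlepath c r)"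
    by (rule Cauchy_integral_circlepath_simple[where f = "\<lambda>_. - ?v"])
      (use assms in \<open>auto simp: dist_norm norm_minus_commute\<close>)
  moreover have "((\<lambda>z. (- ?v) / (z - l)) has_contour_integral apply_bmfun (?J f) x) (circlepath c r)"
    by (rule has_contour_integral_eq[OF has_contour_integral_resolvent[OF has_integral_circle[OF assms(1,2)]]])
      (use res assms(1) in auto)
  ultimately have "apply_bmfun (?J f) x = 2 * of_real pi * \<i> * (- ?v)"
    by (rule has_contour_integral_unique[symmetric])
  then show "apply_bmfun (circle_projection S c r f) x = ?v"
    by (simp add: circle_projection_def)
qed

lemma circle_projection_eq_0:
  assumes "0 < r" "cball c r \<inter> op_spectrum S = {}"
  shows "circle_projection S c r = 0"
proof (intro blinfun_eqI bmfun_eqI)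
  fix f x
  let ?J = "integral {0..1} (resolvent_integrand S (circlepath c r))"
  have s: "sphere c r \<inter> op_spectrum S = {}" using assms(2) sphere_cball by blast
  have "cball c r \<subseteq> - op_spectrum S" using assms(2) by blast
  then have "(\<lambda>z. apply_bmfun (resolvent S z f) x) holomorphic_on cball c r"
    using holomorphic_on_resolvent holomorphic_on_subset by blast
  then have "((\<lambda>z. apply_bmfun (resolvent S z f) x) has_contour_integral 0) (circlepath c r)"
    using assms(1)
    by (intro Cauchy_theorem_convex_simple[of _ "cball c r"]) auto
  then have "apply_bmfun (?J f) x = 0"
    using has_contour_integral_resolvent[OF has_integral_circle[OF assms(1) s]]
      has_contour_integral_unique by blast
  then show "apply_bmfun (circle_projection S c r f) x = apply_bmfun (blinfun_apply 0 f) x"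
    by (simp add: circle_projection_def)
qed

lemma norm_circle_projection_diff_le:
  assumes "0 < r" "sphere c r \<inter> op_spectrum S = {}" "sphere c r \<inter> op_spectrum S' = {}"
    and B: "\<And>z. z \<in> sphere c r \<Longrightarrow> norm (resolvent S z f - resolvent S' z f) \<le> B"
  shows "norm (circle_projection S c r f - circle_projection S' c r f) \<le> r * B"
proof -
  let ?\<gamma> = "circlepath c r" and ?J = "\<lambda>S. integral {0..1} (resolvent_integrand S (circlepath c r))"
  have "c + of_real r \<in> sphere c r" using assms(1) by (simp add: dist_norm)
  then have "0 \<le> B" using B norm_ge_zero order_trans by blast
  have "norm (?J S f - ?J S' f) \<le> 2 * pi * r * B"
  proof (rule norm_bmfun_le)
    fix x
    have "((\<lambda>z. apply_bmfun (resolvent S z f) x - apply_bmfun (resolvent S' z f) x)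
        has_contour_integral (apply_bmfun (?J S f) x - apply_bmfun (?J S' f) x)) ?\<gamma>"
      by (intro has_contour_integral_diff has_contour_integral_resolvent has_integral_circle assms)
    then have "norm (apply_bmfun (?J S f) x - apply_bmfun (?J S' f) x) \<le> B * (2 * pi * r)"
    proof (rule has_contour_integral_bound_circlepath[OF _ \<open>0 \<le> B\<close> \<open>0 < r\<close>])
      fix z assume "cmod (z - c) = r"
      then have "norm (resolvent S z f - resolvent S' z f) \<le> B"
        by (intro B) (simp add: dist_norm norm_minus_commute)
      then show "cmod (apply_bmfun (resolvent S z f) x - apply_bmfun (resolvent S' z f) x) \<le> B"
        using norm_apply_bmfun_le[of "resolvent S z f - resolvent S' z f" x] by simp
    qed
    then show "norm (apply_bmfun (?J S f - ?J S' f) x) \<le> 2 * pi * r * B" by (simp add: mult_ac)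
  qed
  moreover have "circle_projection S c r f - circle_projection S' c r f =
      scaleC_bmfun (- 1 / (2 * of_real pi * \<i>)) (?J S f - ?J S' f)"
    by (rule bmfun_eqI) (simp add: circle_projection_def diff_divide_distrib)
  ultimately show ?thesis by (simp add: norm_scaleC_bmfun norm_divide norm_mult field_simps)
qed

section \<open>The operator of one kernel and one measure\<close>

lemma one_over_Suc_tendsto: "(\<lambda>j. 1 / real (Suc j)) \<longlonglongrightarrow> 0"
  using LIMSEQ_inverse_real_of_nat by (simp add: inverse_eq_divide)

locale kernel_measure = prob_space \<nu>
  for \<nu> :: "'a::topological_space measure" +
  fixes k :: "'a \<Rightarrow> 'a \<Rightarrow> real" and c M :: real
  assumes sets_eq [measurable_cong]: "sets \<nu> = sets borel"
    and k_measurable [measurable]: "(\<lambda>(x, y). k x y) \<in> borel_measurable (borel \<Otimes>\<^sub>M borel)"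
    and k_sym: "k x y = k y x" and k_nonneg: "0 \<le> k x y" and k_le: "k x y \<le> M"
    and c_pos: "0 < c" and deg_ge: "c \<le> deg k \<nu> x"
begin

abbreviation "h \<equiv> hker k \<nu>"
abbreviation "m \<equiv> mfun k \<nu>"
abbreviation "U \<equiv> Uop k \<nu>"

lemma M_nonneg: "0 \<le> M" using k_nonneg k_le order_trans by blast

lemma deg_measurable [measurable]: "deg k \<nu> \<in> borel_measurable borel"
  unfolding deg_def by measurable

lemma h_measurable [measurable]: "(\<lambda>(x, y). h x y) \<in> borel_measurable (borel \<Otimes>\<^sub>M borel)"
  unfolding hker_def by measurable

lemma h_measurable1 [measurable]: "h x \<in> borel_measurable borel"
  unfolding hker_def by measurable

lemma deg_pos: "0 < deg k \<nu> x" using c_pos deg_ge[of x] by linarith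

lemma h_nonneg: "0 \<le> h x y"
  unfolding hker_def using k_nonneg[of x y] deg_pos[of x] deg_pos[of y] by simp

lemma h_sym: "h x y = h y x" unfolding hker_def using k_sym by simp

lemma h_le: "h x y \<le> M / c"
proof -
  have le: "1 / deg k \<nu> x \<le> 1 / c" for x using deg_ge[of x] c_pos by (simp add: frac_le)
  have "k x y * (1 / deg k \<nu> x + 1 / deg k \<nu> y) \<le> M * (1 / c + 1 / c)"
    using k_le k_nonneg M_nonneg deg_pos[of x] deg_pos[of y] le
    by (intro mult_mono add_mono) (auto intro!: add_nonneg_nonneg)
  then show ?thesis unfolding hker_def by simp
qed

lemma integrable_bmfun [simp]:
  fixes f :: "('a, 'b::{banach, second_countable_topology}) bmfun"
  shows "integrable \<nu> (apply_bmfun f)"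
  by (rule integrable_const_bound[where B = "norm f"]) (auto simp: norm_apply_bmfun_le)

lemma integrable_bmfun_mult:
  fixes f g :: "('a, real) bmfun"
  shows "integrable \<nu> (\<lambda>x. apply_bmfun f x * apply_bmfun g x)"
  by (rule integrable_const_bound[where B = "norm f * norm g"])
    (use norm_apply_bmfun_le[of f] norm_apply_bmfun_le[of g] in \<open>auto simp: abs_mult intro!: mult_mono\<close>)

lemma h_mult_le: "0 \<le> s \<Longrightarrow> s \<le> t \<Longrightarrow> h x y * s \<le> M / c * t"
  using h_nonneg h_le M_nonneg c_pos by (intro mult_mono) auto

lemma integrable_h_mult [simp]:
  fixes f :: "('a, real) bmfun"
  shows "integrable \<nu> (\<lambda>y. h x y * apply_bmfun f y)"
proof (rule integrable_const_bound[where B = "M / c * norm f"])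
  show "AE y in \<nu>. norm (h x y * apply_bmfun f y) \<le> M / c * norm f"
    using norm_apply_bmfun_le[of f] by (auto simp: abs_mult h_nonneg intro!: h_mult_le simp del: times_divide_eq_left)
qed measurable

lemma integrable_h [simp]: "integrable \<nu> (h x)"
  by (rule integrable_const_bound[where B = "M / c"]) (use h_nonneg h_le in auto)

lemma integrable_h_mult_complex [simp]:
  fixes F :: "('a, complex) bmfun"
  shows "integrable \<nu> (\<lambda>y. complex_of_real (h x y) * apply_bmfun F y)"
proof (rule integrable_const_bound[where B = "M / c * norm F"])
  show "AE y in \<nu>. norm (complex_of_real (h x y) * apply_bmfun F y) \<le> M / c * norm F"
    using norm_apply_bmfun_le[of F] by (auto simp: norm_mult h_nonneg intro!: h_mult_le simp del: times_divide_eq_left)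
qed measurable

lemma U_apply: "apply_bmfun (U f) x = m x * apply_bmfun f x - (\<integral>y. h x y * apply_bmfun f y \<partial>\<nu>)"
proof -
  have "apply_bmfun (U f) x = (\<integral>y. h x y * (apply_bmfun f x - apply_bmfun f y) \<partial>\<nu>)"
    by (rule Uop_apply[OF prob_space_axioms sets_eq k_measurable k_nonneg k_le c_pos deg_ge])
  also have "\<dots> = (\<integral>y. h x y * apply_bmfun f x - h x y * apply_bmfun f y \<partial>\<nu>)"
    by (simp add: right_diff_distrib)
  finally show ?thesis by (simp add: mfun_def)
qed

lemma U_complex_apply:
  "apply_bmfun (complexify U F) x =
    complex_of_real (m x) * apply_bmfun F x - (\<integral>y. complex_of_real (h x y) * apply_bmfun F y \<partial>\<nu>)"
  by (rule complex_eqI) (simp_all add: U_apply integral_Re[symmetric] integral_Im[symmetric])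

lemma integral_h_mult_le:
  fixes f :: "('a, real) bmfun"
  shows "\<bar>\<integral>y. h x y * apply_bmfun f y \<partial>\<nu>\<bar> \<le> M / c * norm f"
proof -
  have "\<bar>\<integral>y. h x y * apply_bmfun f y \<partial>\<nu>\<bar> \<le> (\<integral>y. M / c * norm f \<partial>\<nu>)"
  proof (rule order_trans[OF integral_abs_bound], rule integral_mono)
    show "\<bar>h x y * apply_bmfun f y\<bar> \<le> M / c * norm f" for y
      using norm_apply_bmfun_le[of f y] by (simp add: abs_mult h_nonneg h_mult_le del: times_divide_eq_left)
  qed (intro integrable_abs integrable_h_mult, simp)
  then show ?thesis by (simp add: prob_space)
qed

lemma m_bounds: "0 \<le> m x" "m x \<le> M / c"
proof -
  show "0 \<le> m x" unfolding mfun_def using h_nonneg by (simp add: integral_nonneg_AE)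
  have "m x \<le> (\<integral>y. M / c \<partial>\<nu>)" unfolding mfun_def by (rule integral_mono) (simp_all add: h_le)
  then show "m x \<le> M / c" by (simp add: prob_space)
qed

lemma norm_U_le: "norm U \<le> 2 * M / c"
proof (rule norm_blinfun_bound)
  show "0 \<le> 2 * M / c" using M_nonneg c_pos by simp
  show "norm (U f) \<le> 2 * M / c * norm f" for f
  proof (rule norm_bmfun_le)
    fix x
    have "\<bar>m x * apply_bmfun f x\<bar> \<le> M / c * norm f"
      unfolding abs_mult using m_bounds[of x] norm_apply_bmfun_le[of f x] M_nonneg c_pos
      by (intro mult_mono) auto
    then show "norm (apply_bmfun (U f) x) \<le> 2 * M / c * norm f"
      using integral_h_mult_le[of x f] unfolding U_apply by simp
  qed
qed

text \<open>Off the range of \<open>m\<close> the equation \<open>(U - z) F = G\<close> can be solved for the values of \<open>F\<close> in terms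
  of \<open>G\<close> and an integral of \<open>F\<close>; a weak \<open>L\<^sup>1\<close> control of \<open>F\<close> thus becomes a uniform one.\<close>

lemma norm_le_shifted_plus_integral:
  assumes d: "0 < d" "\<And>x. d \<le> cmod (complex_of_real (m x) - z)"
  shows "d * norm F \<le> norm (shifted U z F) + M / c * (\<integral>y. cmod (apply_bmfun F y) \<partial>\<nu>)"
proof -
  let ?I = "\<integral>y. cmod (apply_bmfun F y) \<partial>\<nu>" and ?G = "shifted U z F"
  have "norm (apply_bmfun F x) \<le> (norm ?G + M / c * ?I) / d" for x
  proof -
    let ?K = "\<integral>y. complex_of_real (h x y) * apply_bmfun F y \<partial>\<nu>"
    have "cmod ?K \<le> (\<integral>y. cmod (complex_of_real (h x y) * apply_bmfun F y) \<partial>\<nu>)"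
      by (rule integral_norm_bound)
    also have "\<dots> \<le> (\<integral>y. M / c * cmod (apply_bmfun F y) \<partial>\<nu>)"
    proof (rule integral_mono)
      show "cmod (complex_of_real (h x y) * apply_bmfun F y) \<le> M / c * cmod (apply_bmfun F y)" for y
        by (simp add: norm_mult h_nonneg h_mult_le del: times_divide_eq_left)
    qed (intro integrable_norm integrable_h_mult_complex, simp)
    finally have K: "cmod ?K \<le> M / c * ?I" by simp
    have "(complex_of_real (m x) - z) * apply_bmfun F x = apply_bmfun ?G x + ?K"
      by (simp only: blinfun.diff_left minus_bmfun.rep_eq U_complex_apply)
        (simp add: algebra_simps)
    then have "cmod (complex_of_real (m x) - z) * cmod (apply_bmfun F x) \<le> norm ?G + M / c * ?I"
      using K norm_apply_bmfun_le[of ?G x] norm_triangle_ineq[of "apply_bmfun ?G x" ?K]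
      by (simp flip: norm_mult)
    moreover have "d * cmod (apply_bmfun F x) \<le> cmod (complex_of_real (m x) - z) * cmod (apply_bmfun F x)"
      by (rule mult_right_mono) (auto simp: d)
    ultimately show ?thesis using \<open>0 < d\<close> by (simp add: field_simps)
  qed
  then have "norm F \<le> (norm ?G + M / c * ?I) / d" by (rule norm_bmfun_le)
  then show ?thesis using \<open>0 < d\<close> by (simp add: field_simps)
qed

text \<open>The difference of the two sides is the double integral of an antisymmetric function.\<close>

lemma U_symmetric:
  "(\<integral>x. apply_bmfun u x * apply_bmfun (U v) x \<partial>\<nu>) = (\<integral>x. apply_bmfun v x * apply_bmfun (U u) x \<partial>\<nu>)"
proof -
  let ?u = "apply_bmfun u" and ?v = "apply_bmfun v"
  let ?g = "\<lambda>x y. h x y * (?v x * ?u y - ?u x * ?v y)"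
  interpret pair: pair_prob_space \<nu> \<nu> ..
  note int = integrable_bmfun_mult
  have bound: "\<bar>?g x y\<bar> \<le> M / c * (2 * norm u * norm v)" for x y
  proof -
    have "\<bar>?v x * ?u y\<bar> \<le> norm v * norm u" "\<bar>?u x * ?v y\<bar> \<le> norm u * norm v"
      unfolding abs_mult using norm_apply_bmfun_le[of u] norm_apply_bmfun_le[of v]
      by (auto intro!: mult_mono)
    then have "\<bar>?v x * ?u y - ?u x * ?v y\<bar> \<le> 2 * norm u * norm v"
      using abs_triangle_ineq4[of "?v x * ?u y" "?u x * ?v y"] by (simp add: mult_ac)
    then show ?thesis unfolding abs_mult[of "h x y"]
      using h_nonneg h_le M_nonneg c_pos by (intro mult_mono) auto
  qed
  have meas: "case_prod ?g \<in> borel_measurable (\<nu> \<Otimes>\<^sub>M \<nu>)" by measurable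
  have gint: "integrable (\<nu> \<Otimes>\<^sub>M \<nu>) (case_prod ?g)"
    by (rule pair.P.integrable_const_bound[where B = "M / c * (2 * norm u * norm v)"])
      (use bound meas in auto)
  have "(\<integral>x. \<integral>y. ?g x y \<partial>\<nu> \<partial>\<nu>) = (\<integral>y. \<integral>x. ?g x y \<partial>\<nu> \<partial>\<nu>)"
    using pair.Fubini_integral[OF gint] by simp
  also have "\<dots> = (\<integral>y. \<integral>x. - ?g y x \<partial>\<nu> \<partial>\<nu>)"
    by (intro Bochner_Integration.integral_cong refl) (simp add: h_sym algebra_simps)
  finally have zero: "(\<integral>x. \<integral>y. ?g x y \<partial>\<nu> \<partial>\<nu>) = 0" by simp
  have "?u x * apply_bmfun (U v) x - ?v x * apply_bmfun (U u) x = (\<integral>y. ?g x y \<partial>\<nu>)" for x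
  proof -
    have "(\<integral>y. ?g x y \<partial>\<nu>) = (\<integral>y. ?v x * (h x y * ?u y) - ?u x * (h x y * ?v y) \<partial>\<nu>)"
      by (simp add: algebra_simps)
    also have "\<dots> = ?v x * (\<integral>y. h x y * ?u y \<partial>\<nu>) - ?u x * (\<integral>y. h x y * ?v y \<partial>\<nu>)"
      by (simp add: Bochner_Integration.integral_diff)
    finally show ?thesis by (simp add: U_apply algebra_simps)
  qed
  then have "(\<integral>x. ?u x * apply_bmfun (U v) x - ?v x * apply_bmfun (U u) x \<partial>\<nu>) = 0"
    using zero by simp
  then show ?thesis using int by simp
qed

text \<open>By symmetry the imaginary part of \<open>\<langle>(U - z) F, F\<rangle>\<close> in \<open>L\<^sup>2(\<nu>)\<close> is \<open>- Im z * \<parallel>F\<parallel>\<^sub>2\<^sup>2\<close>. Its modulus is at most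
  \<open>\<parallel>(U - z) F\<parallel> * \<parallel>F\<parallel>\<^sub>1\<close>, where \<open>\<parallel>F\<parallel>\<^sub>1\<^sup>2 \<le> \<parallel>F\<parallel>\<^sub>2\<^sup>2\<close> as \<open>\<nu>\<close> is a probability measure.\<close>

lemma Im_mult_integral_le: "\<bar>Im z\<bar> * (\<integral>y. cmod (apply_bmfun F y) \<partial>\<nu>) \<le> norm (shifted U z F)"
proof -
  let ?G = "shifted U z F" and ?u = "Re_bmfun F" and ?v = "Im_bmfun F"
  let ?I = "\<integral>y. cmod (apply_bmfun F y) \<partial>\<nu>" and ?I2 = "\<integral>y. (cmod (apply_bmfun F y))\<^sup>2 \<partial>\<nu>"
  note int = integrable_bmfun_mult
  have int1: "integrable \<nu> (\<lambda>y. cmod (apply_bmfun F y))" by simp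
  have int2: "integrable \<nu> (\<lambda>y. (cmod (apply_bmfun F y))\<^sup>2)"
    using int[of ?u ?u] int[of ?v ?v] unfolding cmod_power2 by (simp add: power2_eq_square)
  have "?I\<^sup>2 \<le> ?I2"
    using variance_eq[OF int1 int2] variance_positive[of "\<lambda>y. cmod (apply_bmfun F y)"] by simp
  \<comment> \<open>The left-hand side is \<open>Im (F x * cnj (G x))\<close>.\<close>
  have pt: "apply_bmfun ?v x * Re (apply_bmfun ?G x) - apply_bmfun ?u x * Im (apply_bmfun ?G x) =
      apply_bmfun ?v x * apply_bmfun (U ?u) x - apply_bmfun ?u x * apply_bmfun (U ?v) x
      + Im z * (cmod (apply_bmfun F x))\<^sup>2" for x
    unfolding cmod_power2
    by (simp only: blinfun.diff_left) (simp add: algebra_simps power2_eq_square)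
  have "(\<integral>x. apply_bmfun ?v x * Re (apply_bmfun ?G x) - apply_bmfun ?u x * Im (apply_bmfun ?G x) \<partial>\<nu>)
      = Im z * ?I2"
    unfolding pt using int[of ?v "U ?u"] int[of ?u "U ?v"] int2 U_symmetric[of ?u ?v] by simp
  then have "\<bar>Im z\<bar> * ?I2 = \<bar>\<integral>x. apply_bmfun ?v x * Re (apply_bmfun ?G x)
      - apply_bmfun ?u x * Im (apply_bmfun ?G x) \<partial>\<nu>\<bar>"
    by (simp add: abs_mult)
  also have "\<dots> \<le> (\<integral>x. cmod (apply_bmfun F x) * norm ?G \<partial>\<nu>)"
  proof (rule order_trans[OF integral_abs_bound], rule integral_mono)
    have "integrable \<nu> (\<lambda>x. apply_bmfun ?v x * apply_bmfun (Re_bmfun ?G) x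
        - apply_bmfun ?u x * apply_bmfun (Im_bmfun ?G) x)"
      by (intro Bochner_Integration.integrable_diff int)
    then show "integrable \<nu> (\<lambda>x. \<bar>apply_bmfun ?v x * Re (apply_bmfun ?G x)
        - apply_bmfun ?u x * Im (apply_bmfun ?G x)\<bar>)" by (intro integrable_abs) simp
    fix x
    have "\<bar>Im (apply_bmfun F x * cnj (apply_bmfun ?G x))\<bar> \<le> cmod (apply_bmfun F x) * norm ?G"
      by (rule order_trans[OF abs_Im_le_cmod])
        (simp only: norm_mult complex_mod_cnj, rule mult_left_mono[OF norm_apply_bmfun_le norm_ge_zero])
    then show "\<bar>apply_bmfun ?v x * Re (apply_bmfun ?G x) - apply_bmfun ?u x * Im (apply_bmfun ?G x)\<bar>
        \<le> cmod (apply_bmfun F x) * norm ?G" by simp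
  qed (use int1 in auto)
  also have "\<dots> = ?I * norm ?G" by simp
  finally have "\<bar>Im z\<bar> * ?I\<^sup>2 \<le> ?I * norm ?G"
    using mult_left_mono[OF \<open>?I\<^sup>2 \<le> ?I2\<close> abs_ge_zero[of "Im z"]] by linarith
  moreover have "0 \<le> ?I" by (rule integral_nonneg_AE) simp
  ultimately show ?thesis
    by (cases "?I = 0") (auto simp: power2_eq_square mult.left_commute)
qed

text \<open>Off the real axis \<open>U - z\<close> is bounded below: the integral of \<open>\<bar>F\<bar>\<close> is controlled by symmetry, and this
  controls \<open>F\<close> uniformly because the distance of \<open>z\<close> from the real values of \<open>m\<close> is at least \<open>\<bar>Im z\<bar>\<close>. A half plane
  containing a point of the spectrum would contain a boundary point of the spectrum, since far
  away points are in the resolvent set.\<close>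

lemma op_spectrum_real: "op_spectrum U \<subseteq> \<real>"
proof -
  have bb: "\<exists>e>0. bounded_below e (shifted U z)" if "Im z \<noteq> 0" for z
  proof -
    let ?b = "\<bar>Im z\<bar>"
    have b: "0 < ?b" using that by simp
    let ?e = "1 + M / c / ?b"
    have e: "0 < ?e" using M_nonneg c_pos b by (intro add_pos_nonneg) auto
    have "?b / ?e * norm F \<le> norm (shifted U z F)" for F
    proof -
      let ?I = "\<integral>y. cmod (apply_bmfun F y) \<partial>\<nu>"
      have "?I \<le> norm (shifted U z F) / ?b"
        using Im_mult_integral_le[of z F] b by (simp add: field_simps)
      then have "M / c * ?I \<le> M / c * (norm (shifted U z F) / ?b)"
        using M_nonneg c_pos by (intro mult_left_mono) auto
      moreover have "?b * norm F \<le> norm (shifted U z F) + M / c * ?I"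
      proof (rule norm_le_shifted_plus_integral[OF b])
        show "?b \<le> cmod (complex_of_real (m x) - z)" for x
          using abs_Im_le_cmod[of "complex_of_real (m x) - z"] by simp
      qed
      ultimately have "?b * norm F \<le> norm (shifted U z F) * ?e"
        by (simp add: algebra_simps)
      then show ?thesis using e by (simp add: field_simps)
    qed
    then show ?thesis using b e unfolding bounded_below_def
      by (intro exI[of _ "?b / ?e"]) simp
  qed
  have half: False
    if H: "connected H" "\<And>z. z \<in> H \<Longrightarrow> Im z \<noteq> 0" "\<And>B. \<exists>z\<in>H. B < cmod z"
      and z: "z \<in> H" "z \<in> op_spectrum U" for H z
  proof -
    obtain w where "w \<in> H" "w \<notin> op_spectrum U"
      using H(3)[of "3 * norm (complexify U)"] norm_le_of_mem_op_spectrum[of _ U] by fastforce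
    then have "H \<inter> frontier (- op_spectrum U) \<noteq> {}"
      using z by (intro connected_Int_frontier[OF H(1)]) auto
    then obtain v where v: "v \<in> H" "v \<in> closure (- op_spectrum U)" "v \<in> op_spectrum U"
      using closed_op_spectrum[of U] by (auto simp: frontier_def interior_open open_Compl)
    then show False
      using bb[OF H(2)[OF v(1)]] notin_spectrum_if_bounded_below[OF v(2)] by blast
  qed
  have "Im z = 0" if z: "z \<in> op_spectrum U" for z
  proof (rule ccontr)
    assume "Im z \<noteq> 0"
    then consider "0 < Im z" | "Im z < 0" by linarith
    then show False
    proof cases
      case 1
      show False
      proof (rule half[of "{w. 0 < Im w}" z])
        show "\<exists>w\<in>{w. 0 < Im w}. B < cmod w" for B
          by (intro bexI[of _ "Complex 0 (\<bar>B\<bar> + 1)"]) (auto simp: cmod_def)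
      qed (use 1 z convex_halfspace_Im_gt[of 0] in \<open>auto intro: convex_connected\<close>)
    next
      case 2
      show False
      proof (rule half[of "{w. Im w < 0}" z])
        show "\<exists>w\<in>{w. Im w < 0}. B < cmod w" for B
          by (intro bexI[of _ "Complex 0 (- \<bar>B\<bar> - 1)"]) (auto simp: cmod_def)
      qed (use 2 z convex_halfspace_Im_lt[of 0] in \<open>auto intro: convex_connected\<close>)
    qed
  qed
  then show ?thesis by (auto simp: complex_is_Real_iff)
qed

lemma mem_closure_resolvent_set: "z \<in> closure (- op_spectrum U)"
  unfolding closure_approachable
proof (intro allI impI)
  fix e :: real assume "0 < e"
  let ?t = "if Im z = 0 then e / 2 else 0"
  have "z + of_real ?t * \<i> \<notin> \<real>" using \<open>0 < e\<close> by (auto simp: complex_is_Real_iff)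
  then have "z + of_real ?t * \<i> \<in> - op_spectrum U" using op_spectrum_real by blast
  moreover have "dist (z + of_real ?t * \<i>) z < e" using \<open>0 < e\<close> by (simp add: dist_norm norm_mult)
  ultimately show "\<exists>w\<in>- op_spectrum U. dist w z < e" by blast
qed

text \<open>As \<open>z\<close> is a boundary point of the real spectrum, there are approximate eigenvectors \<open>F j\<close> at \<open>z\<close>. Some
  subsequence converges at the finitely many points that carry \<open>\<nu>\<close>, and off the range of \<open>m\<close> this
  forces uniform convergence, to an eigenvector. The assumption on \<open>A\<close> says in a form without
  null sets that \<open>\<nu>\<close> is carried by \<open>A\<close>.\<close>

lemma eigenvalue_if_finite_support:
  assumes fin: "finite A"
    and A: "\<And>f :: 'a \<Rightarrow> real. f \<in> borel_measurable borel \<Longrightarrow> (\<integral>y. f y \<partial>\<nu>) \<le> (\<Sum>y\<in>A. \<bar>f y\<bar>)"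
    and z: "z \<in> op_spectrum U" and d: "0 < d" "\<And>x. d \<le> cmod (complex_of_real (m x) - z)"
  shows "op_eigenvalue U z"
proof -
  have nb: "\<not> bounded_below e (shifted U z)" if "0 < e" for e
    using notin_spectrum_if_bounded_below[OF mem_closure_resolvent_set] that z by blast
  have "\<exists>F. norm F = 1 \<and> norm (shifted U z F) < 1 / real (Suc j)" for j
  proof -
    obtain F where F: "norm (shifted U z F) < 1 / real (Suc j) * norm F"
      using nb[of "1 / real (Suc j)"] unfolding bounded_below_def by (auto simp: not_le)
    then have "norm F > 0" using norm_ge_zero[of "shifted U z F"] by (cases "norm F = 0") auto
    then show ?thesis using F
      by (intro exI[of _ "F /\<^sub>R norm F"]) (simp add: blinfun.scaleR_right field_simps)
  qed
  then obtain F where F: "\<And>j. norm (F j) = 1" "\<And>j. norm (shifted U z (F j)) < 1 / real (Suc j)" by metis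
  have "\<exists>r. strict_mono r \<and> (\<forall>y\<in>A. \<exists>l. (\<lambda>j. apply_bmfun (F (r j)) y) \<longlonglongrightarrow> l)"
    using function_convergent_subsequence[of A "\<lambda>j. apply_bmfun (F j)" 1]
      norm_apply_bmfun_le[of "F _"] F(1) fin by (metis countable_finite)
  then obtain r where r: "strict_mono r" "\<And>y. y \<in> A \<Longrightarrow> convergent (\<lambda>j. apply_bmfun (F (r j)) y)"
    unfolding convergent_def by blast
  define g where "g j = shifted U z (F (r j))" for j
  have g0: "g \<longlonglongrightarrow> 0"
  proof (rule Lim_null_comparison)
    show "\<forall>\<^sub>F j in sequentially. norm (g j) \<le> 1 / real (Suc j)"
    proof (rule always_eventually, rule allI)
      fix j
      have "1 / real (Suc (r j)) \<le> 1 / real (Suc j)"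
        using seq_suble[OF r(1), of j] by (simp add: frac_le)
      then show "norm (g j) \<le> 1 / real (Suc j)" using F(2)[of "r j"] unfolding g_def by linarith
    qed
    show "(\<lambda>j. 1 / real (Suc j)) \<longlonglongrightarrow> 0" by (rule one_over_Suc_tendsto)
  qed
  have "Cauchy (\<lambda>j. F (r j))"
  proof (rule metric_CauchyI)
    fix e :: real assume "0 < e"
    \<comment> \<open>If \<open>F i - F j\<close> is below \<open>t\<close> on \<open>A\<close> and its image under \<open>U - z\<close> is below \<open>t\<close>, then its norm is below \<open>B * t\<close>.\<close>
    define B where "B = (1 + M / c * card A) / d"
    have B: "0 < B" using M_nonneg c_pos \<open>0 < d\<close> unfolding B_def
      by (intro divide_pos_pos add_pos_nonneg) auto
    define t where "t = e / (2 * B)"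
    have t: "0 < t" using \<open>0 < e\<close> B by (simp add: t_def)
    have "\<forall>y\<in>A. \<exists>N. \<forall>i\<ge>N. \<forall>j\<ge>N. dist (apply_bmfun (F (r i)) y) (apply_bmfun (F (r j)) y) < t"
      using metric_CauchyD[OF convergent_Cauchy[OF r(2)] t] by blast
    then obtain N where N: "\<And>y i j. y \<in> A \<Longrightarrow> i \<ge> N y \<Longrightarrow> j \<ge> N y \<Longrightarrow>
        dist (apply_bmfun (F (r i)) y) (apply_bmfun (F (r j)) y) < t" by metis
    obtain N' where N': "\<And>i j. i \<ge> N' \<Longrightarrow> j \<ge> N' \<Longrightarrow> dist (g i) (g j) < t"
      using metric_CauchyD[OF convergent_Cauchy[OF convergentI[OF g0]] t] by blast
    let ?N = "Max (insert N' (N ` A))"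
    have "dist (F (r i)) (F (r j)) < e" if ij: "i \<ge> ?N" "j \<ge> ?N" for i j
    proof -
      let ?D = "F (r i) - F (r j)"
      have ge: "i \<ge> N'" "j \<ge> N'" "y \<in> A \<Longrightarrow> i \<ge> N y" "y \<in> A \<Longrightarrow> j \<ge> N y" for y
        using ij fin by auto
      have "(\<integral>y. cmod (apply_bmfun ?D y) \<partial>\<nu>) \<le> (\<Sum>y\<in>A. \<bar>cmod (apply_bmfun ?D y)\<bar>)"
        by (rule A) simp
      also have "\<dots> \<le> (\<Sum>y\<in>A. t)"
        using N ge(3,4) by (intro sum_mono) (auto simp: dist_norm intro: less_imp_le)
      finally have I: "(\<integral>y. cmod (apply_bmfun ?D y) \<partial>\<nu>) \<le> card A * t" by simp
      have "d * norm ?D \<le> norm (shifted U z ?D) + M / c * (\<integral>y. cmod (apply_bmfun ?D y) \<partial>\<nu>)"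
        by (rule norm_le_shifted_plus_integral[OF d])
      also have "shifted U z ?D = g i - g j" by (simp only: g_def blinfun.diff_right)
      also have "norm (g i - g j) \<le> t" using N'[OF ge(1,2)] by (simp add: dist_norm)
      also have "M / c * (\<integral>y. cmod (apply_bmfun ?D y) \<partial>\<nu>) \<le> M / c * (card A * t)"
        using I M_nonneg c_pos by (intro mult_left_mono) auto
      finally have "norm ?D \<le> B * t" using \<open>0 < d\<close> by (simp add: B_def field_simps)
      also have "\<dots> < e" using \<open>0 < e\<close> B by (simp add: t_def)
      finally show ?thesis by (simp add: dist_norm)
    qed
    then show "\<exists>N. \<forall>i\<ge>N. \<forall>j\<ge>N. dist (F (r i)) (F (r j)) < e" by blast
  qed
  then obtain f where f: "(\<lambda>j. F (r j)) \<longlonglongrightarrow> f"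
    using Cauchy_convergent convergent_def by blast
  have "norm f = 1" using tendsto_norm[OF f] F(1) by (simp add: LIMSEQ_const_iff)
  moreover have "shifted U z f = 0"
  proof (rule LIMSEQ_unique[OF _ g0])
    show "g \<longlonglongrightarrow> shifted U z f" unfolding g_def by (intro tendsto_intros f)
  qed
  then have "complexify U f = scaleC_bmfun z f"
    by (simp add: blinfun.diff_left)
  ultimately show ?thesis unfolding op_eigenvalue_def by (intro exI[of _ f]) auto
qed

end

section \<open>Dependence of the operator on the measure\<close>

context kernel_measure
begin

lemma k_measurable1 [measurable]: "k x \<in> borel_measurable borel"
  by measurable

lemma integrable_k_mult [simp]:
  assumes [measurable]: "f \<in> borel_measurable borel" and "\<And>y. \<bar>f y\<bar> \<le> B"
  shows "integrable \<nu> (\<lambda>y. k x y * f y)"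
proof (rule integrable_const_bound[where B = "M * B"])
  show "AE y in \<nu>. norm (k x y * f y) \<le> M * B"
    using assms(2) k_nonneg k_le M_nonneg by (auto simp: abs_mult intro!: mult_mono)
qed measurable

lemma integrable_k [simp]: "integrable \<nu> (k x)"
  using integrable_k_mult[of "\<lambda>_. 1" 1 x] by simp

lemma abs_integral_k_mult_le:
  assumes [measurable]: "f \<in> borel_measurable borel" and B: "\<And>y. \<bar>f y\<bar> \<le> B"
  shows "\<bar>\<integral>y. k x y * f y \<partial>\<nu>\<bar> \<le> M * B"
proof -
  have "\<bar>\<integral>y. k x y * f y \<partial>\<nu>\<bar> \<le> (\<integral>y. M * B \<partial>\<nu>)"
  proof (rule order_trans[OF integral_abs_bound], rule integral_mono)
    show "integrable \<nu> (\<lambda>y. \<bar>k x y * f y\<bar>)"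
      by (intro integrable_abs integrable_k_mult[OF assms])
    show "\<bar>k x y * f y\<bar> \<le> M * B" for y
      unfolding abs_mult using B k_nonneg k_le M_nonneg by (intro mult_mono) auto
  qed simp
  then show ?thesis by (simp add: prob_space)
qed

lemma inverse_deg_bounds: "0 \<le> 1 / deg k \<nu> x" "1 / deg k \<nu> x \<le> 1 / c"
  using deg_ge[of x] deg_pos[of x] c_pos by (auto simp: frac_le)

lemma abs_divide_deg_le:
  assumes "\<And>y. \<bar>f y\<bar> \<le> B" shows "\<bar>f y / deg k \<nu> y\<bar> \<le> B * (1 / c)"
proof -
  have "\<bar>f y / deg k \<nu> y\<bar> = \<bar>f y\<bar> * (1 / deg k \<nu> y)" using deg_pos[of y] by simp
  also have "\<dots> \<le> B * (1 / c)"
    using assms[of y] inverse_deg_bounds[of y] by (intro mult_mono) auto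
  finally show ?thesis .
qed

lemma abs_deg_diff_le: "\<bar>deg k \<nu> x - deg k \<nu> x'\<bar> \<le> (\<integral>y. \<bar>k x y - k x' y\<bar> \<partial>\<nu>)"
  unfolding deg_def using integral_abs_bound[of \<nu> "\<lambda>y. k x y - k x' y"] by simp

lemma abs_inverse_diff_le:
  assumes "c \<le> s" "c \<le> t" shows "\<bar>1 / s - 1 / t\<bar> \<le> \<bar>s - t\<bar> / c\<^sup>2"
proof -
  have pos: "0 < s" "0 < t" using assms c_pos by auto
  then have "\<bar>1 / s - 1 / t\<bar> = \<bar>s - t\<bar> / (s * t)"
    by (simp add: diff_frac_eq abs_mult abs_minus_commute)
  also have "\<dots> \<le> \<bar>s - t\<bar> / c\<^sup>2"
    using assms c_pos pos by (intro divide_left_mono) (auto simp: power2_eq_square intro!: mult_mono)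
  finally show ?thesis .
qed

text \<open>A Lipschitz constant for the passage from \<open>k\<close> to the normalized kernel \<open>h\<close>.\<close>

definition lip :: real where "lip = 1 / c + M / (2 * c\<^sup>2)"

lemma lip_nonneg: "0 \<le> lip" using c_pos M_nonneg by (simp add: lip_def)

lemma abs_integral_h_diff_le:
  fixes f :: "('a, real) bmfun"
  shows "\<bar>(\<integral>y. h x y * apply_bmfun f y \<partial>\<nu>) - (\<integral>y. h x' y * apply_bmfun f y \<partial>\<nu>)\<bar>
    \<le> lip * norm f * (\<integral>y. \<bar>k x y - k x' y\<bar> \<partial>\<nu>)"
proof -
  let ?D = "\<integral>y. \<bar>k x y - k x' y\<bar> \<partial>\<nu>"
  let ?r = "\<lambda>x. 1 / deg k \<nu> x"
  have r: "\<bar>?r x - ?r x'\<bar> \<le> ?D / c\<^sup>2"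
    using abs_inverse_diff_le[OF deg_ge deg_ge, of x x'] abs_deg_diff_le[of x x']
    by (meson divide_right_mono order_trans zero_le_power2)
  have D: "0 \<le> ?D" by (rule integral_nonneg_AE) simp
  have int: "integrable \<nu> (\<lambda>y. \<bar>k x y - k x' y\<bar>)" by simp
  have hd: "\<bar>h x y - h x' y\<bar> \<le> \<bar>k x y - k x' y\<bar> / c + M / (2 * c\<^sup>2) * ?D" for y
  proof -
    have eq: "h x y - h x' y = 1 / 2 * ((k x y - k x' y) * (?r x + ?r y)) + 1 / 2 * (k x' y * (?r x - ?r x'))"
      by (simp add: hker_def algebra_simps)
    have "\<bar>(k x y - k x' y) * (?r x + ?r y)\<bar> \<le> \<bar>k x y - k x' y\<bar> * (1 / c + 1 / c)"
      unfolding abs_mult using inverse_deg_bounds[of x] inverse_deg_bounds[of y]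
      by (intro mult_left_mono) auto
    moreover have "\<bar>k x' y * (?r x - ?r x')\<bar> \<le> M * (?D / c\<^sup>2)"
      unfolding abs_mult using r k_nonneg k_le M_nonneg by (intro mult_mono) auto
    moreover have half: "\<bar>1 / 2 * A + 1 / 2 * B\<bar> \<le> 1 / 2 * s + 1 / 2 * t"
      if "\<bar>A\<bar> \<le> s" "\<bar>B\<bar> \<le> t" for A B s t :: real
      using that by linarith
    ultimately have "\<bar>1 / 2 * ((k x y - k x' y) * (?r x + ?r y)) + 1 / 2 * (k x' y * (?r x - ?r x'))\<bar>
        \<le> 1 / 2 * (\<bar>k x y - k x' y\<bar> * (1 / c + 1 / c)) + 1 / 2 * (M * (?D / c\<^sup>2))"
      by blast
    then show ?thesis unfolding eq by simp
  qed
  have "\<bar>(\<integral>y. h x y * apply_bmfun f y \<partial>\<nu>) - (\<integral>y. h x' y * apply_bmfun f y \<partial>\<nu>)\<bar>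
      = \<bar>\<integral>y. h x y * apply_bmfun f y - h x' y * apply_bmfun f y \<partial>\<nu>\<bar>" by simp
  also have "\<dots> \<le> (\<integral>y. norm f * (\<bar>k x y - k x' y\<bar> / c + M / (2 * c\<^sup>2) * ?D) \<partial>\<nu>)"
  proof (rule order_trans[OF integral_abs_bound], rule integral_mono)
    fix y
    have "\<bar>h x y * apply_bmfun f y - h x' y * apply_bmfun f y\<bar> = \<bar>apply_bmfun f y\<bar> * \<bar>h x y - h x' y\<bar>"
      by (simp add: abs_mult flip: left_diff_distrib)
    also have "\<dots> \<le> norm f * (\<bar>k x y - k x' y\<bar> / c + M / (2 * c\<^sup>2) * ?D)"
      using hd[of y] norm_apply_bmfun_le[of f y] by (intro mult_mono) auto
    finally show "\<bar>h x y * apply_bmfun f y - h x' y * apply_bmfun f y\<bar>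
      \<le> norm f * (\<bar>k x y - k x' y\<bar> / c + M / (2 * c\<^sup>2) * ?D)" .
  qed (intro integrable_abs Bochner_Integration.integrable_diff integrable_h_mult, use int in simp)
  also have "\<dots> = norm f * (?D / c + M / (2 * c\<^sup>2) * ?D)"
    using int by (simp add: prob_space)
  finally show ?thesis by (simp add: lip_def algebra_simps)
qed

lemma abs_m_diff_le: "\<bar>m x - m x'\<bar> \<le> lip * (\<integral>y. \<bar>k x y - k x' y\<bar> \<partial>\<nu>)"
proof -
  define one :: "('a, real) bmfun" where "one = Bmfun (\<lambda>_. 1)"
  have one: "apply_bmfun one y = 1" for y
    unfolding one_def by (subst Bmfun_inverse) (auto intro: bmfunI[where b = 1])
  have "norm one \<le> 1" by (rule norm_bmfun_le) (simp add: one)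
  then have "lip * norm one * (\<integral>y. \<bar>k x y - k x' y\<bar> \<partial>\<nu>) \<le> lip * 1 * (\<integral>y. \<bar>k x y - k x' y\<bar> \<partial>\<nu>)"
    by (intro mult_right_mono mult_left_mono lip_nonneg integral_nonneg_AE) auto
  then show ?thesis using abs_integral_h_diff_le[of x one x'] by (simp add: mfun_def one)
qed

text \<open>The normalized kernel splits so that only integrals of \<open>k\<close> against a function remain.\<close>

lemma integral_h_mult_eq:
  assumes [measurable]: "f \<in> borel_measurable borel" and B: "\<And>y. \<bar>f y\<bar> \<le> B"
  shows "(\<integral>y. h x y * f y \<partial>\<nu>) =
    1 / 2 * (1 / deg k \<nu> x * (\<integral>y. k x y * f y \<partial>\<nu>) + (\<integral>y. k x y * (f y / deg k \<nu> y) \<partial>\<nu>))"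
proof -
  have "\<bar>f y / deg k \<nu> y\<bar> \<le> B * (1 / c)" for y by (rule abs_divide_deg_le[OF B])
  then have int: "integrable \<nu> (\<lambda>y. k x y * (f y / deg k \<nu> y))"
    by (intro integrable_k_mult[where B = "B * (1 / c)"]) measurable
  have "(\<integral>y. h x y * f y \<partial>\<nu>) =
      (\<integral>y. 1 / 2 * (1 / deg k \<nu> x * (k x y * f y) + k x y * (f y / deg k \<nu> y)) \<partial>\<nu>)"
    by (intro Bochner_Integration.integral_cong refl) (simp add: hker_def algebra_simps)
  also have "\<dots> = 1 / 2 * (\<integral>y. 1 / deg k \<nu> x * (k x y * f y) + k x y * (f y / deg k \<nu> y) \<partial>\<nu>)"
    by (rule integral_mult_right_zero)
  also have "(\<integral>y. 1 / deg k \<nu> x * (k x y * f y) + k x y * (f y / deg k \<nu> y) \<partial>\<nu>) =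
      (\<integral>y. 1 / deg k \<nu> x * (k x y * f y) \<partial>\<nu>) + (\<integral>y. k x y * (f y / deg k \<nu> y) \<partial>\<nu>)"
    by (rule Bochner_Integration.integral_add[OF _ int])
      (intro integrable_mult_right integrable_k_mult[OF assms])
  finally show ?thesis by simp
qed

end

text \<open>The measure enters in three places: in the integral, in the factor \<open>1 / deg k \<nu> x\<close> and in
  the factor \<open>1 / deg k \<nu> y\<close> under the integral. The functions \<open>f\<close> and \<open>f / deg k \<nu>\<close> of the hypotheses involve
  the measure \<open>\<nu>\<close> alone, so that for fixed \<open>\<nu>\<close> and varying \<open>\<nu>'\<close> a law of large numbers applies to both.\<close>

lemma abs_integral_h_measures_diff_le:
  assumes "kernel_measure \<nu> k c M" "kernel_measure \<nu>' k c M"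
    and f: "f \<in> borel_measurable borel" and B: "\<And>y. \<bar>f y\<bar> \<le> B"
    and d1: "\<And>x. \<bar>(\<integral>y. k x y * f y \<partial>\<nu>') - (\<integral>y. k x y * f y \<partial>\<nu>)\<bar> \<le> e1"
    and d2: "\<And>x. \<bar>(\<integral>y. k x y * (f y / deg k \<nu> y) \<partial>\<nu>') - (\<integral>y. k x y * (f y / deg k \<nu> y) \<partial>\<nu>)\<bar> \<le> e2"
    and d3: "\<And>x. \<bar>deg k \<nu>' x - deg k \<nu> x\<bar> \<le> e3"
  shows "\<bar>(\<integral>y. hker k \<nu>' x y * f y \<partial>\<nu>') - (\<integral>y. hker k \<nu> x y * f y \<partial>\<nu>)\<bar>
    \<le> e1 / c + e2 + M * B / c\<^sup>2 * e3"
proof -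
  interpret A: kernel_measure \<nu> k c M by fact
  interpret A': kernel_measure \<nu>' k c M by fact
  note [measurable] = f
  have "0 \<le> B" using B[of undefined] by linarith
  let ?A = "\<integral>y. k x y * f y \<partial>\<nu>" and ?A' = "\<integral>y. k x y * f y \<partial>\<nu>'"
  let ?r = "1 / deg k \<nu> x" and ?r' = "1 / deg k \<nu>' x"
  have rr: "\<bar>1 / deg k \<nu>' y - 1 / deg k \<nu> y\<bar> \<le> e3 / c\<^sup>2" for y
    using A.abs_inverse_diff_le[OF A'.deg_ge A.deg_ge, of y y] d3[of y] A.c_pos
    by (meson divide_right_mono order_trans zero_le_power2)
  have e3: "0 \<le> e3" using d3[of x] by linarith
  have e1: "0 \<le> e1" using d1[of x] by linarith
  have e2: "0 \<le> e2" using d2[of x] by linarith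
  have t1: "\<bar>?r' * ?A' - ?r * ?A\<bar> \<le> e1 / c + M * B / c\<^sup>2 * e3"
  proof -
    have "?r' * ?A' - ?r * ?A = ?r' * (?A' - ?A) + ?A * (?r' - ?r)" by (simp only: algebra_simps)
    moreover have "\<bar>?r' * (?A' - ?A)\<bar> \<le> 1 / c * e1"
      unfolding abs_mult using A'.inverse_deg_bounds[of x] d1[of x] A.c_pos by (intro mult_mono) auto
    moreover have "\<bar>?A * (?r' - ?r)\<bar> \<le> (M * B) * (e3 / c\<^sup>2)"
      unfolding abs_mult using A.abs_integral_k_mult_le[OF f B, of x] rr[of x] A.M_nonneg \<open>0 \<le> B\<close>
      by (intro mult_mono) auto
    ultimately show ?thesis
      using abs_triangle_ineq[of "?r' * (?A' - ?A)" "?A * (?r' - ?r)"] by simp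
  qed
  have t2: "\<bar>(\<integral>y. k x y * (f y / deg k \<nu>' y) \<partial>\<nu>') - (\<integral>y. k x y * (f y / deg k \<nu> y) \<partial>\<nu>)\<bar>
      \<le> M * B / c\<^sup>2 * e3 + e2"
  proof -
    have b: "\<bar>f y * (1 / deg k \<nu>' y - 1 / deg k \<nu> y)\<bar> \<le> B * (e3 / c\<^sup>2)" for y
      unfolding abs_mult using B[of y] rr[of y] \<open>0 \<le> B\<close> by (intro mult_mono) auto
    have b': "\<bar>f y / deg k \<nu> y\<bar> \<le> B * (1 / c)" for y by (rule A.abs_divide_deg_le[OF B])
    have i1: "integrable \<nu>' (\<lambda>y. k x y * (f y * (1 / deg k \<nu>' y - 1 / deg k \<nu> y)))"
      by (rule A'.integrable_k_mult[OF _ b]) measurable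
    have i2: "integrable \<nu>' (\<lambda>y. k x y * (f y / deg k \<nu> y))"
      by (rule A'.integrable_k_mult[OF _ b']) measurable
    have "(\<integral>y. k x y * (f y / deg k \<nu>' y) \<partial>\<nu>') =
        (\<integral>y. k x y * (f y * (1 / deg k \<nu>' y - 1 / deg k \<nu> y)) + k x y * (f y / deg k \<nu> y) \<partial>\<nu>')"
      by (intro Bochner_Integration.integral_cong refl) (simp add: algebra_simps)
    also have "\<dots> = (\<integral>y. k x y * (f y * (1 / deg k \<nu>' y - 1 / deg k \<nu> y)) \<partial>\<nu>')
        + (\<integral>y. k x y * (f y / deg k \<nu> y) \<partial>\<nu>')"
      by (rule Bochner_Integration.integral_add[OF i1 i2])
    finally have eq: "(\<integral>y. k x y * (f y / deg k \<nu>' y) \<partial>\<nu>') =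
        (\<integral>y. k x y * (f y * (1 / deg k \<nu>' y - 1 / deg k \<nu> y)) \<partial>\<nu>')
        + (\<integral>y. k x y * (f y / deg k \<nu> y) \<partial>\<nu>')" .
    have "\<bar>\<integral>y. k x y * (f y * (1 / deg k \<nu>' y - 1 / deg k \<nu> y)) \<partial>\<nu>'\<bar> \<le> M * (B * (e3 / c\<^sup>2))"
      by (rule A'.abs_integral_k_mult_le[OF _ b]) measurable
    then show ?thesis unfolding eq using d2[of x] by simp
  qed
  have half: "2 * \<bar>1 / 2 * (A' + B') - 1 / 2 * (A + B)\<bar> \<le> \<bar>A' - A\<bar> + \<bar>B' - B\<bar>" for A A' B B' :: real
    using abs_triangle_ineq[of "A' - A" "B' - B"] by (simp add: abs_if field_simps split: if_splits)
  have "2 * \<bar>(\<integral>y. hker k \<nu>' x y * f y \<partial>\<nu>') - (\<integral>y. hker k \<nu> x y * f y \<partial>\<nu>)\<bar>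
      \<le> \<bar>?r' * ?A' - ?r * ?A\<bar>
        + \<bar>(\<integral>y. k x y * (f y / deg k \<nu>' y) \<partial>\<nu>') - (\<integral>y. k x y * (f y / deg k \<nu> y) \<partial>\<nu>)\<bar>"
    unfolding A.integral_h_mult_eq[OF f B] A'.integral_h_mult_eq[OF f B] by (rule half)
  also have "\<dots> \<le> (e1 / c + M * B / c\<^sup>2 * e3) + (M * B / c\<^sup>2 * e3 + e2)"
    using t1 t2 by (rule add_mono)
  finally show ?thesis
  proof -
    have half': "X \<le> s + t + q" if "2 * X \<le> (s + q) + (q + t)" "0 \<le> s" "0 \<le> t" for X s t q :: real
      using that by linarith
    assume "2 * \<bar>(\<integral>y. hker k \<nu>' x y * f y \<partial>\<nu>') - (\<integral>y. hker k \<nu> x y * f y \<partial>\<nu>)\<bar>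
      \<le> (e1 / c + M * B / c\<^sup>2 * e3) + (M * B / c\<^sup>2 * e3 + e2)"
    then show ?thesis by (rule half') (use e1 e2 A.c_pos in auto)
  qed
qed

text \<open>The finite-range maps \<open>p j\<close> take the place of equicontinuity: each \<open>G i\<close> is up to \<open>E j\<close> determined by its values on
  \<open>range (p j)\<close>, but for given \<open>j\<close> only from some index \<open>i\<close> on. A diagonal subsequence converging on all
  these ranges is uniformly Cauchy, and the limit inherits the oscillation bounds for all \<open>j\<close>.\<close>

lemma asymptotic_Arzela_Ascoli:
  fixes G :: "nat \<Rightarrow> ('a::topological_space, 'b::{banach, heine_borel, second_countable_topology}) bmfun"
  assumes bound: "\<And>i. norm (G i) \<le> B" and fin: "\<And>j. finite (range (p j))" and E: "E \<longlonglongrightarrow> 0"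
    and osc: "\<And>j. \<forall>\<^sub>F i in sequentially. \<forall>x. norm (apply_bmfun (G i) x - apply_bmfun (G i) (p j x)) \<le> E j"
  obtains r g where "strict_mono r" "(\<lambda>i. G (r i)) \<longlonglongrightarrow> g"
    "\<And>j x. norm (apply_bmfun g x - apply_bmfun g (p j x)) \<le> E j"
proof -
  let ?S = "\<Union>j::nat. range (p j)"
  have "countable ?S" using countable_finite[OF fin] by blast
  moreover have "norm (apply_bmfun (G i) x) \<le> B" for i x
    using norm_apply_bmfun_le bound order_trans by blast
  ultimately obtain r where r: "strict_mono (r :: nat \<Rightarrow> nat)"
      and conv: "\<And>x. x \<in> ?S \<Longrightarrow> \<exists>l. (\<lambda>i. apply_bmfun (G (r i)) x) \<longlonglongrightarrow> l"
    by (rule function_convergent_subsequence[of ?S "\<lambda>i. apply_bmfun (G i)" B]) blast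
  have "Cauchy (\<lambda>i. G (r i))"
  proof (rule metric_CauchyI)
    fix e :: real assume "0 < e"
    then obtain j where j: "E j < e / 4"
      using order_tendstoD(2)[OF E, of "e / 4"] eventually_happens[of _ sequentially] by auto
    obtain N where N: "\<And>i x. N \<le> i \<Longrightarrow> norm (apply_bmfun (G i) x - apply_bmfun (G i) (p j x)) \<le> E j"
      using osc[of j] unfolding eventually_sequentially by blast
    have "\<forall>c\<in>range (p j). \<exists>N. \<forall>i\<ge>N. \<forall>l\<ge>N. dist (apply_bmfun (G (r i)) c) (apply_bmfun (G (r l)) c) < e / 4"
    proof
      fix c assume "c \<in> range (p j)"
      then have "Cauchy (\<lambda>i. apply_bmfun (G (r i)) c)"
        using conv[of c] by (auto simp: Cauchy_convergent_iff convergent_def)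
      then show "\<exists>N. \<forall>i\<ge>N. \<forall>l\<ge>N. dist (apply_bmfun (G (r i)) c) (apply_bmfun (G (r l)) c) < e / 4"
        by (rule metric_CauchyD) (use \<open>0 < e\<close> in simp)
    qed
    then obtain N' where N': "\<And>c i l. c \<in> range (p j) \<Longrightarrow> N' c \<le> i \<Longrightarrow> N' c \<le> l \<Longrightarrow>
        dist (apply_bmfun (G (r i)) c) (apply_bmfun (G (r l)) c) < e / 4" by metis
    let ?N = "Max (insert N (N' ` range (p j)))"
    have "dist (G (r i)) (G (r l)) < e" if il: "?N \<le> i" "?N \<le> l" for i l
    proof -
      have ge: "N \<le> r i" "N \<le> r l" "\<And>x. N' (p j x) \<le> i" "\<And>x. N' (p j x) \<le> l"
        using il fin[of j] seq_suble[OF r] by (auto intro: order_trans)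
      have "norm (apply_bmfun (G (r i) - G (r l)) x) \<le> E j + e / 4 + E j" for x
      proof -
        let ?f = "apply_bmfun (G (r i))" and ?g = "apply_bmfun (G (r l))" and ?y = "p j x"
        have "?f x - ?g x = (?f x - ?f ?y) + (?f ?y - ?g ?y) - (?g x - ?g ?y)" by simp
        also have "norm \<dots> \<le> norm (?f x - ?f ?y) + norm (?f ?y - ?g ?y) + norm (?g x - ?g ?y)"
          by (meson norm_triangle_ineq norm_triangle_ineq4 order_trans add_right_mono)
        also have "\<dots> \<le> E j + e / 4 + E j"
          using N[OF ge(1), of x] N[OF ge(2), of x] N'[OF _ ge(3,4), of x]
          by (intro add_mono) (auto simp: dist_norm intro: less_imp_le)
        finally show ?thesis by simp
      qed
      then have "norm (G (r i) - G (r l)) \<le> E j + e / 4 + E j" by (rule norm_bmfun_le)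
      then show ?thesis using j \<open>0 < e\<close> by (simp add: dist_norm)
    qed
    then show "\<exists>N. \<forall>i\<ge>N. \<forall>l\<ge>N. dist (G (r i)) (G (r l)) < e" by blast
  qed
  then obtain g where g: "(\<lambda>i. G (r i)) \<longlonglongrightarrow> g"
    using Cauchy_convergent convergent_def by blast
  have gx: "(\<lambda>i. apply_bmfun (G (r i)) x) \<longlonglongrightarrow> apply_bmfun g x" for x
  proof (rule metric_LIMSEQ_I)
    fix e :: real assume "0 < e"
    then obtain N where N: "\<And>i. i \<ge> N \<Longrightarrow> dist (G (r i)) g < e" using metric_LIMSEQ_D[OF g] by blast
    have "dist (apply_bmfun (G (r i)) x) (apply_bmfun g x) < e" if "i \<ge> N" for i
      using N[OF that] norm_apply_bmfun_le[of "G (r i) - g" x] by (simp add: dist_norm)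
    then show "\<exists>N. \<forall>i\<ge>N. dist (apply_bmfun (G (r i)) x) (apply_bmfun g x) < e" by blast
  qed
  have "norm (apply_bmfun g x - apply_bmfun g (p j x)) \<le> E j" for j x
  proof (rule tendsto_upperbound)
    show "(\<lambda>i. norm (apply_bmfun (G (r i)) x - apply_bmfun (G (r i)) (p j x)))
        \<longlonglongrightarrow> norm (apply_bmfun g x - apply_bmfun g (p j x))"
      by (intro tendsto_intros gx)
    show "\<forall>\<^sub>F i in sequentially. norm (apply_bmfun (G (r i)) x - apply_bmfun (G (r i)) (p j x)) \<le> E j"
      using eventually_subseq[OF r osc[of j]] by eventually_elim simp
  qed simp
  then show ?thesis using that r g by blast
qed

section \<open>Convergence along a sequence of measures\<close>

text \<open>What a sample has to satisfy for the deterministic part of the argument. The map \<open>p j\<close> sends a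
  point to a nearby centre, and \<open>e j\<close> bounds the \<open>L\<^sup>1\<close> oscillation of \<open>k\<close> under this displacement. Convergence of integrals
  is required at the centres only. The margin \<open>\<eta>\<close> makes the degrees for \<open>\<nu> n\<close> exceed \<open>a\<close> eventually.\<close>

locale kernel_approximation = kernel_measure \<mu> k a M
  for \<mu> :: "'a::topological_space measure" and k and a M :: real +
  fixes \<nu> :: "nat \<Rightarrow> 'a measure" and p :: "nat \<Rightarrow> 'a \<Rightarrow> 'a" and e :: "nat \<Rightarrow> real" and \<eta> :: real
  assumes gap: "0 < \<eta>" "\<And>x. a + \<eta> \<le> deg k \<mu> x"
    and prob_\<nu>: "\<forall>\<^sub>F n in sequentially. prob_space (\<nu> n) \<and> sets (\<nu> n) = sets borel"
    and p_finite: "\<And>j. finite (range (p j))"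
    and p_measurable: "\<And>j y. {x. p j x = y} \<in> sets borel"
    and e_tendsto: "e \<longlonglongrightarrow> 0"
    and osc_\<mu>: "\<And>j x. (\<integral>y. \<bar>k x y - k (p j x) y\<bar> \<partial>\<mu>) \<le> e j"
    and osc_\<nu>: "\<And>j. \<forall>\<^sub>F n in sequentially. \<forall>x. (\<integral>y. \<bar>k x y - k (p j x) y\<bar> \<partial>\<nu> n) \<le> e j"
    and conv_one: "\<And>j x. (\<lambda>n. \<integral>y. k (p j x) y \<partial>\<nu> n) \<longlonglongrightarrow> (\<integral>y. k (p j x) y \<partial>\<mu>)"
    and conv_inverse: "\<And>j x. (\<lambda>n. \<integral>y. k (p j x) y * (1 / deg k \<mu> y) \<partial>\<nu> n)
      \<longlonglongrightarrow> (\<integral>y. k (p j x) y * (1 / deg k \<mu> y) \<partial>\<mu>)"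
begin

definition centre_conv :: "('a \<Rightarrow> real) \<Rightarrow> bool"
  where "centre_conv f \<longleftrightarrow>
    (\<forall>j x. (\<lambda>n. \<integral>y. k (p j x) y * f y \<partial>\<nu> n) \<longlonglongrightarrow> (\<integral>y. k (p j x) y * f y \<partial>\<mu>))"

abbreviation "T \<equiv> complexify U"
abbreviation "Us n \<equiv> Uop k (\<nu> n)"
abbreviation "Ts n \<equiv> complexify (Us n)"

lemma e_nonneg: "0 \<le> e j"
proof -
  have "0 \<le> (\<integral>y. \<bar>k x y - k (p j x) y\<bar> \<partial>\<mu>)" for x by (rule integral_nonneg_AE) simp
  then show ?thesis using osc_\<mu> order_trans by blast
qed

lemma abs_integral_k_diff_le:
  assumes "prob_space \<nu>'" "sets \<nu>' = sets borel"
    and f [measurable]: "f \<in> borel_measurable borel" and B: "\<And>y. \<bar>f y\<bar> \<le> B"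
  shows "\<bar>(\<integral>y. k x y * f y \<partial>\<nu>') - (\<integral>y. k c y * f y \<partial>\<nu>')\<bar> \<le> B * (\<integral>y. \<bar>k x y - k c y\<bar> \<partial>\<nu>')"
proof -
  interpret N: prob_space \<nu>' by fact
  note [measurable_cong] = assms(2)
  have kf: "\<bar>k x y * f y\<bar> \<le> M * B" for x y
    unfolding abs_mult using B[of y] k_nonneg k_le M_nonneg by (intro mult_mono) auto
  have i: "integrable \<nu>' (\<lambda>y. k x y * f y)" for x
    by (rule N.integrable_const_bound[where B = "M * B"]) (use kf in auto)
  have ki: "integrable \<nu>' (k x)" for x
    by (rule N.integrable_const_bound[where B = M]) (use k_nonneg k_le in auto)
  have "\<bar>(\<integral>y. k x y * f y \<partial>\<nu>') - (\<integral>y. k c y * f y \<partial>\<nu>')\<bar> = \<bar>\<integral>y. k x y * f y - k c y * f y \<partial>\<nu>'\<bar>"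
    using i by simp
  also have "\<dots> \<le> (\<integral>y. B * \<bar>k x y - k c y\<bar> \<partial>\<nu>')"
  proof (rule order_trans[OF integral_abs_bound], rule integral_mono)
    fix y
    have "\<bar>k x y * f y - k c y * f y\<bar> = \<bar>f y\<bar> * \<bar>k x y - k c y\<bar>"
      by (simp add: abs_mult flip: left_diff_distrib)
    then show "\<bar>k x y * f y - k c y * f y\<bar> \<le> B * \<bar>k x y - k c y\<bar>"
      using B[of y] by (simp add: mult_right_mono)
  qed (use i ki in auto)
  finally show ?thesis by simp
qed

text \<open>A Glivenko-Cantelli argument: replace \<open>x\<close> by its centre \<open>p j x\<close> in both integrals at a cost of \<open>B * e j\<close> each,
  and use that there are finitely many centres.\<close>

lemma uniform_convergence:
  assumes f: "f \<in> borel_measurable borel" "\<And>y. \<bar>f y\<bar> \<le> B"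
    and c: "centre_conv f" and "0 < \<epsilon>"
  shows "\<forall>\<^sub>F n in sequentially. \<forall>x. \<bar>(\<integral>y. k x y * f y \<partial>\<nu> n) - (\<integral>y. k x y * f y \<partial>\<mu>)\<bar> \<le> \<epsilon>"
proof -
  have "0 \<le> B" using f(2)[of undefined] by linarith
  have "(\<lambda>j. B * e j) \<longlonglongrightarrow> B * 0" by (intro tendsto_intros e_tendsto)
  then obtain j where j: "B * e j < \<epsilon> / 3"
    using order_tendstoD(2)[of _ "B * 0" sequentially "\<epsilon> / 3"] \<open>0 < \<epsilon>\<close>
      eventually_happens[of _ sequentially] by auto
  have "\<forall>\<^sub>F n in sequentially. \<bar>(\<integral>y. k z y * f y \<partial>\<nu> n) - (\<integral>y. k z y * f y \<partial>\<mu>)\<bar> < \<epsilon> / 3"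
    if z: "z \<in> range (p j)" for z
  proof -
    have "(\<lambda>n. \<integral>y. k z y * f y \<partial>\<nu> n) \<longlonglongrightarrow> (\<integral>y. k z y * f y \<partial>\<mu>)"
      using z c unfolding centre_conv_def by blast
    from tendstoD[OF this, of "\<epsilon> / 3"] show ?thesis using \<open>0 < \<epsilon>\<close> by (simp add: dist_real_def)
  qed
  then have "\<forall>\<^sub>F n in sequentially. \<forall>z\<in>range (p j).
      \<bar>(\<integral>y. k z y * f y \<partial>\<nu> n) - (\<integral>y. k z y * f y \<partial>\<mu>)\<bar> < \<epsilon> / 3"
    by (intro eventually_ball_finite p_finite) blast
  then show ?thesis using prob_\<nu> osc_\<nu>[of j]
  proof eventually_elim
    case (elim n)
    show ?case
    proof
      fix x
      have "B * (\<integral>y. \<bar>k x y - k (p j x) y\<bar> \<partial>\<nu> n) \<le> B * e j"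
        "B * (\<integral>y. \<bar>k x y - k (p j x) y\<bar> \<partial>\<mu>) \<le> B * e j"
        using elim(3) osc_\<mu>[of x j] \<open>0 \<le> B\<close> by (auto intro!: mult_left_mono)
      moreover have "\<bar>(\<integral>y. k (p j x) y * f y \<partial>\<nu> n) - (\<integral>y. k (p j x) y * f y \<partial>\<mu>)\<bar> < \<epsilon> / 3"
        using elim(1) by blast
      moreover note abs_integral_k_diff_le[OF _ _ f, of "\<nu> n" x "p j x"]
        abs_integral_k_diff_le[OF prob_space_axioms sets_eq f, of x "p j x"] elim(2) j
      ultimately show "\<bar>(\<integral>y. k x y * f y \<partial>\<nu> n) - (\<integral>y. k x y * f y \<partial>\<mu>)\<bar> \<le> \<epsilon>"
        by linarith
    qed
  qed
qed

lemma centre_conv_one: "centre_conv (\<lambda>_. 1)"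
  using conv_one by (simp add: centre_conv_def)

lemma centre_conv_inverse: "centre_conv (\<lambda>y. 1 / deg k \<mu> y)"
  unfolding centre_conv_def using conv_inverse by blast

lemma uniform_deg: "0 < \<epsilon> \<Longrightarrow> \<forall>\<^sub>F n in sequentially. \<forall>x. \<bar>deg k (\<nu> n) x - deg k \<mu> x\<bar> \<le> \<epsilon>"
  using uniform_convergence[of "\<lambda>_. 1" 1 \<epsilon>] centre_conv_one by (simp add: deg_def)

lemma eventually_kernel_measure: "\<forall>\<^sub>F n in sequentially. kernel_measure (\<nu> n) k a M"
  using prob_\<nu> uniform_deg[OF gap(1)]
proof eventually_elim
  case (elim n)
  have "a \<le> deg k (\<nu> n) x" for x using elim(2)[rule_format, of x] gap(2)[of x] by linarith
  then show ?case
    using elim(1) k_measurable k_sym k_nonneg k_le c_pos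
    by (intro kernel_measure.intro kernel_measure_axioms.intro) auto
qed

lemma uniform_h:
  assumes f: "f \<in> borel_measurable borel" "\<And>y. \<bar>f y\<bar> \<le> B"
    and c: "centre_conv f" "centre_conv (\<lambda>y. f y / deg k \<mu> y)" and "0 < \<epsilon>"
  shows "\<forall>\<^sub>F n in sequentially. \<forall>x.
    \<bar>(\<integral>y. hker k (\<nu> n) x y * f y \<partial>\<nu> n) - (\<integral>y. h x y * f y \<partial>\<mu>)\<bar> \<le> \<epsilon>"
proof -
  note [measurable] = f(1)
  have "0 \<le> B" using f(2)[of undefined] by linarith
  define D where "D = 1 / a + 1 + M * B / a\<^sup>2"
  have D: "0 < D" using c_pos M_nonneg \<open>0 \<le> B\<close> unfolding D_def
    by (intro add_pos_nonneg) auto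
  define t where "t = \<epsilon> / D"
  have t: "0 < t" using D \<open>0 < \<epsilon>\<close> by (simp add: t_def)
  have b: "\<bar>f y / deg k \<mu> y\<bar> \<le> B * (1 / a)" for y by (rule abs_divide_deg_le[OF f(2)])
  have "(\<lambda>y. f y / deg k \<mu> y) \<in> borel_measurable borel" by measurable
  from eventually_kernel_measure uniform_convergence[OF f c(1) t]
    uniform_convergence[OF this b c(2) t] uniform_deg[OF t]
  show ?thesis
  proof eventually_elim
    case (elim n)
    show ?case
    proof
      fix x
      have "\<bar>(\<integral>y. hker k (\<nu> n) x y * f y \<partial>\<nu> n) - (\<integral>y. h x y * f y \<partial>\<mu>)\<bar>
          \<le> t / a + t + M * B / a\<^sup>2 * t"
        using abs_integral_h_measures_diff_le[OF kernel_measure_axioms elim(1) f, of t t t x] elim(2-4)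
        by blast
      also have "\<dots> = t * D" by (simp add: D_def algebra_simps)
      also have "\<dots> = \<epsilon>" using D by (simp add: t_def)
      finally show "\<bar>(\<integral>y. hker k (\<nu> n) x y * f y \<partial>\<nu> n) - (\<integral>y. h x y * f y \<partial>\<mu>)\<bar> \<le> \<epsilon>" .
    qed
  qed
qed

lemma uniform_m:
  "0 < \<epsilon> \<Longrightarrow> \<forall>\<^sub>F n in sequentially. \<forall>x. \<bar>mfun k (\<nu> n) x - m x\<bar> \<le> \<epsilon>"
  using uniform_h[of "\<lambda>_. 1" 1 \<epsilon>] centre_conv_one centre_conv_inverse by (simp add: mfun_def)

lemma Us_diff_apply:
  assumes "kernel_measure (\<nu> n) k a M"
  shows "apply_bmfun ((U - Us n) f) x = (m x - mfun k (\<nu> n) x) * apply_bmfun f x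
    - ((\<integral>y. h x y * apply_bmfun f y \<partial>\<mu>) - (\<integral>y. hker k (\<nu> n) x y * apply_bmfun f y \<partial>\<nu> n))"
  using kernel_measure.U_apply[OF assms, of f x] U_apply[of f x]
  by (simp add: blinfun.diff_left algebra_simps)

lemma Us_tendsto:
  assumes c: "centre_conv (apply_bmfun f)" "centre_conv (\<lambda>y. apply_bmfun f y / deg k \<mu> y)"
  shows "(\<lambda>n. Us n f) \<longlonglongrightarrow> U f"
proof (rule metric_LIMSEQ_I)
  fix \<epsilon> :: real assume "0 < \<epsilon>"
  define t where "t = \<epsilon> / 2 / (norm f + 1)"
  have nf: "0 < norm f + 1" using norm_ge_zero[of f] by linarith
  have t: "0 < t" using \<open>0 < \<epsilon>\<close> nf by (simp add: t_def)
  have "\<bar>apply_bmfun f y\<bar> \<le> norm f" for y using norm_apply_bmfun_le[of f y] by simp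
  from eventually_kernel_measure uniform_m[OF t] uniform_h[OF measurable_apply_bmfun this c t]
  have "\<forall>\<^sub>F n in sequentially. dist (Us n f) (U f) < \<epsilon>"
  proof eventually_elim
    case (elim n)
    have "norm ((U - Us n) f) \<le> t * (norm f + 1)"
    proof (rule norm_bmfun_le)
      fix x
      have "\<bar>(m x - mfun k (\<nu> n) x) * apply_bmfun f x\<bar> \<le> t * norm f"
        unfolding abs_mult using elim(2) norm_apply_bmfun_le[of f x] t
        by (intro mult_mono) (auto simp: abs_minus_commute)
      moreover have "\<bar>(\<integral>y. h x y * apply_bmfun f y \<partial>\<mu>) - (\<integral>y. hker k (\<nu> n) x y * apply_bmfun f y \<partial>\<nu> n)\<bar> \<le> t"
        using elim(3) by (simp add: abs_minus_commute)
      ultimately show "norm (apply_bmfun ((U - Us n) f) x) \<le> t * (norm f + 1)"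
        unfolding Us_diff_apply[OF elim(1)] by (simp add: algebra_simps)
    qed
    also have "\<dots> = \<epsilon> / 2" using nf unfolding t_def
      by (metis less_irrefl nonzero_mult_div_cancel_right times_divide_eq_left)
    also have "\<dots> < \<epsilon>" using \<open>0 < \<epsilon>\<close> by simp
    finally show ?case by (simp add: dist_norm blinfun.diff_left norm_minus_commute)
  qed
  then show "\<exists>N. \<forall>n\<ge>N. dist (Us n f) (U f) < \<epsilon>" by (simp add: eventually_sequentially)
qed

text \<open>The bound for the oscillation of \<open>(T - Ts n) F\<close>, \<open>\<parallel>F\<parallel> \<le> 1\<close>. The summand \<open>1 / Suc j\<close> absorbs the multiplication
  part \<open>(m - m\<^sub>n) F\<close>, which does not oscillate little but is small for large \<open>n\<close>. The factor \<open>2\<close> is for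
  real and imaginary parts.\<close>

definition osc :: "nat \<Rightarrow> real"
  where "osc j = 2 * (1 / real (Suc j) + 2 * lip * e j)"

lemma osc_tendsto: "osc \<longlonglongrightarrow> 0"
proof -
  have "(\<lambda>j. 2 * (1 / real (Suc j) + 2 * lip * e j)) \<longlonglongrightarrow> 2 * (0 + 2 * lip * 0)"
    by (intro tendsto_intros e_tendsto one_over_Suc_tendsto)
  then show ?thesis by (simp add: osc_def[abs_def])
qed

lemma eventually_osc_real:
  "\<forall>\<^sub>F n in sequentially. \<forall>f x. norm f \<le> 1 \<longrightarrow>
    \<bar>apply_bmfun ((U - Us n) f) x - apply_bmfun ((U - Us n) f) (p j x)\<bar> \<le> osc j / 2"
proof -
  have "0 < 1 / (2 * real (Suc j))" by simp
  from eventually_kernel_measure uniform_m[OF this] osc_\<nu>[of j] show ?thesis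
  proof eventually_elim
    case (elim n)
    interpret N: kernel_measure "\<nu> n" k a M by (rule elim(1))
    show ?case
    proof (intro allI impI)
      fix f :: "('a, real) bmfun" and x assume f: "norm f \<le> 1"
      have le: "lip * norm f * t \<le> lip * e j" if "t \<le> e j" "0 \<le> t" for t
      proof -
        have "(lip * norm f) * t \<le> (lip * 1) * e j"
          using that f lip_nonneg by (intro mult_mono mult_left_mono) auto
        then show ?thesis by simp
      qed
      have K: "\<bar>(\<integral>y. h x y * apply_bmfun f y \<partial>\<mu>) - (\<integral>y. h (p j x) y * apply_bmfun f y \<partial>\<mu>)\<bar> \<le> lip * e j"
        by (rule order_trans[OF abs_integral_h_diff_le le[OF osc_\<mu>]]) (rule integral_nonneg_AE, simp)
      have Kn: "\<bar>(\<integral>y. N.h x y * apply_bmfun f y \<partial>\<nu> n) - (\<integral>y. N.h (p j x) y * apply_bmfun f y \<partial>\<nu> n)\<bar> \<le> lip * e j"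
        using elim(3) by (intro order_trans[OF N.abs_integral_h_diff_le le]) (auto intro: integral_nonneg_AE)
      have mm: "\<bar>(m x - N.m x) * apply_bmfun f x\<bar> \<le> 1 / (2 * real (Suc j))" for x
      proof -
        have "\<bar>m x - N.m x\<bar> * \<bar>apply_bmfun f x\<bar> \<le> 1 / (2 * real (Suc j)) * 1"
          using elim(2) f norm_apply_bmfun_le[of f x]
          by (intro mult_mono) (auto simp: abs_minus_commute intro: order_trans)
        then show ?thesis by (simp add: abs_mult)
      qed
      have "osc j / 2 = 1 / (2 * real (Suc j)) + 1 / (2 * real (Suc j)) + lip * e j + lip * e j"
        by (simp add: osc_def field_simps)
      then show "\<bar>apply_bmfun ((U - Us n) f) x - apply_bmfun ((U - Us n) f) (p j x)\<bar> \<le> osc j / 2"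
        unfolding Us_diff_apply[OF elim(1)] using K Kn mm[of x] mm[of "p j x"] by linarith
    qed
  qed
qed

lemma eventually_osc:
  "\<forall>\<^sub>F n in sequentially. \<forall>F x. norm F \<le> 1 \<longrightarrow>
    norm (apply_bmfun ((T - Ts n) F) x - apply_bmfun ((T - Ts n) F) (p j x)) \<le> osc j"
  using eventually_osc_real[of j]
proof eventually_elim
  case (elim n)
  show ?case
  proof (intro allI impI)
    fix F :: "('a, complex) bmfun" and x assume F: "norm F \<le> 1"
    let ?G = "apply_bmfun (complexify (U - Us n) F)"
    have "\<bar>Re (?G x - ?G (p j x))\<bar> \<le> osc j / 2" "\<bar>Im (?G x - ?G (p j x))\<bar> \<le> osc j / 2"
      using elim[rule_format, of "Re_bmfun F" x] elim[rule_format, of "Im_bmfun F" x]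
        norm_Re_bmfun[of F] norm_Im_bmfun[of F] F by auto
    then show "norm (apply_bmfun ((T - Ts n) F) x - apply_bmfun ((T - Ts n) F) (p j x)) \<le> osc j"
      using cmod_le[of "?G x - ?G (p j x)"] by (simp flip: complexify_diff)
  qed
qed

lemma eventually_norm_Us: "\<forall>\<^sub>F n in sequentially. norm (Us n) \<le> 2 * M / a"
  using eventually_kernel_measure by eventually_elim (rule kernel_measure.norm_U_le)

lemma eventually_norm_Ts: "\<forall>\<^sub>F n in sequentially. norm (Ts n) \<le> 4 * M / a"
  using eventually_norm_Us
proof eventually_elim
  case (elim n)
  then show ?case using norm_complexify_le[of "Us n"] by simp
qed

text \<open>Compact convergence in a form that allows the operators to be taken at any indices \<open>n i\<close> tending to infinity,
  as needed when only some operators of the sequence are known to be badly invertible. The limit is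
  recorded to be regulated, that is, to satisfy the oscillation bounds.\<close>

lemma compact_convergence:
  fixes D :: "nat \<Rightarrow> ('a, 'b::{banach, heine_borel, second_countable_topology}) bmfun \<Rightarrow>\<^sub>L ('a, 'b) bmfun"
  assumes osc: "\<And>j. \<forall>\<^sub>F n in sequentially. \<forall>F x. norm F \<le> 1 \<longrightarrow>
      norm (apply_bmfun (D n F) x - apply_bmfun (D n F) (p j x)) \<le> osc j"
    and bound: "\<forall>\<^sub>F n in sequentially. norm (D n) \<le> B"
    and n: "filterlim n at_top sequentially" and F: "\<And>i. norm (F i) \<le> 1"
  obtains r g where "strict_mono (r :: nat \<Rightarrow> nat)" "(\<lambda>i. D (n (r i)) (F (r i))) \<longlonglongrightarrow> g"
    "\<And>j x. norm (apply_bmfun g x - apply_bmfun g (p j x)) \<le> osc j"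
proof -
  have "\<forall>\<^sub>F i in sequentially. norm (D (n i)) \<le> B"
    using eventually_compose_filterlim[OF bound n] .
  then obtain N where N: "\<And>i. N \<le> i \<Longrightarrow> norm (D (n i)) \<le> B"
    unfolding eventually_sequentially by blast
  define G where "G i = D (n (i + N)) (F (i + N))" for i
  have nN: "filterlim (\<lambda>i. n (i + N)) at_top sequentially"
    by (rule filterlim_compose[OF n filterlim_add_const_nat_at_top])
  have "0 \<le> B" using N[of N] norm_ge_zero order_trans by blast
  have "norm (G i) \<le> B" for i
  proof -
    have "norm (G i) \<le> norm (D (n (i + N))) * norm (F (i + N))" unfolding G_def by (rule norm_blinfun)
    also have "\<dots> \<le> B * 1" using N F \<open>0 \<le> B\<close> by (intro mult_mono) auto
    finally show ?thesis by simp
  qed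
  moreover have "\<forall>\<^sub>F i in sequentially. \<forall>x. norm (apply_bmfun (G i) x - apply_bmfun (G i) (p j x)) \<le> osc j" for j
    using eventually_compose_filterlim[OF osc[of j] nN]
    by eventually_elim (use F in \<open>auto simp: G_def\<close>)
  ultimately obtain r g where "strict_mono r" "(\<lambda>i. G (r i)) \<longlonglongrightarrow> g"
      "\<And>j x. norm (apply_bmfun g x - apply_bmfun g (p j x)) \<le> osc j"
    by (rule asymptotic_Arzela_Ascoli[OF _ p_finite osc_tendsto]) blast
  then show ?thesis
    by (intro that[of "\<lambda>i. r i + N" g]) (auto simp: G_def strict_mono_def)
qed

lemma converges_compactly_Us: "converges_compactly Us U"
  unfolding converges_compactly_def
proof (intro allI impI)
  fix f :: "nat \<Rightarrow> ('a, real) bmfun" assume f: "\<forall>n. norm (f n) \<le> 1"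
  have "\<forall>\<^sub>F n in sequentially. \<forall>f x. norm f \<le> 1 \<longrightarrow>
      norm (apply_bmfun ((U - Us n) f) x - apply_bmfun ((U - Us n) f) (p j x)) \<le> osc j" for j
    using eventually_osc_real[of j]
  proof eventually_elim
    case (elim n)
    have "0 \<le> osc j" using lip_nonneg e_nonneg[of j] by (simp add: osc_def)
    then have "osc j / 2 \<le> osc j" by simp
    then show ?case using elim order_trans unfolding real_norm_def by blast
  qed
  moreover have "\<forall>\<^sub>F n in sequentially. norm (U - Us n) \<le> norm U + 2 * M / a"
    using eventually_norm_Us
    by eventually_elim (rule order_trans[OF norm_triangle_ineq4], simp)
  ultimately obtain r g where "strict_mono (r :: nat \<Rightarrow> nat)" "(\<lambda>i. (U - Us (r i)) (f (r i))) \<longlonglongrightarrow> g"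
    by (rule compact_convergence[where n = "\<lambda>i. i" and F = f]) (use f filterlim_ident in blast)+
  then show "\<exists>r. strict_mono r \<and> convergent (\<lambda>j. (U - Us (r j)) (f (r j)))"
    unfolding convergent_def by blast
qed

end

section \<open>Convergence of spectra and spectral projections\<close>

definition indicator_bmfun :: "'a::topological_space set \<Rightarrow> ('a, complex) bmfun"
  where "indicator_bmfun A = Bmfun (indicator A)"

lemma apply_indicator_bmfun: "A \<in> sets borel \<Longrightarrow> apply_bmfun (indicator_bmfun A) x = indicator A x"
  unfolding indicator_bmfun_def by (subst Bmfun_inverse) (auto intro!: bmfunI[where b = 1] simp: indicator_def)

lemma apply_bmfun_sum: "apply_bmfun (\<Sum>i\<in>I. f i) x = (\<Sum>i\<in>I. apply_bmfun (f i) x)"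
  by (induction I rule: infinite_finite_induct) auto

context kernel_approximation
begin

definition conv_vec :: "('a, complex) bmfun \<Rightarrow> bool"
  where "conv_vec F \<longleftrightarrow> (\<lambda>n. Ts n F) \<longlonglongrightarrow> T F"

lemma conv_vec_sum:
  assumes "\<And>i. i \<in> I \<Longrightarrow> conv_vec (F i)" shows "conv_vec (\<Sum>i\<in>I. F i)"
  using assms unfolding conv_vec_def by (simp add: blinfun.sum_right tendsto_sum)

lemma conv_vec_scaleC:
  assumes "conv_vec F" shows "conv_vec (scaleC_bmfun c F)"
proof -
  have "(\<lambda>n. scalar_op c (Ts n F)) \<longlonglongrightarrow> scalar_op c (T F)"
    using assms unfolding conv_vec_def
    by (rule bounded_linear.tendsto[OF blinfun.bounded_linear_right])
  then show ?thesis by (simp add: conv_vec_def complexify_scaleC)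
qed

lemma conv_vec_complex:
  assumes "(\<lambda>n. Us n (Re_bmfun F)) \<longlonglongrightarrow> U (Re_bmfun F)" "(\<lambda>n. Us n (Im_bmfun F)) \<longlonglongrightarrow> U (Im_bmfun F)"
  shows "conv_vec F"
  unfolding conv_vec_def
proof (rule LIM_zero_cancel, rule Lim_null_comparison)
  show "\<forall>\<^sub>F n in sequentially. norm (Ts n F - T F)
      \<le> norm (Us n (Re_bmfun F) - U (Re_bmfun F)) + norm (Us n (Im_bmfun F) - U (Im_bmfun F))"
    using norm_complexify_apply_le[of "Us _ - U" F]
    by (intro always_eventually allI) (simp add: complexify_diff blinfun.diff_left)
  show "(\<lambda>n. norm (Us n (Re_bmfun F) - U (Re_bmfun F)) + norm (Us n (Im_bmfun F) - U (Im_bmfun F))) \<longlonglongrightarrow> 0"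
    using tendsto_add[OF tendsto_norm_zero[OF LIM_zero[OF assms(1)]] tendsto_norm_zero[OF LIM_zero[OF assms(2)]]]
    by simp
qed

definition "diff_bound = 4 * M / a + norm T + 1"

lemma diff_bound_pos: "0 < diff_bound"
  using M_nonneg c_pos by (auto simp: diff_bound_def intro!: add_nonneg_pos)

lemma eventually_norm_diff: "\<forall>\<^sub>F n in sequentially. norm (Ts n - T) \<le> diff_bound"
  using eventually_norm_Ts
proof eventually_elim
  case (elim n)
  then show ?case using norm_triangle_ineq4[of "Ts n" T] by (simp add: diff_bound_def)
qed

lemma norm_diff_apply_le:
  assumes "norm (Ts n - T) \<le> diff_bound" "dist G F < t"
  shows "norm ((Ts n - T) F) \<le> norm ((Ts n - T) G) + diff_bound * t"
proof -
  have "norm ((Ts n - T) (F - G)) \<le> norm (Ts n - T) * norm (F - G)" by (rule norm_blinfun)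
  also have "\<dots> \<le> diff_bound * t"
    using assms diff_bound_pos by (intro mult_mono) (auto simp: dist_norm norm_minus_commute)
  finally show ?thesis
    using norm_triangle_sub[of "(Ts n - T) F" "(Ts n - T) G"] by (simp add: blinfun.diff_right)
qed

lemma uniform_conv_on_compact:
  assumes "compact S" and S: "\<And>F. F \<in> S \<Longrightarrow> conv_vec F" and "0 < \<epsilon>"
  shows "\<forall>\<^sub>F n in sequentially. \<forall>F\<in>S. norm ((Ts n - T) F) \<le> \<epsilon>"
proof -
  define t where "t = \<epsilon> / 2 / diff_bound"
  have t: "0 < t" "diff_bound * t = \<epsilon> / 2" using \<open>0 < \<epsilon>\<close> diff_bound_pos by (auto simp: t_def)
  obtain C where C: "finite C" "C \<subseteq> S" "S \<subseteq> (\<Union>x\<in>C. ball x t)"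
    using seq_compact_imp_totally_bounded[of S] compact_imp_seq_compact[OF assms(1)] t(1) by blast
  have "\<forall>\<^sub>F n in sequentially. norm ((Ts n - T) F) < \<epsilon> / 2" if "F \<in> C" for F
    using tendstoD[of "\<lambda>n. Ts n F" "T F" sequentially "\<epsilon> / 2"] S that C(2) \<open>0 < \<epsilon>\<close>
    by (auto simp: conv_vec_def dist_norm blinfun.diff_left)
  then have "\<forall>\<^sub>F n in sequentially. \<forall>F\<in>C. norm ((Ts n - T) F) < \<epsilon> / 2"
    using C(1) by (simp add: eventually_ball_finite)
  then show ?thesis using eventually_norm_diff
  proof eventually_elim
    case (elim n)
    show ?case
    proof
      fix F assume "F \<in> S"
      then obtain G where G: "G \<in> C" "dist G F < t" using C(3) by auto
      then have "norm ((Ts n - T) G) < \<epsilon> / 2" using elim(1) by blast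
      then show "norm ((Ts n - T) F) \<le> \<epsilon>"
        using norm_diff_apply_le[OF elim(2) G(2)] t(2) by linarith
    qed
  qed
qed

text \<open>The operators are uniformly bounded for large \<open>n\<close>.\<close>

lemma conv_vec_closed:
  assumes "F \<in> closure {F. conv_vec F}" shows "conv_vec F"
  unfolding conv_vec_def
proof (rule metric_LIMSEQ_I)
  fix \<epsilon> :: real assume "0 < \<epsilon>"
  define t where "t = \<epsilon> / 2 / diff_bound"
  have t: "0 < t" "diff_bound * t = \<epsilon> / 2" using \<open>0 < \<epsilon>\<close> diff_bound_pos by (auto simp: t_def)
  obtain G where G: "conv_vec G" "dist G F < t"
    using assms t(1) unfolding closure_approachable by auto
  have "\<forall>\<^sub>F n in sequentially. norm ((Ts n - T) G) < \<epsilon> / 2"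
    using tendstoD[of "\<lambda>n. Ts n G" "T G" sequentially "\<epsilon> / 2"] G(1) \<open>0 < \<epsilon>\<close>
    by (auto simp: conv_vec_def dist_norm blinfun.diff_left)
  then have "\<forall>\<^sub>F n in sequentially. dist (Ts n F) (T F) < \<epsilon>" using eventually_norm_diff
  proof eventually_elim
    case (elim n)
    have "norm ((Ts n - T) F) < \<epsilon>"
      using norm_diff_apply_le[OF elim(2) G(2)] t(2) elim(1) by linarith
    then show ?case by (simp add: dist_norm blinfun.diff_left)
  qed
  then show "\<exists>N. \<forall>n\<ge>N. dist (Ts n F) (T F) < \<epsilon>" by (simp add: eventually_sequentially)
qed

lemma conv_vec_lim:
  assumes "(\<lambda>i. F i) \<longlonglongrightarrow> G" "\<And>i::nat. conv_vec (F i)" shows "conv_vec G"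
  using assms by (intro conv_vec_closed) (auto simp: closure_sequential)

text \<open>The resolvent is norm continuous in \<open>z\<close>, so a countable dense set \<open>Z\<close> decides convergence for all \<open>z\<close>.\<close>

lemma conv_vec_resolvent_dense:
  assumes "Z \<subseteq> - op_spectrum U" "- op_spectrum U \<subseteq> closure Z"
    and Z: "\<And>z. z \<in> Z \<Longrightarrow> conv_vec (resolvent U z F)" and z: "z \<notin> op_spectrum U"
  shows "conv_vec (resolvent U z F)"
proof -
  obtain w where w: "\<And>i. w i \<in> Z" "w \<longlonglongrightarrow> z"
    using z assms(2) by (force simp: closure_sequential)
  have "(\<lambda>i. resolvent U (w i)) \<longlonglongrightarrow> resolvent U z"
  proof (rule continuous_on_tendsto_compose[OF continuous_on_resolvent w(2)])
    show "\<forall>\<^sub>F i in sequentially. w i \<in> - op_spectrum U"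
      using w(1) assms(1) by (intro always_eventually allI) blast
  qed (use z in simp)
  then have "(\<lambda>i. resolvent U (w i) F) \<longlonglongrightarrow> resolvent U z F"
    by (intro tendsto_intros)
  then show ?thesis by (rule conv_vec_lim) (use w Z in blast)
qed

definition step :: "nat \<Rightarrow> ('a, complex) bmfun \<Rightarrow> ('a, complex) bmfun"
  where "step j y = (\<Sum>c\<in>range (p j). scaleC_bmfun (apply_bmfun y c) (indicator_bmfun {x. p j x = c}))"

lemma apply_step: "apply_bmfun (step j y) x = apply_bmfun y (p j x)"
proof -
  have "apply_bmfun (step j y) x = (\<Sum>c\<in>range (p j). if c = p j x then apply_bmfun y c else 0)"
    unfolding step_def apply_bmfun_sum
    by (intro sum.cong refl) (auto simp: apply_indicator_bmfun[OF p_measurable] indicator_def)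
  then show ?thesis using p_finite[of j] by simp
qed

lemma step_tendsto:
  assumes "\<And>j x. norm (apply_bmfun y x - apply_bmfun y (p j x)) \<le> osc j"
  shows "(\<lambda>j. step j y) \<longlonglongrightarrow> y"
proof (rule LIM_zero_cancel, rule Lim_null_comparison[OF _ osc_tendsto])
  show "\<forall>\<^sub>F j in sequentially. norm (step j y - y) \<le> osc j"
    using assms by (intro always_eventually allI norm_bmfun_le) (simp add: apply_step norm_minus_commute)
qed

end

text \<open>For random measures this holds almost surely, as countably many \<open>z\<close> decide it
  (\<open>conv_vec_resolvent_dense\<close>).\<close>

locale spectral_approximation = kernel_approximation +
  assumes conv_indicator: "\<And>z j y. z \<notin> op_spectrum U \<Longrightarrow> y \<in> range (p j) \<Longrightarrow>
    conv_vec (resolvent U z (indicator_bmfun {x. p j x = y}))"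
begin

lemma conv_vec_resolvent_regulated:
  assumes y: "\<And>j x. norm (apply_bmfun y x - apply_bmfun y (p j x)) \<le> osc j"
    and z: "z \<notin> op_spectrum U"
  shows "conv_vec (resolvent U z y)"
proof (rule conv_vec_lim)
  show "(\<lambda>j. resolvent U z (step j y)) \<longlonglongrightarrow> resolvent U z y"
    by (intro tendsto_intros step_tendsto y)
  show "conv_vec (resolvent U z (step j y))" for j
    unfolding step_def blinfun.sum_right resolvent_scaleC[OF z]
    by (intro conv_vec_sum conv_vec_scaleC conv_indicator z)
qed

text \<open>Otherwise there are unit vectors \<open>F j\<close> with \<open>(Us (n j) - z j) (F j) \<longlonglongrightarrow> 0\<close> and \<open>n j \<longlonglongrightarrow> \<infinity>\<close>, and \<open>z j \<longlonglongrightarrow> w\<close> without loss of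
  generality. Along a subsequence \<open>(T - Ts (n j)) (F j)\<close> tends to some regulated \<open>g\<close>, so \<open>(T - w) (F j) \<longlonglongrightarrow> g\<close>
  and \<open>F j \<longlonglongrightarrow> R(w) g\<close>. Since \<open>Ts n\<close> converges to \<open>T\<close> at this limit, \<open>(T - Ts (n j)) (F j)\<close> tends to \<open>0\<close>
  as well, hence \<open>g = 0\<close> and \<open>F j \<longlonglongrightarrow> 0\<close>, which contradicts \<open>\<parallel>F j\<parallel> = 1\<close>.\<close>

lemma uniformly_bounded_below:
  assumes "compact K" "K \<inter> op_spectrum U = {}"
  shows "\<exists>c>0. \<forall>\<^sub>F n in sequentially. \<forall>z\<in>K. bounded_below c (shifted (Us n) z)"
proof (rule ccontr)
  assume no: "\<not> ?thesis"
  have "\<exists>n z F. j \<le> n \<and> z \<in> K \<and> norm F = 1 \<and> norm (shifted (Us n) z F) < 1 / real (Suc j)" for j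
  proof -
    have "\<not> (\<forall>\<^sub>F n in sequentially. \<forall>z\<in>K. bounded_below (1 / real (Suc j)) (shifted (Us n) z))"
      using no by auto
    then obtain n z where nz: "j \<le> n" "z \<in> K" "\<not> bounded_below (1 / real (Suc j)) (shifted (Us n) z)"
      unfolding eventually_sequentially by blast
    then obtain F where F: "norm (shifted (Us n) z F) < 1 / real (Suc j) * norm F"
      unfolding bounded_below_def by (auto simp: not_le)
    then have "norm F > 0" using norm_ge_zero[of "shifted (Us n) z F"] by (cases "norm F = 0") auto
    then have "norm (F /\<^sub>R norm F) = 1" "norm (shifted (Us n) z (F /\<^sub>R norm F)) < 1 / real (Suc j)"
      using F by (simp_all add: blinfun.scaleR_right field_simps)
    then show ?thesis using nz by blast
  qed
  then obtain n z F where nzF: "\<And>j. j \<le> n j" "\<And>j. z j \<in> K" "\<And>j. norm (F j) = 1"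
      "\<And>j. norm (shifted (Us (n j)) (z j) (F j)) < 1 / real (Suc j)" by metis
  have ntop: "filterlim n at_top sequentially"
    by (rule filterlim_at_top_mono[OF filterlim_ident]) (use nzF(1) in auto)
  have s0: "(\<lambda>j. shifted (Us (n j)) (z j) (F j)) \<longlonglongrightarrow> 0"
  proof (rule Lim_null_comparison)
    show "\<forall>\<^sub>F j in sequentially. norm (shifted (Us (n j)) (z j) (F j)) \<le> 1 / real (Suc j)"
      using nzF(4) by (intro always_eventually allI) (simp add: less_imp_le)
    show "(\<lambda>j. 1 / real (Suc j)) \<longlonglongrightarrow> 0" by (rule one_over_Suc_tendsto)
  qed
  obtain w r where w: "w \<in> K" "strict_mono (r :: nat \<Rightarrow> nat)" "(z \<circ> r) \<longlonglongrightarrow> w"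
    using assms(1) nzF(2) unfolding compact_def by metis
  have wns: "w \<notin> op_spectrum U" using w(1) assms(2) by blast
  have rtop: "filterlim r at_top sequentially" by (rule filterlim_subseq[OF w(2)])
  have nr: "filterlim (\<lambda>i. n (r i)) at_top sequentially" by (rule filterlim_compose[OF ntop rtop])
  have nd: "\<forall>\<^sub>F n in sequentially. norm (T - Ts n) \<le> diff_bound"
    using eventually_norm_diff by (simp add: norm_minus_commute)
  have "norm (F (r i)) \<le> 1" for i using nzF(3) by simp
  then obtain q g where q: "strict_mono (q :: nat \<Rightarrow> nat)"
      "(\<lambda>i. (T - Ts (n (r (q i)))) (F (r (q i)))) \<longlonglongrightarrow> g"
      "\<And>j x. norm (apply_bmfun g x - apply_bmfun g (p j x)) \<le> osc j"
    by (rule compact_convergence[where F = "\<lambda>i. F (r i)", OF eventually_osc nd nr]) blast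
  define s where "s i = r (q i)" for i
  have smono: "strict_mono s" using strict_mono_o[OF w(2) q(1)] by (simp add: s_def[abs_def] o_def)
  have stop: "filterlim s at_top sequentially" by (rule filterlim_subseq[OF smono])
  let ?n = "\<lambda>i. n (s i)" and ?z = "\<lambda>i. z (s i)" and ?F = "\<lambda>i. F (s i)"
  have zw: "?z \<longlonglongrightarrow> w"
    using LIMSEQ_subseq_LIMSEQ[OF w(3) q(1)] by (simp add: o_def s_def)
  have s0': "(\<lambda>i. shifted (Us (?n i)) (?z i) (?F i)) \<longlonglongrightarrow> 0"
    using filterlim_compose[OF s0 stop] .
  have zF: "(\<lambda>i. scalar_op (?z i - w) (?F i)) \<longlonglongrightarrow> 0"
  proof (rule Lim_null_comparison)
    show "\<forall>\<^sub>F i in sequentially. norm (scalar_op (?z i - w) (?F i)) \<le> cmod (?z i - w)"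
      using nzF(3) by (intro always_eventually allI) (simp add: norm_scaleC_bmfun)
    show "(\<lambda>i. cmod (?z i - w)) \<longlonglongrightarrow> 0" using zw by (simp add: tendsto_norm_zero LIM_zero)
  qed
  have "(\<lambda>i. shifted (Us (?n i)) (?z i) (?F i) + (T - Ts (?n i)) (?F i) + scalar_op (?z i - w) (?F i))
      \<longlonglongrightarrow> 0 + g + 0"
    using s0' q(2) zF unfolding s_def by (intro tendsto_add)
  moreover have "shifted (Us (?n i)) (?z i) (?F i) + (T - Ts (?n i)) (?F i) + scalar_op (?z i - w) (?F i)
      = shifted U w (?F i)" for i
    by (rule bmfun_eqI) (simp add: blinfun.diff_left algebra_simps)
  ultimately have "(\<lambda>i. shifted U w (?F i)) \<longlonglongrightarrow> g" by simp
  then have "(\<lambda>i. resolvent U w (shifted U w (?F i))) \<longlonglongrightarrow> resolvent U w g"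
    by (intro tendsto_intros)
  then have Fx: "?F \<longlonglongrightarrow> resolvent U w g" using wns by simp
  let ?x = "resolvent U w g"
  have nx: "norm ?x = 1" using tendsto_norm[OF Fx] nzF(3) by (simp add: LIMSEQ_const_iff)
  have "conv_vec ?x" by (rule conv_vec_resolvent_regulated[OF q(3) wns])
  moreover have ntop': "filterlim ?n at_top sequentially" by (rule filterlim_compose[OF ntop stop])
  ultimately have Tx: "(\<lambda>i. Ts (?n i) ?x) \<longlonglongrightarrow> T ?x"
    unfolding conv_vec_def by (rule filterlim_compose)
  have TF: "(\<lambda>i. (Ts (?n i) - T) (?F i - ?x)) \<longlonglongrightarrow> 0"
  proof (rule Lim_null_comparison)
    show "\<forall>\<^sub>F i in sequentially. norm ((Ts (?n i) - T) (?F i - ?x)) \<le> diff_bound * norm (?F i - ?x)"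
      using eventually_compose_filterlim[OF eventually_norm_diff ntop']
      by eventually_elim (rule order_trans[OF norm_blinfun mult_right_mono], auto)
    show "(\<lambda>i. diff_bound * norm (?F i - ?x)) \<longlonglongrightarrow> 0"
      using tendsto_mult_right_zero[OF tendsto_norm_zero[OF LIM_zero[OF Fx]]] .
  qed
  have "g = 0"
  proof (rule LIMSEQ_unique)
    show "(\<lambda>i. (T - Ts (?n i)) (?F i)) \<longlonglongrightarrow> g" using q(2) by (simp add: s_def)
    have "(\<lambda>i. - ((Ts (?n i) - T) (?F i - ?x)) - (Ts (?n i) ?x - T ?x)) \<longlonglongrightarrow> - 0 - 0"
      by (intro tendsto_diff tendsto_minus TF LIM_zero[OF Tx])
    then show "(\<lambda>i. (T - Ts (?n i)) (?F i)) \<longlonglongrightarrow> 0"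
      by (simp add: blinfun.diff_left blinfun.diff_right algebra_simps)
  qed
  then show False using nx by simp
qed

lemma eventually_resolvent:
  assumes "compact K" "K \<inter> op_spectrum U = {}"
  shows "\<exists>B. \<forall>\<^sub>F n in sequentially. K \<inter> op_spectrum (Us n) = {} \<and>
    (\<forall>z\<in>K. norm (resolvent (Us n) z) \<le> B)"
proof -
  obtain c where c: "0 < c"
      "\<forall>\<^sub>F n in sequentially. \<forall>z\<in>K. bounded_below c (shifted (Us n) z)"
    using uniformly_bounded_below[OF assms] by blast
  have "\<forall>\<^sub>F n in sequentially. K \<inter> op_spectrum (Us n) = {} \<and>
    (\<forall>z\<in>K. norm (resolvent (Us n) z) \<le> 1 / c)"
    using c(2) eventually_kernel_measure
  proof eventually_elim
    case (elim n)
    have "z \<notin> op_spectrum (Us n)" if "z \<in> K" for z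
      using elim(1) that c(1)
      by (intro notin_spectrum_if_bounded_below[OF kernel_measure.mem_closure_resolvent_set[OF elim(2)]]) auto
    then show ?case using elim(1) c(1) resolvent(2) by (auto intro!: norm_inverse_le)
  qed
  then show ?thesis by blast
qed

text \<open>By the resolvent identity \<open>R\<^sub>n(z) F - R(z) F = - R\<^sub>n(z) (Ts n - T) R(z) F\<close>. The resolvents \<open>R\<^sub>n(z)\<close> are bounded on the
  circle, and the vectors \<open>R(z) F\<close> form a compact set, on which pointwise convergence is uniform.\<close>

lemma circle_projection_tendsto:
  assumes r: "0 < r" and s: "sphere c r \<inter> op_spectrum U = {}"
    and conv: "\<And>z. z \<in> sphere c r \<Longrightarrow> conv_vec (resolvent U z F)"
  shows "(\<lambda>n. circle_projection (Us n) c r F) \<longlonglongrightarrow> circle_projection U c r F"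
proof (rule metric_LIMSEQ_I)
  fix \<epsilon> :: real assume "0 < \<epsilon>"
  obtain B where B: "\<forall>\<^sub>F n in sequentially. sphere c r \<inter> op_spectrum (Us n) = {} \<and>
      (\<forall>z\<in>sphere c r. norm (resolvent (Us n) z) \<le> B)"
    using eventually_resolvent[OF compact_sphere s] by blast
  let ?B = "\<bar>B\<bar> + 1"
  define t where "t = \<epsilon> / 2 / (r * ?B)"
  have rB: "0 < r * ?B" using r by (intro mult_pos_pos) auto
  have t: "0 < t" "r * (?B * t) = \<epsilon> / 2"
  proof -
    show "0 < t" using rB \<open>0 < \<epsilon>\<close> by (simp add: t_def)
    have "x * (y / x) = y" if "0 < x" for x y :: real using that by simp
    from this[OF rB] have "(r * ?B) * t = \<epsilon> / 2" unfolding t_def .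
    then show "r * (?B * t) = \<epsilon> / 2" by (simp only: mult.assoc)
  qed
  have "continuous_on (sphere c r) (\<lambda>z. resolvent U z F)"
    using s by (intro continuous_intros continuous_on_subset[OF continuous_on_resolvent]) auto
  then have "compact ((\<lambda>z. resolvent U z F) ` sphere c r)"
    by (rule compact_continuous_image) (rule compact_sphere)
  then have "\<forall>\<^sub>F n in sequentially. \<forall>G\<in>(\<lambda>z. resolvent U z F) ` sphere c r. norm ((Ts n - T) G) \<le> t"
    by (rule uniform_conv_on_compact) (use conv t in auto)
  then have "\<forall>\<^sub>F n in sequentially. dist (circle_projection (Us n) c r F) (circle_projection U c r F) < \<epsilon>"
    using B
  proof eventually_elim
    case (elim n)
    have "norm (resolvent (Us n) z F - resolvent U z F) \<le> ?B * t" if z: "z \<in> sphere c r" for z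
    proof -
      have ns: "z \<notin> op_spectrum U" "z \<notin> op_spectrum (Us n)" using z s elim(2) by auto
      let ?x = "resolvent U z F"
      have "shifted (Us n) z ?x = F + (Ts n - T) ?x"
      proof -
        have "shifted (Us n) z ?x = shifted U z ?x + (Ts n - T) ?x" by (simp add: blinfun.diff_left)
        then show ?thesis using ns by simp
      qed
      then have "?x = resolvent (Us n) z (F + (Ts n - T) ?x)" using ns by (metis resolvent_eqI)
      then have "resolvent (Us n) z F - ?x = - resolvent (Us n) z ((Ts n - T) ?x)"
        unfolding blinfun.add_right by (metis add_diff_cancel_left' minus_diff_eq)
      then have "norm (resolvent (Us n) z F - ?x) \<le> norm (resolvent (Us n) z) * norm ((Ts n - T) ?x)"
        by (simp add: norm_blinfun)
      also have "\<dots> \<le> ?B * t"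
        using elim z by (intro mult_mono) (auto intro: order_trans[of _ B])
      finally show ?thesis .
    qed
    then have "norm (circle_projection (Us n) c r F - circle_projection U c r F) \<le> r * (?B * t)"
      using elim(2) s r by (intro norm_circle_projection_diff_le) auto
    then show ?case using t \<open>0 < \<epsilon>\<close> by (simp add: dist_norm)
  qed
  then show "\<exists>N. \<forall>n\<ge>N. dist (circle_projection (Us n) c r F) (circle_projection U c r F) < \<epsilon>"
    by (simp add: eventually_sequentially)
qed

text \<open>The part of the closure of \<open>V\<close> outside the disc meets the spectrum of \<open>U\<close> nowhere; the
  uniform bound of the spectra reduces it to a compact set.\<close>

lemma eventually_spectrum_subset_ball:
  assumes "V \<inter> op_spectrum U = {l}" "frontier V \<inter> op_spectrum U = {}" "0 < \<epsilon>"
  shows "\<forall>\<^sub>F n in sequentially. V \<inter> op_spectrum (Us n) \<subseteq> ball l \<epsilon>"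
proof -
  let ?K = "(closure V - ball l \<epsilon>) \<inter> cball 0 (3 * (4 * M / a))"
  have "compact ?K" by (intro closed_Int_compact closed_Diff) auto
  moreover have "?K \<inter> op_spectrum U = {}"
  proof -
    have "z \<in> ball l \<epsilon>" if z: "z \<in> closure V" "z \<in> op_spectrum U" for z
    proof -
      have "z \<in> V" using z assms(2) closure_Un_frontier[of V] by blast
      then have "z = l" using z(2) assms(1) by blast
      then show ?thesis using \<open>0 < \<epsilon>\<close> by simp
    qed
    then show ?thesis by blast
  qed
  ultimately obtain B where "\<forall>\<^sub>F n in sequentially. ?K \<inter> op_spectrum (Us n) = {} \<and>
      (\<forall>z\<in>?K. norm (resolvent (Us n) z) \<le> B)"
    using eventually_resolvent by blast
  then show ?thesis using eventually_norm_Ts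
  proof eventually_elim
    case (elim n)
    show ?case
    proof
      fix z assume z: "z \<in> V \<inter> op_spectrum (Us n)"
      then have "cmod z \<le> 3 * (4 * M / a)"
        using norm_le_of_mem_op_spectrum[of z "Us n"] elim(2) by simp
      then show "z \<in> ball l \<epsilon>" using elim(1) z closure_subset[of V] by auto
    qed
  qed
qed

lemma eventually_spectral_circle:
  assumes V: "V \<inter> op_spectrum U = {l}" "frontier V \<inter> op_spectrum U = {}"
    and \<epsilon>: "0 < \<epsilon>" "cball l \<epsilon> \<subseteq> V"
  shows "\<forall>\<^sub>F n in sequentially. sphere l \<epsilon> \<inter> op_spectrum (Us n) = {} \<and>
    ball l \<epsilon> \<inter> op_spectrum (Us n) = V \<inter> op_spectrum (Us n) \<and> op_spectrum (Us n) \<subseteq> \<real>"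
proof -
  have "sphere l \<epsilon> \<inter> op_spectrum U = {}"
    using V \<epsilon> by (force simp: dist_norm)
  then obtain B where B: "\<forall>\<^sub>F n in sequentially. sphere l \<epsilon> \<inter> op_spectrum (Us n) = {} \<and>
      (\<forall>z\<in>sphere l \<epsilon>. norm (resolvent (Us n) z) \<le> B)"
    using eventually_resolvent[OF compact_sphere] by blast
  show ?thesis
    using B eventually_spectrum_subset_ball[OF V \<epsilon>(1)] eventually_kernel_measure
  proof eventually_elim
    case (elim n)
    then show ?case using \<epsilon>(2) ball_subset_cball[of l \<epsilon>] kernel_measure.op_spectrum_real[OF elim(3)]
      by auto
  qed
qed

text \<open>The circle projections of \<open>F\<close> tend to \<open>F \<noteq> 0\<close>, but vanish when there is no spectrum inside the circle.\<close>

lemma eventually_spectrum_meets: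
  assumes V: "V \<inter> op_spectrum U = {l}" "frontier V \<inter> op_spectrum U = {}"
    and \<epsilon>: "0 < \<epsilon>" "cball l \<epsilon> \<subseteq> V"
    and F: "F \<noteq> 0" "T F = scaleC_bmfun l F"
    and conv: "\<And>z. z \<in> sphere l \<epsilon> \<Longrightarrow> conv_vec (resolvent U z F)"
  shows "\<forall>\<^sub>F n in sequentially. V \<inter> op_spectrum (Us n) \<noteq> {}"
proof -
  have s: "sphere l \<epsilon> \<inter> op_spectrum U = {}"
    using V \<epsilon> by (force simp: dist_norm)
  have "circle_projection U l \<epsilon> F = F"
    by (rule circle_projection_eigenvector[OF \<epsilon>(1) s _ F(2)]) (use \<epsilon>(1) in simp)
  then have "(\<lambda>n. circle_projection (Us n) l \<epsilon> F) \<longlonglongrightarrow> F"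
    using circle_projection_tendsto[OF \<epsilon>(1) s conv] by simp
  then have "\<forall>\<^sub>F n in sequentially. circle_projection (Us n) l \<epsilon> F \<noteq> 0"
    using F(1) by (rule tendsto_imp_eventually_ne)
  then show ?thesis using eventually_spectral_circle[OF V \<epsilon>]
  proof eventually_elim
    case (elim n)
    show ?case
    proof
      assume "V \<inter> op_spectrum (Us n) = {}"
      then have "cball l \<epsilon> \<inter> op_spectrum (Us n) = {}" using \<epsilon>(2) by blast
      then show False using elim(1) circle_projection_eq_0[OF \<epsilon>(1)] by force
    qed
  qed
qed

end

section \<open>Almost sure convergence of empirical averages\<close>

text \<open>Hoeffding's inequality makes the probabilities of an \<open>\<epsilon>\<close>-deviation decay geometrically, so the
  Borel-Cantelli lemma applies.\<close>

lemma strong_law_bounded: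
  fixes X :: "nat \<Rightarrow> 'w \<Rightarrow> 'a::topological_space" and g :: "'a \<Rightarrow> real"
  assumes "prob_space P" and indep: "prob_space.indep_vars P (\<lambda>_. borel) X {1..}"
    and distr: "\<And>i. 1 \<le> i \<Longrightarrow> distr P borel (X i) = \<mu>"
    and g [measurable]: "g \<in> borel_measurable borel" and B: "\<And>x. \<bar>g x\<bar> \<le> B"
  shows "AE w in P. (\<lambda>n. (\<Sum>i=1..n. g (X i w)) / n) \<longlonglongrightarrow> (\<integral>x. g x \<partial>\<mu>)"
proof -
  interpret P: prob_space P by fact
  define I where "I = (\<integral>x. g x \<partial>\<mu>)"
  define b where "b = B + 1"
  have b: "0 < b" using B[of undefined] by (simp add: b_def)
  have rv [measurable]: "X i \<in> measurable P borel" if "1 \<le> i" for i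
    using indep that unfolding P.indep_vars_def by auto
  have X1: "X 1 \<in> measurable P borel" by (rule rv) simp
  have iid: "Hoeffding_ineq_iid P {1..n} (\<lambda>i w. g (X i w)) (\<lambda>w. g (X 1 w)) (- b) b" for n
  proof (intro Hoeffding_ineq_iid.intro iid_interval_bounded_random_variables.intro
      iid_interval_bounded_random_variables_axioms.intro)
    show "P.indep_vars (\<lambda>_. borel) (\<lambda>i w. g (X i w)) {1..n}"
      by (rule P.indep_vars_compose2[OF P.indep_vars_subset[OF indep]]) auto
    show "distr P borel (\<lambda>w. g (X i w)) = distr P borel (\<lambda>w. g (X 1 w))" if "i \<in> {1..n}" for i
    proof -
      have "distr P borel (\<lambda>w. g (X i w)) = distr (distr P borel (X i)) borel g"
        using that rv[of i] by (subst distr_distr) (auto simp: o_def)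
      also have "\<dots> = distr (distr P borel (X 1)) borel g" using that distr[of i] distr[of 1] by simp
      also have "\<dots> = distr P borel (\<lambda>w. g (X 1 w))"
        using X1 by (subst distr_distr) (auto simp: o_def)
      finally show ?thesis .
    qed
    show "(\<lambda>w. g (X 1 w)) \<in> borel_measurable P" using X1 by measurable
    show "AE w in P. g (X 1 w) \<in> {- b..b}"
    proof (rule AE_I2)
      fix w
      show "g (X 1 w) \<in> {- b..b}" using B[of "X 1 w"] by (simp add: b_def abs_le_iff)
    qed
  qed (auto intro: P.prob_space_axioms)
  have mean: "P.expectation (\<lambda>w. g (X 1 w)) = I"
    unfolding I_def distr[of 1, simplified, symmetric] using X1 by (subst integral_distr) auto
  have "AE w in P. \<forall>\<^sub>F n in sequentially. \<bar>(\<Sum>i=1..n. g (X i w)) / n - I\<bar> < \<epsilon>" if "0 < \<epsilon>" for \<epsilon>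
  proof -
    define A where "A n = {w \<in> space P. \<bar>(\<Sum>i=1..n. g (X i w)) / real n - I\<bar> \<ge> \<epsilon>}" for n
    define q where "q = exp (- 2 * \<epsilon>\<^sup>2 / (b - - b)\<^sup>2)"
    have q: "0 \<le> q" "q < 1" using \<open>0 < \<epsilon>\<close> b by (auto simp: q_def)
    have meas: "A n \<in> sets P" for n
    proof -
      have [measurable]: "(\<lambda>w. \<Sum>i=1..n. g (X i w)) \<in> borel_measurable P"
        using rv by (intro borel_measurable_sum) (auto intro!: measurable_compose[OF _ g])
      show ?thesis unfolding A_def by measurable
    qed
    have le: "P.prob (A n) \<le> 2 * q ^ n" if "1 \<le> n" for n
    proof -
      interpret H: Hoeffding_ineq_iid P "{1..n}" "\<lambda>i w. g (X i w)" "\<lambda>w. g (X 1 w)" "- b" b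
        "P.expectation (\<lambda>w. g (X 1 w))" by (rule iid)
      have "P.prob (A n) \<le> 2 * exp (- 2 * real n * \<epsilon>\<^sup>2 / (b - - b)\<^sup>2)"
        using H.Hoeffding_ineq_abs_ge'[of \<epsilon>] \<open>0 < \<epsilon>\<close> b that unfolding mean A_def by simp
      also have "exp (- 2 * real n * \<epsilon>\<^sup>2 / (b - - b)\<^sup>2) = q ^ n"
        unfolding q_def exp_of_nat_mult[symmetric] by (simp add: mult_ac)
      finally show ?thesis .
    qed
    have "summable (\<lambda>n. P.prob (A n))"
    proof (rule summable_comparison_test)
      show "\<exists>N. \<forall>n\<ge>N. norm (P.prob (A n)) \<le> 2 * q ^ n" using le by auto
      show "summable (\<lambda>n. 2 * q ^ n)" using q by (intro summable_mult summable_geometric) auto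
    qed
    then have "AE w in P. \<forall>\<^sub>F n in sequentially. w \<in> space P - A n"
      by (intro borel_cantelli_AE1 meas) (auto simp: P.emeasure_eq_measure)
    then show ?thesis
      by eventually_elim (auto simp: A_def elim!: eventually_mono)
  qed
  then have "AE w in P. \<forall>m::nat. \<forall>\<^sub>F n in sequentially. \<bar>(\<Sum>i=1..n. g (X i w)) / n - I\<bar> < 1 / real (Suc m)"
    by (subst AE_all_countable) simp
  then show ?thesis unfolding I_def[symmetric]
  proof eventually_elim
    case (elim w)
    show ?case
    proof (rule tendstoI)
      fix \<epsilon> :: real assume "0 < \<epsilon>"
      then obtain m where m: "1 / real (Suc m) < \<epsilon>"
        using nat_approx_posE by blast
      show "\<forall>\<^sub>F n in sequentially. dist ((\<Sum>i=1..n. g (X i w)) / n) I < \<epsilon>"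
        using elim[rule_format, of m] by eventually_elim (use m in \<open>simp add: dist_real_def\<close>)
    qed
  qed
qed

text \<open>The functions \<open>kdelta\<close>, being suprema over uncountable balls, are only measurable for the completion. Such
  a function agrees with a Borel function off a null set, which almost surely no sample point hits.\<close>

lemma strong_law_bounded_completion:
  fixes X :: "nat \<Rightarrow> 'w \<Rightarrow> 'a::topological_space" and g :: "'a \<Rightarrow> real"
  assumes P: "prob_space P" and indep: "prob_space.indep_vars P (\<lambda>_. borel) X {1..}"
    and distr: "\<And>i. 1 \<le> i \<Longrightarrow> distr P borel (X i) = \<mu>"
    and g: "g \<in> borel_measurable (completion \<mu>)" and B: "\<And>x. \<bar>g x\<bar> \<le> B"
  shows "AE w in P. (\<lambda>n. (\<Sum>i=1..n. g (X i w)) / n) \<longlonglongrightarrow> (\<integral>x. g x \<partial>completion \<mu>)"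
proof -
  interpret P: prob_space P by fact
  have sets: "sets \<mu> = sets borel" using distr[of 1, symmetric] by simp
  obtain g0 where g0: "g0 \<in> borel_measurable \<mu>" "AE x in \<mu>. g x = g0 x"
    using completion_ex_borel_measurable_real[OF g] by blast
  define g' where "g' x = max (- B) (min B (g0 x))" for x
  have "0 \<le> B" using B[of undefined] by linarith
  have g'm: "g' \<in> borel_measurable \<mu>" unfolding g'_def using g0(1) by measurable
  then have g'b: "g' \<in> borel_measurable borel" using measurable_cong_sets[OF sets refl] by blast
  have ae: "AE x in \<mu>. g x = g' x"
    using g0(2)
  proof eventually_elim
    case (elim x)
    then show ?case using B[of x] by (simp add: g'_def)
  qed
  have rv: "X i \<in> measurable P borel" if "1 \<le> i" for i
    using indep that unfolding P.indep_vars_def by auto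
  have "AE w in P. g (X i w) = g' (X i w)" if "1 \<le> i" for i
    by (rule AE_distrD[OF rv[OF that]]) (subst distr[OF that], rule ae)
  then have "AE w in P. \<forall>i. 1 \<le> i \<longrightarrow> g (X i w) = g' (X i w)"
    by (subst AE_all_countable) auto
  moreover have "AE w in P. (\<lambda>n. (\<Sum>i=1..n. g' (X i w)) / n) \<longlonglongrightarrow> (\<integral>x. g' x \<partial>\<mu>)"
    by (rule strong_law_bounded[OF P indep distr g'b, of B]) (use \<open>0 \<le> B\<close> in \<open>auto simp: g'_def\<close>)
  moreover have "(\<integral>x. g x \<partial>completion \<mu>) = (\<integral>x. g' x \<partial>\<mu>)"
  proof -
    have "(\<integral>x. g x \<partial>completion \<mu>) = (\<integral>x. g' x \<partial>completion \<mu>)"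
      using g g'm AE_completion[OF ae] by (intro integral_cong_AE) (auto intro: measurable_completion)
    also have "\<dots> = (\<integral>x. g' x \<partial>\<mu>)" by (rule integral_completion[OF g'm])
    finally show ?thesis .
  qed
  ultimately show ?thesis
  proof (elim AE_mp, intro AE_I2 impI)
    fix w assume w: "\<forall>i. 1 \<le> i \<longrightarrow> g (X i w) = g' (X i w)"
      and l: "(\<lambda>n. (\<Sum>i=1..n. g' (X i w)) / real n) \<longlonglongrightarrow> (\<integral>x. g' x \<partial>\<mu>)"
      and eq: "(\<integral>x. g x \<partial>completion \<mu>) = (\<integral>x. g' x \<partial>\<mu>)"
    have "(\<Sum>i=1..n. g (X i w)) = (\<Sum>i=1..n. g' (X i w))" for n
      using w by (intro sum.cong) auto
    then show "(\<lambda>n. (\<Sum>i=1..n. g (X i w)) / real n) \<longlonglongrightarrow> (\<integral>x. g x \<partial>completion \<mu>)"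
      using l eq by simp
  qed
qed

lemma prob_space_empirical: "1 \<le> n \<Longrightarrow> prob_space (empirical X n w)"
  unfolding empirical_def
  by (intro prob_space.prob_space_distr prob_space_uniform_count_measure)
    (auto simp: measurable_def sets_uniform_count_measure space_uniform_count_measure)

lemma sets_empirical [simp]: "sets (empirical X n w) = sets borel"
  by (simp add: empirical_def)

lemma finite_borel_discretization:
  fixes C :: "'a::metric_space set"
  assumes "finite C" "C \<noteq> {}"
  shows "\<exists>p. range p \<subseteq> C \<and> (\<forall>y. {x. p x = y} \<in> sets borel) \<and>
    (\<forall>x \<in> (\<Union>c\<in>C. ball c \<delta>). x \<in> ball (p x) \<delta>)"
  using assms
proof (induction rule: finite_ne_induct)
  case (singleton c)
  show ?case by (intro exI[of _ "\<lambda>_. c"]) auto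
next
  case (insert c C)
  from insert.IH obtain p where p: "range p \<subseteq> C" "\<forall>y. {x. p x = y} \<in> sets borel"
    "\<forall>x \<in> (\<Union>c\<in>C. ball c \<delta>). x \<in> ball (p x) \<delta>" by blast
  let ?q = "\<lambda>x. if x \<in> ball c \<delta> then c else p x"
  have "{x. ?q x = y} \<in> sets borel" for y
  proof -
    have "{x. ?q x = y} = (if y = c then ball c \<delta> else {}) \<union> ({x. p x = y} - ball c \<delta>)" by auto
    also have "\<dots> \<in> sets borel" using p(2) by auto
    finally show ?thesis .
  qed
  moreover have "range ?q \<subseteq> insert c C" using p(1) by auto
  moreover have "x \<in> ball (?q x) \<delta>" if "x \<in> (\<Union>c\<in>insert c C. ball c \<delta>)" for x
    using that p(3) by (cases "x \<in> ball c \<delta>") auto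
  ultimately show ?case by blast
qed

section \<open>The sampled operators\<close>

text \<open>The centre maps \<open>p j\<close> belong to the parameters so that one choice serves all samples and all statements.\<close>

locale iid_kernel_sample = kernel_measure \<mu> k a M + sample: prob_space P
  for \<mu> :: "'a::metric_space measure" and k and a M :: real and P :: "'w measure" +
  fixes X :: "nat \<Rightarrow> 'w \<Rightarrow> 'a" and \<eta> :: real and \<omega> :: "ennreal \<Rightarrow> real" and p :: "nat \<Rightarrow> 'a \<Rightarrow> 'a"
  assumes compact_UNIV: "compact (UNIV :: 'a set)"
    and gap: "0 < \<eta>" "\<And>x. a + \<eta> \<le> deg k \<mu> x"
    and indep: "sample.indep_vars (\<lambda>_. borel) X {1..}"
    and law: "\<And>i. 1 \<le> i \<Longrightarrow> distr P borel (X i) = \<mu>"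
    and \<omega>_tendsto: "(\<omega> \<longlongrightarrow> 0) (at 0)"
    and kdelta_integrable: "\<And>x \<delta>. 0 < \<delta> \<Longrightarrow> integrable (completion \<mu>) (kdelta k \<delta> x)"
    and kdelta_le: "\<And>x \<delta>. 0 < \<delta> \<Longrightarrow> (\<integral>z. kdelta k \<delta> x z \<partial>completion \<mu>) \<le> \<omega> (ennreal \<delta>)"
    and p_finite: "\<And>j. finite (range (p j))"
    and p_measurable: "\<And>j y. {x. p j x = y} \<in> sets borel"
    and p_ball: "\<And>j x. x \<in> ball (p j x) (1 / real (Suc j))"
begin

abbreviation "emp w n \<equiv> empirical X n w"

text \<open>The summand \<open>1 / Suc j\<close> leaves room between the expectation of \<open>kdelta\<close> and its empirical averages.\<close>

definition e :: "nat \<Rightarrow> real"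
  where "e j = \<omega> (ennreal (1 / real (Suc j))) + 1 / real (Suc j)"

lemma \<omega>_ennreal_tendsto: "(\<lambda>j. \<omega> (ennreal (1 / real (Suc j)))) \<longlonglongrightarrow> 0"
proof (rule filterlim_compose[OF \<omega>_tendsto])
  have "(\<lambda>j. ennreal (1 / real (Suc j))) \<longlonglongrightarrow> ennreal 0"
    by (rule tendsto_ennrealI[OF one_over_Suc_tendsto])
  then show "filterlim (\<lambda>j. ennreal (1 / real (Suc j))) (at 0) sequentially"
    unfolding filterlim_at by (auto simp: ennreal_eq_0_iff)
qed

lemma e_tendsto: "e \<longlonglongrightarrow> 0"
  using tendsto_add[OF \<omega>_ennreal_tendsto one_over_Suc_tendsto] by (simp add: e_def[abs_def])

lemma abs_k_diff_le: "\<bar>k x z - k y z\<bar> \<le> M"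
  using k_nonneg[of x z] k_nonneg[of y z] k_le[of x z] k_le[of y z] by linarith

lemma abs_k_diff_le_kdelta: "y \<in> ball x \<delta> \<Longrightarrow> \<bar>k x z - k y z\<bar> \<le> kdelta k \<delta> x z"
  unfolding kdelta_def using abs_k_diff_le by (intro cSUP_upper bdd_aboveI2)

lemma abs_kdelta_le: assumes "0 < \<delta>" shows "\<bar>kdelta k \<delta> x z\<bar> \<le> M"
proof -
  have "0 \<le> kdelta k \<delta> x z" using abs_k_diff_le_kdelta[of x x \<delta> z] assms by simp
  moreover have "kdelta k \<delta> x z \<le> M"
    unfolding kdelta_def using abs_k_diff_le assms by (intro cSUP_least) auto
  ultimately show ?thesis by simp
qed

lemma oscillation_le_\<omega>:
  assumes "x \<in> ball c \<delta>" "0 < \<delta>"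
  shows "(\<integral>y. \<bar>k x y - k c y\<bar> \<partial>\<mu>) \<le> \<omega> (ennreal \<delta>)"
proof -
  have m: "(\<lambda>y. \<bar>k x y - k c y\<bar>) \<in> borel_measurable \<mu>" by measurable
  have "(\<integral>y. \<bar>k x y - k c y\<bar> \<partial>\<mu>) = (\<integral>y. \<bar>k x y - k c y\<bar> \<partial>completion \<mu>)"
    by (rule integral_completion[OF m, symmetric])
  also have "\<dots> \<le> (\<integral>y. kdelta k \<delta> c y \<partial>completion \<mu>)"
  proof (rule integral_mono[OF _ kdelta_integrable[OF assms(2)]])
    show "integrable (completion \<mu>) (\<lambda>y. \<bar>k x y - k c y\<bar>)"
      by (subst integrable_completion[OF m]) simp
    show "\<bar>k x y - k c y\<bar> \<le> kdelta k \<delta> c y" for y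
      using abs_k_diff_le_kdelta[OF assms(1), of y] by (simp add: abs_minus_commute)
  qed
  also have "\<dots> \<le> \<omega> (ennreal \<delta>)" by (rule kdelta_le[OF assms(2)])
  finally show ?thesis .
qed

lemma AE_average:
  fixes f :: "'a \<Rightarrow> real"
  assumes "f \<in> borel_measurable borel" "\<And>x. \<bar>f x\<bar> \<le> B"
  shows "AE w in P. (\<lambda>n. \<integral>y. f y \<partial>emp w n) \<longlonglongrightarrow> (\<integral>y. f y \<partial>\<mu>)"
  using strong_law_bounded[where g = f and B = B, OF sample.prob_space_axioms indep law assms]
  by (simp add: integral_empirical[OF assms(1)])

lemma AE_oscillation:
  "AE w in P. \<forall>j. \<forall>\<^sub>F n in sequentially. \<forall>x. (\<integral>y. \<bar>k x y - k (p j x) y\<bar> \<partial>emp w n) \<le> e j"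
proof (subst AE_all_countable, rule allI)
  fix j
  let ?d = "1 / real (Suc j)" and ?I = "\<lambda>c. \<integral>y. kdelta k (1 / real (Suc j)) c y \<partial>completion \<mu>"
  have d: "0 < ?d" by simp
  have "AE w in P. (\<lambda>n. (\<Sum>i=1..n. kdelta k ?d c (X i w)) / n) \<longlonglongrightarrow> ?I c" for c
    by (rule strong_law_bounded_completion[OF sample.prob_space_axioms indep law
          borel_measurable_integrable[OF kdelta_integrable[OF d]] abs_kdelta_le[OF d]])
  then have "AE w in P. \<forall>c\<in>range (p j). (\<lambda>n. (\<Sum>i=1..n. kdelta k ?d c (X i w)) / n) \<longlonglongrightarrow> ?I c"
    by (subst AE_ball_countable) (auto simp: countable_finite[OF p_finite])
  then show "AE w in P. \<forall>\<^sub>F n in sequentially. \<forall>x. (\<integral>y. \<bar>k x y - k (p j x) y\<bar> \<partial>emp w n) \<le> e j"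
  proof eventually_elim
    case (elim w)
    have "\<forall>\<^sub>F n in sequentially. (\<Sum>i=1..n. kdelta k ?d c (X i w)) / n < e j" if "c \<in> range (p j)" for c
    proof (rule order_tendstoD(2))
      show "(\<lambda>n. (\<Sum>i=1..n. kdelta k ?d c (X i w)) / n) \<longlonglongrightarrow> ?I c" using elim that by blast
      show "?I c < e j" using kdelta_le[OF d, of c] d unfolding e_def by linarith
    qed
    then have "\<forall>\<^sub>F n in sequentially. \<forall>c\<in>range (p j). (\<Sum>i=1..n. kdelta k ?d c (X i w)) / n < e j"
      by (intro eventually_ball_finite p_finite) blast
    then show ?case
    proof eventually_elim
      case (elim n)
      show ?case
      proof
        fix x
        have "(\<integral>y. \<bar>k x y - k (p j x) y\<bar> \<partial>emp w n) = (\<Sum>i=1..n. \<bar>k x (X i w) - k (p j x) (X i w)\<bar>) / n"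
          by (rule integral_empirical) measurable
        also have "\<dots> \<le> (\<Sum>i=1..n. kdelta k ?d (p j x) (X i w)) / n"
          using abs_k_diff_le_kdelta[OF p_ball[of x j]]
          by (intro divide_right_mono sum_mono) (auto simp: abs_minus_commute)
        also have "\<dots> \<le> e j" using elim by (simp add: less_imp_le)
        finally show "(\<integral>y. \<bar>k x y - k (p j x) y\<bar> \<partial>emp w n) \<le> e j" .
      qed
    qed
  qed
qed

lemma AE_centres:
  assumes [measurable]: "f \<in> borel_measurable borel" and B: "\<And>x. \<bar>f x\<bar> \<le> B"
  shows "AE w in P. \<forall>j x. (\<lambda>n. \<integral>y. k (p j x) y * f y \<partial>emp w n) \<longlonglongrightarrow> (\<integral>y. k (p j x) y * f y \<partial>\<mu>)"
proof (subst AE_all_countable, rule allI)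
  fix j
  have "AE w in P. \<forall>c\<in>range (p j). (\<lambda>n. \<integral>y. k c y * f y \<partial>emp w n) \<longlonglongrightarrow> (\<integral>y. k c y * f y \<partial>\<mu>)"
  proof (subst AE_ball_countable)
    show "\<forall>c\<in>range (p j). AE w in P. (\<lambda>n. \<integral>y. k c y * f y \<partial>emp w n) \<longlonglongrightarrow> (\<integral>y. k c y * f y \<partial>\<mu>)"
    proof
      fix c
      have "\<bar>k c y * f y\<bar> \<le> M * B" for y
        unfolding abs_mult using B[of y] k_nonneg[of c y] k_le[of c y] M_nonneg by (intro mult_mono) auto
      then show "AE w in P. (\<lambda>n. \<integral>y. k c y * f y \<partial>emp w n) \<longlonglongrightarrow> (\<integral>y. k c y * f y \<partial>\<mu>)"
        by (intro AE_average[where B = "M * B"]) measurable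
    qed
  qed (simp add: countable_finite[OF p_finite])
  then show "AE w in P. \<forall>x. (\<lambda>n. \<integral>y. k (p j x) y * f y \<partial>emp w n) \<longlonglongrightarrow> (\<integral>y. k (p j x) y * f y \<partial>\<mu>)"
    by eventually_elim blast
qed

lemma AE_kernel_approximation: "AE w in P. kernel_approximation \<mu> k a M (emp w) p e \<eta>"
proof -
  have inv: "(\<lambda>y. 1 / deg k \<mu> y) \<in> borel_measurable borel" by measurable
  have ib: "\<bar>1 / deg k \<mu> y\<bar> \<le> 1 * (1 / a)" for y by (rule abs_divide_deg_le) simp
  have "AE w in P. \<forall>j x. (\<lambda>n. \<integral>y. k (p j x) y * 1 \<partial>emp w n) \<longlonglongrightarrow> (\<integral>y. k (p j x) y * 1 \<partial>\<mu>)"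
    by (rule AE_centres[where B = 1]) auto
  then show ?thesis using AE_oscillation AE_centres[OF inv ib]
  proof eventually_elim
    case (elim w)
    show ?case
    proof (intro kernel_approximation.intro kernel_measure_axioms kernel_approximation_axioms.intro)
      show "\<forall>\<^sub>F n in sequentially. prob_space (emp w n) \<and> sets (emp w n) = sets borel"
        using eventually_ge_at_top[of 1] by eventually_elim (simp add: prob_space_empirical)
      show "(\<integral>y. \<bar>k x y - k (p j x) y\<bar> \<partial>\<mu>) \<le> e j" for j x
      proof -
        have "(\<integral>y. \<bar>k x y - k (p j x) y\<bar> \<partial>\<mu>) \<le> \<omega> (ennreal (1 / real (Suc j)))"
          by (rule oscillation_le_\<omega>[OF p_ball]) simp
        moreover have "0 \<le> 1 / real (Suc j)" by simp
        ultimately show ?thesis unfolding e_def by linarith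
      qed
    qed (use gap p_finite p_measurable e_tendsto elim in auto)
  qed
qed

lemma AE_operator_real:
  "AE w in P. (\<lambda>n. Uop k (emp w n) f) \<longlonglongrightarrow> U f"
proof -
  have b: "\<bar>apply_bmfun f y\<bar> \<le> norm f" for y using norm_apply_bmfun_le[of f y] by simp
  have m: "(\<lambda>y. apply_bmfun f y / deg k \<mu> y) \<in> borel_measurable borel" by measurable
  have bm: "\<bar>apply_bmfun f y / deg k \<mu> y\<bar> \<le> norm f * (1 / a)" for y
    by (rule abs_divide_deg_le) (rule b)
  from AE_kernel_approximation AE_centres[OF measurable_apply_bmfun b] AE_centres[OF m bm]
  show ?thesis
  proof eventually_elim
    case (elim w)
    interpret kernel_approximation \<mu> k a M "emp w" p e \<eta> by (rule elim(1))
    show ?case by (rule Us_tendsto) (use elim(2,3) in \<open>auto simp only: centre_conv_def\<close>)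
  qed
qed

lemma AE_operator:
  "AE w in P. (\<lambda>n. complexify (Uop k (emp w n)) F) \<longlonglongrightarrow> complexify U F"
  using AE_kernel_approximation AE_operator_real[of "Re_bmfun F"] AE_operator_real[of "Im_bmfun F"]
proof eventually_elim
  case (elim w)
  interpret kernel_approximation \<mu> k a M "emp w" p e \<eta> by (rule elim(1))
  show ?case using conv_vec_complex[OF elim(2,3)] by (simp only: conv_vec_def)
qed

text \<open>The exceptional set depends on \<open>F\<close>, but not on \<open>z\<close>.\<close>

lemma AE_conv_resolvent:
  "AE w in P. \<forall>z. z \<notin> op_spectrum U \<longrightarrow>
    kernel_approximation.conv_vec \<mu> k (emp w) (resolvent U z F)"
proof -
  obtain Z where Z: "countable Z" "Z \<subseteq> - op_spectrum U" "- op_spectrum U \<subseteq> closure Z"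
    using separable[of "- op_spectrum U"] by blast
  have "AE w in P. \<forall>z\<in>Z. (\<lambda>n. complexify (Uop k (emp w n)) (resolvent U z F))
      \<longlonglongrightarrow> complexify U (resolvent U z F)"
    using AE_operator Z(1) by (subst AE_ball_countable) auto
  then show ?thesis using AE_kernel_approximation
  proof eventually_elim
    case (elim w)
    interpret kernel_approximation \<mu> k a M "emp w" p e \<eta> by (rule elim(2))
    show ?case
      using conv_vec_resolvent_dense[OF Z(2,3)] elim(1) unfolding conv_vec_def by blast
  qed
qed

lemma AE_spectral_approximation:
  "AE w in P. spectral_approximation \<mu> k a M (emp w) p e \<eta>"
proof -
  have "AE w in P. \<forall>j. \<forall>y\<in>range (p j). \<forall>z. z \<notin> op_spectrum U \<longrightarrow>
      kernel_approximation.conv_vec \<mu> k (emp w) (resolvent U z (indicator_bmfun {x. p j x = y}))"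
  proof (subst AE_all_countable, rule allI)
    fix j
    show "AE w in P. \<forall>y\<in>range (p j). \<forall>z. z \<notin> op_spectrum U \<longrightarrow>
      kernel_approximation.conv_vec \<mu> k (emp w) (resolvent U z (indicator_bmfun {x. p j x = y}))"
      by (subst AE_ball_countable[OF countable_finite[OF p_finite]], rule ballI, rule AE_conv_resolvent)
  qed
  then show ?thesis using AE_kernel_approximation
  proof eventually_elim
    case (elim w)
    then show ?case
      by (intro spectral_approximation.intro spectral_approximation_axioms.intro) auto
  qed
qed

text \<open>The function \<open>m\<close> is continuous on a compact space, so its range is closed.\<close>

lemma m_away:
  assumes "lam \<notin> range (\<lambda>x. complex_of_real (m x))"
  obtains d where "0 < d" "\<And>x. d \<le> cmod (complex_of_real (m x) - lam)"
proof -
  have "continuous_on UNIV m"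
    unfolding continuous_on_iff
  proof (intro ballI allI impI)
    fix x \<epsilon> assume "(0::real) < \<epsilon>"
    have "(\<lambda>j. lip * \<omega> (ennreal (1 / real (Suc j)))) \<longlonglongrightarrow> lip * 0"
      by (intro tendsto_intros \<omega>_ennreal_tendsto)
    then obtain j where j: "lip * \<omega> (ennreal (1 / real (Suc j))) < \<epsilon>"
      using order_tendstoD(2)[of _ "lip * 0" sequentially \<epsilon>] \<open>0 < \<epsilon>\<close>
        eventually_happens[of _ sequentially] by auto
    have "dist (m x') (m x) < \<epsilon>" if "dist x' x < 1 / real (Suc j)" for x'
    proof -
      have "(\<integral>y. \<bar>k x' y - k x y\<bar> \<partial>\<mu>) \<le> \<omega> (ennreal (1 / real (Suc j)))"
        using that by (intro oscillation_le_\<omega>) (auto simp: dist_commute)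
      then have "\<bar>m x' - m x\<bar> \<le> lip * \<omega> (ennreal (1 / real (Suc j)))"
        using lip_nonneg by (intro order_trans[OF abs_m_diff_le] mult_left_mono)
      then show ?thesis using j by (simp add: dist_real_def)
    qed
    then show "\<exists>d>0. \<forall>x'\<in>UNIV. dist x' x < d \<longrightarrow> dist (m x') (m x) < \<epsilon>"
      by (intro exI[of _ "1 / real (Suc j)"]) auto
  qed
  then have "compact (range (\<lambda>x. complex_of_real (m x)))"
    using compact_UNIV by (intro compact_continuous_image continuous_intros)
  then obtain d where "0 < d" "\<forall>z\<in>range (\<lambda>x. complex_of_real (m x)). d \<le> dist lam z"
    using separate_point_closed[OF compact_imp_closed assms] by blast
  then show ?thesis by (intro that[of d]) (auto simp: dist_norm norm_minus_commute)
qed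

context
  fixes lam :: complex and V :: "complex set"
  assumes off_range: "lam \<notin> range (\<lambda>x. complex_of_real (m x))"
    and eigenvalue: "op_eigenvalue U lam"
    and V: "open V" "V \<inter> op_spectrum U = {lam}" "frontier V \<inter> op_spectrum U = {}"
begin

lemma AE_spectrum_is_eigenvalue:
  "AE w in P. \<forall>\<^sub>F n in sequentially. \<forall>z \<in> op_spectrum (Uop k (emp w n)) \<inter> V.
    op_eigenvalue (Uop k (emp w n)) z"
proof -
  obtain d where d: "0 < d" "\<And>x. d \<le> cmod (complex_of_real (m x) - lam)"
    using m_away[OF off_range] by blast
  \<comment> \<open>One third each for the distance of \<open>z\<close> from \<open>lam\<close>, for the distance of \<open>m\<^sub>n\<close> from \<open>m\<close>, and for the remaining gap.\<close>
  have d3: "0 < d / 3" using d(1) by simp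
  have tri: "cmod (A - B - C) \<le> cmod A + cmod B + cmod C" for A B C
    using norm_triangle_ineq4[of "A - B" C] norm_triangle_ineq4[of A B] by linarith
  show ?thesis using AE_spectral_approximation
  proof eventually_elim
    case (elim w)
    interpret spectral_approximation \<mu> k a M "emp w" p e \<eta> by (rule elim)
    show ?case
      using eventually_spectrum_subset_ball[OF V(2,3) d3] uniform_m[OF d3] eventually_kernel_measure
        eventually_ge_at_top[of 1]
    proof eventually_elim
      case (elim n)
      interpret N: kernel_measure "emp w n" k a M by (rule elim(3))
      show ?case
      proof
        fix z assume z: "z \<in> op_spectrum N.U \<inter> V"
        then have zl: "cmod (lam - z) < d / 3" using elim(1) by (auto simp: dist_norm)
        have away: "d / 3 \<le> cmod (complex_of_real (N.m x) - z)" for x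
        proof -
          have "complex_of_real (m x) - lam =
              (complex_of_real (N.m x) - z) - complex_of_real (N.m x - m x) - (lam - z)" by simp
          then have "d \<le> cmod ((complex_of_real (N.m x) - z) - complex_of_real (N.m x - m x) - (lam - z))"
            using d(2)[of x] by simp
          also have "\<dots> \<le> cmod (complex_of_real (N.m x) - z) + \<bar>N.m x - m x\<bar> + cmod (lam - z)"
            unfolding norm_of_real[of "N.m x - m x", where 'a = complex, symmetric] by (rule tri)
          finally show ?thesis using elim(2)[rule_format, of x] zl by linarith
        qed
        show "op_eigenvalue N.U z"
        proof (rule N.eigenvalue_if_finite_support[OF _ _ _ d3 away])
          let ?A = "(\<lambda>i. X i w) ` {1..n}"
          show "(\<integral>y. f y \<partial>emp w n) \<le> (\<Sum>y\<in>?A. \<bar>f y\<bar>)" if "f \<in> borel_measurable borel" for f :: "'a \<Rightarrow> real"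
          proof -
            have "(\<Sum>i=1..n. f (X i w)) \<le> (\<Sum>i=1..n. \<Sum>y\<in>?A. \<bar>f y\<bar>)"
            proof (rule sum_mono)
              fix i assume "i \<in> {1..n}"
              then have "\<bar>f (X i w)\<bar> \<le> (\<Sum>y\<in>?A. \<bar>f y\<bar>)"
                by (intro member_le_sum[of _ _ "\<lambda>y. \<bar>f y\<bar>"]) auto
              then show "f (X i w) \<le> (\<Sum>y\<in>?A. \<bar>f y\<bar>)" by linarith
            qed
            also have "\<dots> = n * (\<Sum>y\<in>?A. \<bar>f y\<bar>)" by simp
            finally show ?thesis
              using elim(4) unfolding integral_empirical[OF that] by (simp add: field_simps)
          qed
        qed (use z in auto)
      qed
    qed
  qed
qed

lemma small_disc:
  obtains \<epsilon> where "0 < \<epsilon>" "cball lam \<epsilon> \<subseteq> V"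
proof -
  have "lam \<in> V" using V(2) by blast
  then show ?thesis using V(1) that open_contains_cball by blast
qed

lemma spectral_projection_limit:
  assumes \<epsilon>: "0 < \<epsilon>" "cball lam \<epsilon> \<subseteq> V"
  shows "sphere lam \<epsilon> \<inter> op_spectrum U = {}" "\<exists>!Pr. is_spectral_projection U V Pr"
    "spectral_projection U V = circle_projection U lam \<epsilon>"
proof -
  show s: "sphere lam \<epsilon> \<inter> op_spectrum U = {}" using V(2) \<epsilon> by (force simp: dist_norm)
  have b: "ball lam \<epsilon> \<inter> op_spectrum U = V \<inter> op_spectrum U"
  proof -
    have "lam \<in> ball lam \<epsilon>" "ball lam \<epsilon> \<subseteq> V" using \<epsilon> ball_subset_cball order_trans by auto
    moreover have "lam \<in> op_spectrum U" using V(2) by blast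
    ultimately show ?thesis using V(2) by (intro equalityI) (blast, simp)
  qed
  show "\<exists>!Pr. is_spectral_projection U V Pr" "spectral_projection U V = circle_projection U lam \<epsilon>"
    using spectral_projection_eq_circle[OF \<epsilon>(1) s b op_spectrum_real] by auto
qed

lemma AE_eigenvalues:
  "AE w in P.
    (\<forall>\<^sub>F n in sequentially. \<exists>z \<in> op_spectrum (Uop k (emp w n)) \<inter> V. op_eigenvalue (Uop k (emp w n)) z) \<and>
    (\<forall>z. (\<forall>\<^sub>F n in sequentially. z n \<in> op_spectrum (Uop k (emp w n)) \<inter> V \<and>
      op_eigenvalue (Uop k (emp w n)) (z n)) \<longrightarrow> z \<longlonglongrightarrow> lam)"
proof -
  obtain \<epsilon> where \<epsilon>: "0 < \<epsilon>" "cball lam \<epsilon> \<subseteq> V" by (rule small_disc)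
  obtain F where F: "F \<noteq> 0" "complexify U F = scaleC_bmfun lam F"
    using eigenvalue unfolding op_eigenvalue_def by blast
  show ?thesis
    using AE_spectral_approximation AE_spectrum_is_eigenvalue AE_conv_resolvent[of F]
  proof eventually_elim
    case (elim w)
    interpret spectral_approximation \<mu> k a M "emp w" p e \<eta> by (rule elim)
    have conv: "conv_vec (resolvent U z F)" if "z \<in> sphere lam \<epsilon>" for z
      using elim(3) spectral_projection_limit(1)[OF \<epsilon>] that by blast
    have "\<forall>\<^sub>F n in sequentially. V \<inter> op_spectrum (Us n) \<noteq> {}"
      by (rule eventually_spectrum_meets[OF V(2,3) \<epsilon> F conv])
    with elim(2) have "\<forall>\<^sub>F n in sequentially. \<exists>z \<in> op_spectrum (Us n) \<inter> V. op_eigenvalue (Us n) z"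
      by eventually_elim blast
    moreover have "z \<longlonglongrightarrow> lam"
      if z: "\<forall>\<^sub>F n in sequentially. z n \<in> op_spectrum (Us n) \<inter> V \<and> op_eigenvalue (Us n) (z n)" for z
    proof (rule tendstoI)
      fix t :: real assume "0 < t"
      from eventually_spectrum_subset_ball[OF V(2,3) this] z
      show "\<forall>\<^sub>F n in sequentially. dist (z n) lam < t"
        by eventually_elim (auto simp: dist_commute)
    qed
    ultimately show ?case by blast
  qed
qed

lemma AE_spectral_projections:
  assumes \<epsilon>: "0 < \<epsilon>" "cball lam \<epsilon> \<subseteq> V"
  shows "AE w in P. \<forall>\<^sub>F n in sequentially.
    (\<exists>!Pr. is_spectral_projection (Uop k (emp w n)) V Pr) \<and>
    spectral_projection (Uop k (emp w n)) V = circle_projection (Uop k (emp w n)) lam \<epsilon>"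
  using AE_spectral_approximation
proof eventually_elim
  case (elim w)
  interpret spectral_approximation \<mu> k a M "emp w" p e \<eta> by (rule elim)
  show ?case
    using eventually_spectral_circle[OF V(2,3) \<epsilon>]
  proof eventually_elim
    case (elim n)
    then have "sphere lam \<epsilon> \<inter> op_spectrum (Us n) = {}"
      "ball lam \<epsilon> \<inter> op_spectrum (Us n) = V \<inter> op_spectrum (Us n)" "op_spectrum (Us n) \<subseteq> \<real>"
      by auto
    from spectral_projection_eq_circle[OF \<epsilon>(1) this] show ?case by (rule conjI)
  qed
qed

lemma AE_spectral_projection_tendsto:
  "AE w in P. (\<lambda>n. norm (spectral_projection (Uop k (emp w n)) V F - spectral_projection U V F)) \<longlonglongrightarrow> 0"
proof -
  obtain \<epsilon> where \<epsilon>: "0 < \<epsilon>" "cball lam \<epsilon> \<subseteq> V" by (rule small_disc)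
  note lim = spectral_projection_limit[OF \<epsilon>]
  show ?thesis
    using AE_spectral_approximation AE_spectral_projections[OF \<epsilon>] AE_conv_resolvent[of F]
  proof eventually_elim
    case (elim w)
    interpret spectral_approximation \<mu> k a M "emp w" p e \<eta> by (rule elim)
    have conv: "conv_vec (resolvent U z F)" if "z \<in> sphere lam \<epsilon>" for z
      using elim(3) lim(1) that by blast
    have "(\<lambda>n. norm (circle_projection (Us n) lam \<epsilon> F - circle_projection U lam \<epsilon> F)) \<longlonglongrightarrow> 0"
      by (intro tendsto_norm_zero LIM_zero circle_projection_tendsto[OF \<epsilon>(1) lim(1) conv])
    then show ?case
      by (rule Lim_transform_eventually) (use elim(2) lim(3) in \<open>auto elim!: eventually_mono\<close>)
  qed
qed

end

end

theorem theorem2: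
  fixes P :: "'w measure" and \<mu> :: "'a::metric_space measure"
    and k :: "'a \<Rightarrow> 'a \<Rightarrow> real" and X :: "nat \<Rightarrow> 'w \<Rightarrow> 'a"
    and a M :: real and \<omega> :: "ennreal \<Rightarrow> real"
    and lam :: complex and V :: "complex set"
  assumes "prob_space P"
    and "compact (UNIV :: 'a set)"
    and "prob_space \<mu>" and "sets \<mu> = sets borel"
    and "(\<lambda>(x, y). k x y) \<in> borel_measurable (borel \<Otimes>\<^sub>M borel)"
    and "\<And>x y. k x y = k y x" and "\<And>x y. 0 \<le> k x y"
    and "prob_space.indep_vars P (\<lambda>_. borel) X {1..}"
    and "\<And>i. 1 \<le> i \<Longrightarrow> distr P borel (X i) = \<mu>"
    and "0 < a" and "a \<le> 1" and "1 \<le> M"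
    and "continuous_on UNIV \<omega>" and "mono \<omega>" and "(\<omega> \<longlongrightarrow> 0) (at 0)"
    and "bdd_above (range (\<lambda>(x, y). k x y))" and "(SUP (x, y). k x y) < M"
    and "a < (INF x. deg k \<mu> x)"
    and "\<And>x \<delta>. 0 < \<delta> \<Longrightarrow> integrable (completion \<mu>) (kdelta k \<delta> x)"
    and "\<And>x \<delta>. 0 < \<delta> \<Longrightarrow> (\<integral>z. kdelta k \<delta> x z \<partial>completion \<mu>) \<le> \<omega> (ennreal \<delta>)"
    and "lam \<notin> range (\<lambda>x. complex_of_real (mfun k \<mu> x))"
    and "op_eigenvalue (Uop k \<mu>) lam"
    and "open V" and "V \<inter> op_spectrum (Uop k \<mu>) = {lam}"
    and "frontier V \<inter> op_spectrum (Uop k \<mu>) = {}"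
  shows
    "(AE w in P. converges_compactly (\<lambda>n. Uop k (empirical X n w)) (Uop k \<mu>)) \<and>
     (AE w in P.
        (\<forall>\<^sub>F n in sequentially.
          \<exists>z \<in> op_spectrum (Uop k (empirical X n w)) \<inter> V.
            op_eigenvalue (Uop k (empirical X n w)) z) \<and>
        (\<forall>z. (\<forall>\<^sub>F n in sequentially. z n \<in> op_spectrum (Uop k (empirical X n w)) \<inter> V \<and>
            op_eigenvalue (Uop k (empirical X n w)) (z n)) \<longrightarrow> z \<longlonglongrightarrow> lam)) \<and>
     (\<exists>!Pr. is_spectral_projection (Uop k \<mu>) V Pr) \<and>
     (AE w in P. \<forall>\<^sub>F n in sequentially.
        \<exists>!Pr. is_spectral_projection (Uop k (empirical X n w)) V Pr) \<and>
     (\<forall>f. AE w in P.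
        (\<lambda>n. norm (spectral_projection (Uop k (empirical X n w)) V f
                  - spectral_projection (Uop k \<mu>) V f)) \<longlonglongrightarrow> 0)"
proof -
  let ?I = "INF x. deg k \<mu> x"
  have k_le: "k x y \<le> M" for x y
  proof -
    have "k x y \<le> (SUP (x, y). k x y)"
      using cSUP_upper[OF UNIV_I assms(16), of "(x, y)"] by simp
    then show ?thesis using assms(17) by simp
  qed
  have "0 \<le> deg k \<mu> x" for x
    unfolding deg_def using assms(7) by (intro integral_nonneg_AE) simp
  then have "?I \<le> deg k \<mu> x" for x by (intro cINF_lower bdd_belowI2) auto
  then have gap: "a + (?I - a) \<le> deg k \<mu> x" for x by simp
  have "\<exists>q :: 'a \<Rightarrow> 'a. finite (range q) \<and> (\<forall>y. {x. q x = y} \<in> sets borel) \<and> (\<forall>x. x \<in> ball (q x) (1 / real (Suc j)))"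
    for j
  proof -
    obtain C :: "'a set" where C: "finite C" "UNIV \<subseteq> (\<Union>c\<in>C. ball c (1 / real (Suc j)))"
      using seq_compact_imp_totally_bounded[OF compact_imp_seq_compact[OF assms(2)]]
      by (metis of_nat_0_less_iff zero_less_Suc zero_less_divide_1_iff)
    then have "C \<noteq> {}" by auto
    from finite_borel_discretization[OF C(1) this, of "1 / real (Suc j)"]
    obtain q where q: "range q \<subseteq> C" "\<forall>y. {x. q x = y} \<in> sets borel"
      "\<forall>x \<in> (\<Union>c\<in>C. ball c (1 / real (Suc j))). x \<in> ball (q x) (1 / real (Suc j))" by blast
    have "\<forall>x. x \<in> ball (q x) (1 / real (Suc j))" using q(3) C(2) by blast
    moreover have "finite (range q)" using q(1) C(1) by (rule finite_subset)
    ultimately show ?thesis using q(2) by (intro exI[of _ q] conjI)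
  qed
  then have "\<exists>p. \<forall>j. finite (range (p j)) \<and> (\<forall>y :: 'a. {x :: 'a. p j x = y} \<in> sets borel) \<and>
      (\<forall>x. x \<in> ball (p j x) (1 / real (Suc j)))"
    by (intro choice allI)
  then obtain p :: "nat \<Rightarrow> 'a \<Rightarrow> 'a"
    where p: "\<forall>j. finite (range (p j)) \<and> (\<forall>y. {x. p j x = y} \<in> sets borel) \<and>
      (\<forall>x. x \<in> ball (p j x) (1 / real (Suc j)))" ..
  interpret iid_kernel_sample \<mu> k a M P X "?I - a" \<omega> p
  proof (intro iid_kernel_sample.intro kernel_measure.intro kernel_measure_axioms.intro
      iid_kernel_sample_axioms.intro)
    show "a \<le> deg k \<mu> x" for x using gap[of x] assms(18) by linarith
    show "finite (range (p j))" "{x. p j x = y} \<in> sets borel" "x \<in> ball (p j x) (1 / real (Suc j))" for j x y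
      using p by blast+
  qed (use assms k_le gap in auto)
  note V = assms(21-25)
  obtain \<epsilon> where \<epsilon>: "0 < \<epsilon>" "cball lam \<epsilon> \<subseteq> V" by (rule small_disc[OF V])
  have "AE w in P. converges_compactly (\<lambda>n. Uop k (empirical X n w)) (Uop k \<mu>)"
    using AE_kernel_approximation by eventually_elim (rule kernel_approximation.converges_compactly_Us)
  moreover have "AE w in P. \<forall>\<^sub>F n in sequentially.
      \<exists>!Pr. is_spectral_projection (Uop k (empirical X n w)) V Pr"
    using AE_spectral_projections[OF V \<epsilon>] by eventually_elim (auto elim: eventually_mono)
  ultimately show ?thesis
    using AE_eigenvalues[OF V] spectral_projection_limit(2)[OF V \<epsilon>] AE_spectral_projection_tendsto[OF V]
    by blast
qed

end
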